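(* Let $|q|<1$. Then \begin{align*} \sum_{i,j\geq 0}\frac{q^{3i^2+4j^2+4ij-2i}}{(q^4;q^4)_i (q^4;q^4)_j}&=\sum_{i,j\geq 0}\frac{q^{i^2+4ij+4j^2+4j}}{(q^4;q^4)_i(q^8;q^8)_j}=\frac{J_{14}J_{28}^2J_{2,28}}{J_{1,28}J_{4,28}J_{8,28}J_{13,28}},\\ \sum_{i,j\geq 0}\frac{q^{3i^2+4j^2+4ij}}{(q^4;q^4)_i (q^4;q^4)_j}&=\sum_{i,j\geq 0}\frac{q^{i^2+4ij+4j^2+2i}}{(q^4;q^4)_i(q^8;q^8)_j}=\frac{J_{14}J_{28}^2J_{6,28}}{J_{3,28}J_{4,28}J_{11,28}J_{12,28}},\\ \sum_{i,j\geq 0}\frac{q^{3i^2+4j^2+4ij+2i+4j}}{(q^4;q^4)_i (q^4;q^4)_j}&=\sum_{i,j\geq 0}\frac{q^{i^2+4ij+4j^2+4i+4j}}{(q^4;q^4)_i(q^8;q^8)_j}=\frac{J_{14}J_{28}^2J_{10,28}}{J_{5,28}J_{8,28}J_{9,28}J_{12,28}}. \end{align*} As a consequence, with $A=\begin{pmatrix}3/2&1\\1&2\end{pmatrix}$ and $q=e^{2\pi i\tau}$, the functions $f_{A,(-1/2,0)^{\mathrm T},1/168}(q^{168})$ and $f_{A,(0,0)^{\mathrm T},-5/168}(q^{168})$ are modular functions on $\Gamma_1(28224)$, and $f_{A,(1/2,1)^{\mathrm T},5/21}(q^{84})$ is a modular function on $\Gamma_1(14112)$.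
   Context: Notation: $(a;q)_n=\prod_{k=0}^{n-1}(1-aq^k)$, $(a;q)_\infty=\prod_{k\ge0}(1-aq^k)$, $(a_1,\dots,a_m;q)_n=(a_1;q)_n\cdots(a_m;q)_n$; $J_m=(q^m;q^m)_\infty$ and $J_{a,m}=(q^a,q^{m-a},q^m;q^m)_\infty$. Fractional powers $q^{x}$ mean $e^{2\pi i x\tau}$ where $q=e^{2\pi i\tau}$, $\tau$ in the upper half-plane. For a positive definite symmetric rational $2\times2$ matrix $A$, a rational vector $B$ and rational scalar $C$, the Nahm sum is $f_{A,B,C}(q)=\sum_{n=(n_1,n_2)^{\mathrm T}\in\mathbb{Z}_{\ge0}^2}\frac{q^{\frac12 n^{\mathrm T}An+n^{\mathrm T}B+C}}{(q;q)_{n_1}(q;q)_{n_2}}$. $\Gamma_1(N)=\{\gamma\in\mathrm{SL}_2(\mathbb Z):\gamma\equiv\begin{pmatrix}1&*\\0&1\end{pmatrix}\pmod N\}$.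
   Formalization: The last claim is false as printed: with C=5/21 the function is q^{15/2} times a modular function. It is replaced by: f_{A,(1/2,1)^T,25/168}(q^{168}) is a modular function on Γ_1(28224) (instead of C=5/21, q^{84} and Γ_1(14112)). *)

theory Defs
  imports "HOL-Complex_Analysis.Complex_Analysis" "HOL-Number_Theory.Cong"
begin

definition qpoch :: "complex \<Rightarrow> complex \<Rightarrow> nat \<Rightarrow> complex" where
  "qpoch a q n = (\<Prod>k<n. 1 - a * q ^ k)"

definition qpoch_inf :: "complex \<Rightarrow> complex \<Rightarrow> complex" where
  "qpoch_inf a q = (\<Prod>k. 1 - a * q ^ k)"

definition J :: "nat \<Rightarrow> complex \<Rightarrow> complex" where
  "J m q = qpoch_inf (q ^ m) (q ^ m)"

(* Only meant for a <= m, where the natural-number subtraction does not truncate. *)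
definition J2 :: "nat \<Rightarrow> nat \<Rightarrow> complex \<Rightarrow> complex" where
  "J2 a m q = qpoch_inf (q ^ a) (q ^ m) * qpoch_inf (q ^ (m - a)) (q ^ m) * qpoch_inf (q ^ m) (q ^ m)"

abbreviation upper_half_plane :: "complex set" where
  "upper_half_plane \<equiv> {\<tau>. Im \<tau> > 0}"

(* q^x for q = exp (2 pi i tau) *)
definition qpow :: "complex \<Rightarrow> rat \<Rightarrow> complex" where
  "qpow \<tau> x = exp (2 * of_real pi * \<i> * of_rat x * \<tau>)"

definition dot :: "rat ^ 2 \<Rightarrow> rat ^ 2 \<Rightarrow> rat" where
  "dot x y = (\<Sum>k\<in>UNIV. x $ k * y $ k)"

(* The Nahm sum as a function of tau, where q = exp (2 pi i tau). Hence the value of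
   f_{A,B,C} at q^M is nahm_sum A B C (M * tau). *)
definition nahm_sum :: "rat ^ 2 ^ 2 \<Rightarrow> rat ^ 2 \<Rightarrow> rat \<Rightarrow> complex \<Rightarrow> complex" where
  "nahm_sum A B C \<tau> =
     (\<Sum>\<^sub>\<infinity>(n1, n2)\<in>(UNIV :: (nat \<times> nat) set).
        (let n = (vector [of_nat n1, of_nat n2] :: rat ^ 2); q = qpow \<tau> 1 in
          qpow \<tau> (1/2 * dot n (A *v n) + dot n B + C) / (qpoch q q n1 * qpoch q q n2)))"

definition SL2Z :: "(int ^ 2 ^ 2) set" where
  "SL2Z = {\<gamma>. det \<gamma> = 1}"

definition Gamma1 :: "nat \<Rightarrow> (int ^ 2 ^ 2) set" where
  "Gamma1 N = {\<gamma> \<in> SL2Z. [\<gamma> $ 1 $ 1 = 1] (mod int N) \<and> [\<gamma> $ 2 $ 1 = 0] (mod int N) \<and>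
                         [\<gamma> $ 2 $ 2 = 1] (mod int N)}"

definition act :: "int ^ 2 ^ 2 \<Rightarrow> complex \<Rightarrow> complex" where
  "act \<gamma> = moebius (of_int (\<gamma> $ 1 $ 1)) (of_int (\<gamma> $ 1 $ 2))
                  (of_int (\<gamma> $ 2 $ 1)) (of_int (\<gamma> $ 2 $ 2))"

(* A modular function on G: meromorphic on the upper half-plane, G-invariant, and
   meromorphic at every cusp. The last condition says that, for each gamma in SL2(Z),
   f (gamma tau) is near i * infinity a function of q_h = exp (2 pi i tau / h), for some
   h >= 1, that is meromorphic at q_h = 0 (a Laurent series in q_h with finite principal part).
   "Nicely" meromorphic fixes the values at poles and removable singularities, so that
   invariance can be stated pointwise. *)
definition modular_function_on :: "(int ^ 2 ^ 2) set \<Rightarrow> (complex \<Rightarrow> complex) \<Rightarrow> bool" where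
  "modular_function_on G f \<longleftrightarrow>
     f nicely_meromorphic_on upper_half_plane \<and>
     (\<forall>\<gamma>\<in>G. \<forall>\<tau>\<in>upper_half_plane. f (act \<gamma> \<tau>) = f \<tau>) \<and>
     (\<forall>\<gamma>\<in>SL2Z. \<exists>h::nat. h > 0 \<and> (\<exists>g Y. g meromorphic_on {0} \<and> Y \<ge> 0 \<and>
        (\<forall>\<tau>. Im \<tau> > Y \<longrightarrow> f (act \<gamma> \<tau>) = g (exp (2 * of_real pi * \<i> * \<tau> / of_nat h)))))"

end

theory Submission
  imports Defs
begin

text \<open>
  Substituting \<open>n = i + 2 j\<close> in the sums over \<open>(q\<^sup>4;q\<^sup>4)\<^sub>i (q\<^sup>8;q\<^sup>8)\<^sub>j\<close> gives
  \<open>\<Sum> q\<^bsup>n\<^sup>2\<^esup> c\<^sub>n\<close>, where \<open>c\<^sub>n\<close> is the coefficient of \<open>z\<^sup>n\<close> in \<open>1 / ((x z; Q) (s z\<^sup>2; Q\<^sup>2))\<close> for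
  \<open>Q = q\<^sup>4\<close>; multiplying numerator and denominator by \<open>(- x z; Q)\<close> turns the denominator into
  \<open>(x\<^sup>2 z\<^sup>2; Q\<^sup>2) (s z\<^sup>2; Q\<^sup>2)\<close>, which for the relevant \<open>x, s\<close> is a product \<open>(y z\<^sup>2; Q)\<close>, and the coefficients
  of \<open>(- x z; Q) / (y z\<^sup>2; Q)\<close> give the other double sums. The \<open>q\<close>-Pascal rules, followed by a change of base
  from \<open>Q\<^sup>2\<close> to \<open>Q\<close>, show that \<open>c\<^sub>n = \<Sum> w(b - a) / ((Q;Q)\<^sub>a (Q;Q)\<^sub>b)\<close> over \<open>a + b = n\<close>, where the
  weights \<open>w(r)\<close> are signed powers depending on \<open>r\<close> modulo 3, or zero. Summing along \<open>b - a = r\<close> instead, the Durfee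
  rectangle identity leaves \<open>\<Sum> w(r) q\<^bsup>r\<^sup>2\<^esup>\<close> divided by \<open>(Q;Q)\<close> (infinite product), and this theta series is
  evaluated by the quintuple product identity with base \<open>q\<^bsup>14\<^esup>\<close>.

  For modularity, the products are rewritten as quotients of Klein forms. The transformation of Klein
  forms under \<open>SL\<^sub>2(\<int>)\<close> follows from Liouville's theorem, since the quotient of the two sides is
  an entire elliptic function, and no multiplier system of \<open>\<eta>\<close> is needed. At a cusp, the
  translated function is periodic and holomorphic, and an elementary estimate of the infinite products
  shows that it grows at most exponentially in \<open>Im \<tau>\<close>; hence it is meromorphic in the local parameter.
\<close>

section \<open>Weighted sums of Gaussian binomials\<close>

text \<open>The weights vanish on one residue class modulo 3. The two surviving classes supply the
  terms 1 and z p^k of the factor 1 + z p^k in the quintuple product, which is why that identity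
  evaluates the theta series. The obstacle is a mismatch of bases: the weighted sums with a closed
  form have base Q^2, while Durfee rectangles need base Q. Expanding 1 / ((Q;Q)_a (Q;Q)_b) into
  terms with base Q^2 costs exactly the sum over s^j / (Q^2;Q^2)_j that is already present in c_n,
  and it does not change b - a, on which the weights depend. On the modular side, Klein forms at
  28-torsion points account for the J_{a,28} but leave J_14 J_28^-7 over. That factor is assembled
  from Klein forms at 3-torsion and 4-torsion points so that the total weight is 0. The divisibility
  conditions used for all these points have least common multiple 28224 = 168^2.\<close>

lemma qpoch_0 [simp]: "qpoch a q 0 = 1"
  by (simp add: qpoch_def)

lemma qpoch_Suc: "qpoch a q (Suc n) = qpoch a q n * (1 - a * q ^ n)"
  by (simp add: qpoch_def)

lemma qpoch_rec: "qpoch a q (Suc n) = (1 - a) * qpoch (a * q) q n"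
  unfolding qpoch_def by (subst prod.lessThan_Suc_shift) (simp add: mult_ac)

lemma qpoch_nonzero:
  assumes "norm q < 1" "norm a < 1"
  shows "qpoch a q n \<noteq> 0"
proof -
  have "a * q ^ k \<noteq> 1" for k
  proof
    assume "a * q ^ k = 1"
    hence "norm a * norm q ^ k = 1" by (metis norm_mult norm_one norm_power)
    moreover have "norm a * norm q ^ k \<le> norm a * 1"
      using assms by (intro mult_left_mono power_le_one) auto
    ultimately show False using assms by auto
  qed
  thus ?thesis by (auto simp: qpoch_def)
qed

lemma qpoch_square: "qpoch a q n * qpoch (- a) q n = qpoch (a\<^sup>2) (q\<^sup>2) n"
  unfolding qpoch_def prod.distrib [symmetric]
  by (rule prod.cong) (auto simp: algebra_simps power2_eq_square power_mult_distrib)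

text \<open>The convention \<open>1 / (q;q)\<^sub>a = 0\<close> for \<open>a < 0\<close> makes the recurrences hold for all integers.\<close>

definition rqfact2 :: "complex \<Rightarrow> int \<Rightarrow> int \<Rightarrow> complex" where
  "rqfact2 q a b =
     (if a < 0 \<or> b < 0 then 0 else 1 / (qpoch q q (nat a) * qpoch q q (nat b)))"

lemma powi_add_eq_power:
  assumes "(x :: complex) \<noteq> 0" "a + b = int n"
  shows "x powi a * x powi b = x ^ n"
  using assms by (metis power_int_add power_int_of_nat)

lemma square_power_mult_powi:
  assumes "(x :: complex) \<noteq> 0"
  shows "(x\<^sup>2) ^ n * x powi m = x powi (2 * int n + m)"
proof -
  have "(x\<^sup>2) ^ n = x powi (2 * int n)"
    by (metis power_int_of_nat power_mult of_nat_mult of_nat_numeral)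
  thus ?thesis using assms by (simp add: power_int_add)
qed

lemma power_mult_powi:
  assumes "(x :: complex) \<noteq> 0"
  shows "x ^ n * x powi m = x powi (int n + m)"
  using assms by (simp add: power_int_add)

lemma rqfact2_commute: "rqfact2 q a b = rqfact2 q b a"
  by (simp add: rqfact2_def)

lemma rqfact2_pred:
  assumes "norm q < 1"
  shows "rqfact2 q (a - 1) b = (1 - q powi a) * rqfact2 q a b"
proof (cases "a \<le> 0 \<or> b < 0")
  case True
  thus ?thesis by (cases "a = 0") (auto simp: rqfact2_def)
next
  case False
  then obtain m where m: "a = int (Suc m)" by (metis not_le zero_less_imp_eq_int gr0_implies_Suc)
  have "qpoch q q (Suc m) \<noteq> 0" using assms by (intro qpoch_nonzero)
  moreover have "nat (int (Suc m)) = Suc m" "nat (int (Suc m) - 1) = m" by auto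
  moreover have "q powi int (Suc m) = q * q ^ m"
    unfolding power_int_of_nat by simp
  ultimately show ?thesis using False m
    by (auto simp: rqfact2_def qpoch_Suc)
qed

lemma rqfact2_pred':
  assumes "norm q < 1"
  shows "rqfact2 q a (b - 1) = (1 - q powi b) * rqfact2 q a b"
  using rqfact2_pred[OF assms, of b a] by (simp add: rqfact2_commute)

text \<open>1 - p^(n+1) = (1 - p^a) + p^a (1 - p^(n+1-a)), and each of the two factors lowers one
  index of \<open>rqfact2\<close>. This is a q-Pascal rule for Gaussian binomials, without their
  normalising factor (p;p)_n, summed against an arbitrary weight.\<close>

lemma qpascal_sum1:
  assumes "norm p < 1" "p \<noteq> 0"
  shows "(1 - p ^ Suc n) * (\<Sum>a\<le>Suc n. u (int (Suc n) - 2 * int a) * rqfact2 p a (int (Suc n) - a)) =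
    (\<Sum>a\<le>n. (u (int n - 2 * int a - 1) + p ^ a * u (int n - 2 * int a + 1)) * rqfact2 p a (int n - a))"
proof -
  let ?h = "\<lambda>a. rqfact2 p (int a) (int (Suc n) - int a)"
  let ?u = "\<lambda>a. u (int (Suc n) - 2 * int a)"
  have "(1 - p ^ Suc n) * ?h a = (1 - p powi a) * ?h a + p ^ a * ((1 - p powi (int (Suc n) - a)) * ?h a)" for a
  proof -
    have "p ^ Suc n = p powi int a * p powi (int (Suc n) - int a)"
      using assms powi_add_eq_power[of p "int a" "int (Suc n) - int a" "Suc n"] by simp
    thus ?thesis by (simp add: algebra_simps)
  qed
  hence "(1 - p ^ Suc n) * ?h a = rqfact2 p (int a - 1) (int (Suc n) - int a) + p ^ a * rqfact2 p a (int n - a)" for a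
    using rqfact2_pred[OF assms(1), of "int a" "int (Suc n) - int a"]
      rqfact2_pred'[OF assms(1), of "int a" "int (Suc n) - int a"] by simp
  hence "(1 - p ^ Suc n) * (\<Sum>a\<le>Suc n. ?u a * ?h a) =
    (\<Sum>a\<le>Suc n. ?u a * rqfact2 p (int a - 1) (int (Suc n) - int a)) +
    (\<Sum>a\<le>Suc n. ?u a * (p ^ a * rqfact2 p a (int n - a)))"
    unfolding sum_distrib_left sum.distrib [symmetric]
    by (intro sum.cong refl) (metis (no_types, lifting) distrib_left mult.left_commute)
  also have "(\<Sum>a\<le>Suc n. ?u a * rqfact2 p (int a - 1) (int (Suc n) - int a)) =
    (\<Sum>a\<le>n. u (int n - 2 * int a - 1) * rqfact2 p a (int n - a))"
    by (subst sum.atMost_Suc_shift) (simp add: rqfact2_def algebra_simps)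
  also have "(\<Sum>a\<le>Suc n. ?u a * (p ^ a * rqfact2 p a (int n - a))) =
    (\<Sum>a\<le>n. u (int n - 2 * int a + 1) * (p ^ a * rqfact2 p a (int n - a)))"
    by (simp add: rqfact2_def algebra_simps)
  finally show ?thesis by (simp only: sum.distrib distrib_right distrib_left mult_ac)
qed

text \<open>The other q-Pascal rule: the reflection of a to n - a negates the argument of the
  weight, so \<open>qpascal_sum1\<close> is applied to u(-r).\<close>

lemma qpascal_sum2:
  assumes "norm p < 1" "p \<noteq> 0"
  shows "(1 - p ^ Suc n) * (\<Sum>a\<le>Suc n. u (int (Suc n) - 2 * int a) * rqfact2 p a (int (Suc n) - a)) =
    (\<Sum>a\<le>n. (u (int n - 2 * int a + 1) + p ^ (n - a) * u (int n - 2 * int a - 1)) * rqfact2 p a (int n - a))"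
proof -
  have "(\<Sum>a\<le>Suc n. u (int (Suc n) - 2 * int a) * rqfact2 p a (int (Suc n) - a)) =
        (\<Sum>a\<le>Suc n. u (- (int (Suc n) - 2 * int a)) * rqfact2 p a (int (Suc n) - a))"
    by (rule sum.reindex_bij_witness[of _ "\<lambda>a. Suc n - a" "\<lambda>a. Suc n - a"])
       (auto simp: of_nat_diff algebra_simps rqfact2_commute)
  hence "(1 - p ^ Suc n) * (\<Sum>a\<le>Suc n. u (int (Suc n) - 2 * int a) * rqfact2 p a (int (Suc n) - a)) =
    (\<Sum>a\<le>n. (u (- (int n - 2 * int a - 1)) + p ^ a * u (- (int n - 2 * int a + 1))) * rqfact2 p a (int n - a))"
    using qpascal_sum1[OF assms, where u = "\<lambda>r. u (- r)" and n = n] by simp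
  also have "\<dots> = (\<Sum>a\<le>n. (u (int n - 2 * int a + 1) + p ^ (n - a) * u (int n - 2 * int a - 1)) * rqfact2 p a (int n - a))"
    by (rule sum.reindex_bij_witness[of _ "\<lambda>a. n - a" "\<lambda>a. n - a"])
       (auto simp: of_nat_diff algebra_simps rqfact2_commute)
  finally show ?thesis .
qed

text \<open>In terms of p = Q^2 the exponents are k(3k+1)/2, the pentagonal numbers: the limit of
  \<open>wA_sum\<close> for n to infinity is Euler's pentagonal number theorem.\<close>

definition wA :: "complex \<Rightarrow> int \<Rightarrow> complex" where
  "wA Q r = (let k = r div 3 in
     if r mod 3 = 2 then 0 else (-1) powi k * Q powi (3 * k\<^sup>2 + k))"

definition wB :: "complex \<Rightarrow> int \<Rightarrow> complex" where
  "wB Q r = (let k = r div 3 in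
     if r mod 3 = 1 then 0
     else (if r mod 3 = 0 then 1 else -1) * (-1) powi k * Q powi (3 * k\<^sup>2 + 2 * k))"

definition wC :: "complex \<Rightarrow> int \<Rightarrow> complex" where
  "wC t r = (let k = r div 3 in
     if r mod 3 = 2 then 0
     else (-1) powi k * t powi (if r mod 3 = 0 then 6 * k\<^sup>2 - k else 6 * k\<^sup>2 + 5 * k + 1))"

lemma div_mod_3 [simp]:
  "(3 * k :: int) div 3 = k" "(3 * k + 1 :: int) div 3 = k" "(3 * k + 2 :: int) div 3 = k"
  "(3 * k :: int) mod 3 = 0" "(3 * k + 1 :: int) mod 3 = 1" "(3 * k + 2 :: int) mod 3 = 2"
  "(3 * k - 1 :: int) div 3 = k - 1" "(3 * k - 1 :: int) mod 3 = 2"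
  by presburger+

lemma wA_simps:
  "wA Q (3 * k) = (-1) powi k * Q powi (3 * k\<^sup>2 + k)"
  "wA Q (3 * k + 1) = (-1) powi k * Q powi (3 * k\<^sup>2 + k)"
  "wA Q (3 * k + 2) = 0"
  by (simp_all add: wA_def)

lemma wB_simps:
  "wB Q (3 * k) = (-1) powi k * Q powi (3 * k\<^sup>2 + 2 * k)"
  "wB Q (3 * k + 1) = 0"
  "wB Q (3 * k + 2) = - ((-1) powi k * Q powi (3 * k\<^sup>2 + 2 * k))"
  by (simp_all add: wB_def)

lemma wC_simps:
  "wC t (3 * k) = (-1) powi k * t powi (6 * k\<^sup>2 - k)"
  "wC t (3 * k + 1) = (-1) powi k * t powi (6 * k\<^sup>2 + 5 * k + 1)"
  "wC t (3 * k + 2) = 0"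
  by (simp_all add: wC_def)

lemma mod3_cases:
  fixes r :: int
  obtains k where "r = 3 * k" | k where "r = 3 * k + 1" | k where "r = 3 * k + 2"
proof -
  have "r mod 3 = 0 \<or> r mod 3 = 1 \<or> r mod 3 = 2" by presburger
  thus ?thesis using that[of "r div 3"] by (metis add.right_neutral mult_div_mod_eq)
qed

lemma minus_one_powi_add1: "(-1 :: complex) powi (k + 1) = - ((-1) powi k)"
  by (simp add: power_int_add)

lemma minus_one_powi_diff1: "(-1 :: complex) powi (k - 1) = - ((-1) powi k)"
  by (simp add: power_int_diff)

lemma minus_one_powi_minus: "(-1 :: complex) powi (- k) = (-1) powi k"
  by (simp add: power_int_minus_left)

text \<open>The induction works because residue class 0 is expanded with one q-Pascal rule and class
  1 with the other. At an index r that is 0 or 1 modulo 3, exactly one term survives and it equals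
  \<open>wA Q r\<close>; at an index that is 2 modulo 3, two terms survive and cancel.\<close>

lemma wA_sum:
  assumes "norm Q < 1" "Q \<noteq> 0"
  shows "(\<Sum>a\<le>n. wA Q (int n - 2 * int a) * rqfact2 (Q\<^sup>2) a (int n - a)) = 1 / qpoch (Q\<^sup>2) (Q\<^sup>2) n"
proof (induction n)
  case 0
  show ?case by (simp add: wA_def rqfact2_def)
next
  case (Suc n)
  define u0 where "u0 r = (if r mod 3 = 0 then wA Q r else 0)" for r
  define u1 where "u1 r = (if r mod 3 = 1 then wA Q r else 0)" for r
  have P: "norm (Q\<^sup>2) < 1" "Q\<^sup>2 \<noteq> 0" using assms by (auto simp: norm_power power_less_one_iff)
  have u: "wA Q r = u0 r + u1 r" for r
    by (cases r rule: mod3_cases) (simp_all add: u0_def u1_def wA_simps)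
  have key: "u0 (r - 1) + (Q\<^sup>2) ^ a * u0 (r + 1) + (u1 (r + 1) + (Q\<^sup>2) ^ (n - a) * u1 (r - 1)) = wA Q r"
    if a: "a \<le> n" and r: "r = int n - 2 * int a" for r a
  proof (cases r rule: mod3_cases)
    case (1 k)
    show ?thesis unfolding 1 by (simp add: u0_def u1_def wA_simps)
  next
    case (2 k)
    have *: "3 * k + 1 + 1 = 3 * k + 2" by simp
    show ?thesis unfolding 2 * by (simp add: u0_def u1_def wA_simps)
  next
    case (3 k)
    have *: "3 * k + 2 + 1 = 3 * (k + 1)" "3 * k + 2 - 1 = 3 * k + 1" by simp_all
    \<comment> \<open>The cancellation in class 2: because n - 2a = 3k + 2 the two exponents agree,
      while (-1)^(k+1) and (-1)^k are opposite.\<close>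
    have "(Q\<^sup>2) ^ a * Q powi (3 * (k + 1)\<^sup>2 + (k + 1)) = Q powi (2 * int a + (3 * (k + 1)\<^sup>2 + (k + 1)))"
      using assms(2) by (rule square_power_mult_powi)
    also have "2 * int a + (3 * (k + 1)\<^sup>2 + (k + 1)) = 2 * int (n - a) + (3 * k\<^sup>2 + k)"
      using a r 3 by (simp add: of_nat_diff power2_eq_square algebra_simps)
    also have "Q powi \<dots> = (Q\<^sup>2) ^ (n - a) * Q powi (3 * k\<^sup>2 + k)"
      using assms(2) by (rule square_power_mult_powi [symmetric])
    finally show ?thesis unfolding 3 *
      by (simp only: u0_def u1_def wA_simps div_mod_3 minus_one_powi_add1) (simp add: mult_ac)
  qed
  have "(1 - (Q\<^sup>2) ^ Suc n) * (\<Sum>a\<le>Suc n. wA Q (int (Suc n) - 2 * int a) * rqfact2 (Q\<^sup>2) a (int (Suc n) - a))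
     = (1 - (Q\<^sup>2) ^ Suc n) * (\<Sum>a\<le>Suc n. u0 (int (Suc n) - 2 * int a) * rqfact2 (Q\<^sup>2) a (int (Suc n) - a)) +
       (1 - (Q\<^sup>2) ^ Suc n) * (\<Sum>a\<le>Suc n. u1 (int (Suc n) - 2 * int a) * rqfact2 (Q\<^sup>2) a (int (Suc n) - a))"
    unfolding u by (simp only: distrib_left distrib_right sum.distrib)
  also have "\<dots> = (\<Sum>a\<le>n. wA Q (int n - 2 * int a) * rqfact2 (Q\<^sup>2) a (int n - a))"
    unfolding qpascal_sum1[OF P, where u = u0] qpascal_sum2[OF P, where u = u1] sum.distrib [symmetric] distrib_right [symmetric]
    by (intro sum.cong refl) (use key in auto)
  finally show ?case using Suc.IH qpoch_nonzero[OF P(1) P(1), of "Suc n"]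
    by (simp add: qpoch_Suc field_simps)
qed

text \<open>A single q-Pascal step turns the \<open>wB\<close> sum at n + 1 into Q^(n+1) times the
  reflected \<open>wA\<close> sum at n, so \<open>wA_sum\<close> finishes the proof without an
  induction.\<close>

lemma wB_sum:
  assumes "norm Q < 1" "Q \<noteq> 0"
  shows "(\<Sum>a\<le>n. wB Q (int n - 2 * int a) * rqfact2 (Q\<^sup>2) a (int n - a)) = Q ^ n / qpoch (Q\<^sup>2) (Q\<^sup>2) n"
proof (cases n)
  case 0
  thus ?thesis by (simp add: wB_def rqfact2_def)
next
  case (Suc n)
  define u0 where "u0 r = (if r mod 3 = 0 then wB Q r else 0)" for r
  define u2 where "u2 r = (if r mod 3 = 2 then wB Q r else 0)" for r
  have P: "norm (Q\<^sup>2) < 1" "Q\<^sup>2 \<noteq> 0" using assms by (auto simp: norm_power power_less_one_iff)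
  have u: "wB Q r = u0 r + u2 r" for r
    by (cases r rule: mod3_cases) (simp_all add: u0_def u2_def wB_simps)
  have key: "u0 (r - 1) + (Q\<^sup>2) ^ a * u0 (r + 1) + (u2 (r + 1) + (Q\<^sup>2) ^ (n - a) * u2 (r - 1)) =
       Q ^ Suc n * wA Q (- r)"
    if a: "a \<le> n" and r: "r = int n - 2 * int a" for r a
  proof (cases r rule: mod3_cases)
    case (1 k)
    have *: "- (3 * k) = 3 * (- k)" by simp
    have wB': "wB Q (3 * k - 1) = (-1) powi k * Q powi (3 * (k - 1)\<^sup>2 + 2 * (k - 1))"
      unfolding wB_def Let_def div_mod_3 by (simp add: minus_one_powi_diff1)
    have "(Q\<^sup>2) ^ (n - a) * Q powi (3 * (k - 1)\<^sup>2 + 2 * (k - 1)) = Q powi (2 * int (n - a) + (3 * (k - 1)\<^sup>2 + 2 * (k - 1)))"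
      using assms(2) by (rule square_power_mult_powi)
    also have "2 * int (n - a) + (3 * (k - 1)\<^sup>2 + 2 * (k - 1)) = int (Suc n) + (3 * (-k)\<^sup>2 + (-k))"
      using a r 1 by (simp add: of_nat_diff power2_eq_square algebra_simps)
    also have "Q powi \<dots> = Q ^ Suc n * Q powi (3 * (-k)\<^sup>2 + (-k))"
      using assms(2) by (rule power_mult_powi [symmetric])
    finally show ?thesis unfolding 1 * wA_simps
      by (simp only: u0_def u2_def wB' wB_simps div_mod_3 minus_one_powi_minus) (simp add: mult_ac)
  next
    case (2 k)
    have *: "3 * k + 1 + 1 = 3 * k + 2" "- (3 * k + 1) = 3 * (- k - 1) + 2" by simp_all
    show ?thesis unfolding 2 * wA_simps by (simp add: u0_def u2_def wB_simps)
  next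
    case (3 k)
    have *: "3 * k + 2 + 1 = 3 * (k + 1)" "3 * k + 2 - 1 = 3 * k + 1" "- (3 * k + 2) = 3 * (- (k + 1)) + 1" by simp_all
    have "(Q\<^sup>2) ^ a * Q powi (3 * (k + 1)\<^sup>2 + 2 * (k + 1)) = Q powi (2 * int a + (3 * (k + 1)\<^sup>2 + 2 * (k + 1)))"
      using assms(2) by (rule square_power_mult_powi)
    also have "2 * int a + (3 * (k + 1)\<^sup>2 + 2 * (k + 1)) = int (Suc n) + (3 * (- (k + 1))\<^sup>2 + (- (k + 1)))"
      using a r 3 by (simp add: of_nat_diff power2_eq_square algebra_simps)
    also have "Q powi \<dots> = Q ^ Suc n * Q powi (3 * (- (k + 1))\<^sup>2 + (- (k + 1)))"
      using assms(2) by (rule power_mult_powi [symmetric])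
    finally show ?thesis unfolding 3 * wA_simps minus_one_powi_minus
      by (simp only: u0_def u2_def wB_simps div_mod_3 minus_one_powi_add1) (simp add: mult_ac)
  qed
  have "(1 - (Q\<^sup>2) ^ Suc n) * (\<Sum>a\<le>Suc n. wB Q (int (Suc n) - 2 * int a) * rqfact2 (Q\<^sup>2) a (int (Suc n) - a))
     = (1 - (Q\<^sup>2) ^ Suc n) * (\<Sum>a\<le>Suc n. u0 (int (Suc n) - 2 * int a) * rqfact2 (Q\<^sup>2) a (int (Suc n) - a)) +
       (1 - (Q\<^sup>2) ^ Suc n) * (\<Sum>a\<le>Suc n. u2 (int (Suc n) - 2 * int a) * rqfact2 (Q\<^sup>2) a (int (Suc n) - a))"
    unfolding u by (simp only: distrib_left distrib_right sum.distrib)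
  also have "\<dots> = (\<Sum>a\<le>n. Q ^ Suc n * wA Q (- (int n - 2 * int a)) * rqfact2 (Q\<^sup>2) a (int n - a))"
    unfolding qpascal_sum1[OF P, where u = u0] qpascal_sum2[OF P, where u = u2] sum.distrib [symmetric] distrib_right [symmetric]
    by (intro sum.cong refl) (use key in auto)
  also have "\<dots> = Q ^ Suc n * (\<Sum>a\<le>n. wA Q (- (int n - 2 * int a)) * rqfact2 (Q\<^sup>2) a (int n - a))"
    by (simp only: sum_distrib_left mult.assoc)
  also have "(\<Sum>a\<le>n. wA Q (- (int n - 2 * int a)) * rqfact2 (Q\<^sup>2) a (int n - a)) =
      (\<Sum>a\<le>n. wA Q (int n - 2 * int a) * rqfact2 (Q\<^sup>2) a (int n - a))"
    by (rule sum.reindex_bij_witness[of _ "\<lambda>a. n - a" "\<lambda>a. n - a"])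
       (auto simp: of_nat_diff algebra_simps rqfact2_commute)
  also have "\<dots> = 1 / qpoch (Q\<^sup>2) (Q\<^sup>2) n"
    by (rule wA_sum[OF assms])
  finally show ?thesis using Suc qpoch_nonzero[OF P(1) P(1), of "Suc n"]
    by (simp add: qpoch_Suc field_simps)
qed

text \<open>This factorization is the reason for the choice of \<open>wC\<close>: for q = t^2 the
  factor q^a + q^b in \<open>V2\<close> is a multiple of t^r + t^-r with r = b - a, so sums over
  \<open>wC\<close> reduce to those over \<open>wA\<close> and \<open>wB\<close>.\<close>

lemma wC_eq_wA_wB:
  assumes "t \<noteq> 0"
  shows "wC t r * (t powi r + t powi (- r)) = wA (t\<^sup>2) r + wB (t\<^sup>2) (- r)"
proof -
  have sq: "(t\<^sup>2) powi m = t powi (2 * m)" for m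
    by (metis power_int_mult power_int_of_nat of_nat_numeral)
  show ?thesis
  proof (cases r rule: mod3_cases)
    case (1 k)
    have *: "- (3 * k) = 3 * (- k)" by simp
    have **: "6 * k\<^sup>2 - k + 3 * k = 2 * (3 * k\<^sup>2 + k)" "6 * k\<^sup>2 - k - 3 * k = 2 * (3 * k\<^sup>2 - 2 * k)" by auto
    show ?thesis unfolding 1 * wA_simps wB_simps wC_simps sq minus_one_powi_minus
      using assms by (simp add: algebra_simps ** flip: power_int_add)
  next
    case (2 k)
    have *: "- (3 * k + 1) = 3 * (- (k + 1)) + 2" by simp
    have **: "6 * k\<^sup>2 + 5 * k + 1 + (3 * k + 1) = 2 * (3 * (- (k + 1))\<^sup>2 + 2 * (- (k + 1)))"
       "6 * k\<^sup>2 + 5 * k + 1 + (3 * (- (k + 1)) + 2) = 2 * (3 * k\<^sup>2 + k)"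
      by (auto simp: power2_eq_square algebra_simps)
    have "t powi (6 * k\<^sup>2 + 5 * k + 1) * t powi (3 * k + 1) = t powi (2 * (3 * (- (k + 1))\<^sup>2 + 2 * (- (k + 1))))"
         "t powi (6 * k\<^sup>2 + 5 * k + 1) * t powi (3 * (- (k + 1)) + 2) = t powi (2 * (3 * k\<^sup>2 + k))"
      by (simp_all only: ** power_int_add [OF disjI1, OF assms, symmetric])
    thus ?thesis unfolding 2 * wA_simps wB_simps wC_simps sq minus_one_powi_minus minus_one_powi_add1
      by (simp only: distrib_left mult.assoc) simp
  next
    case (3 k)
    have *: "- (3 * k + 2) = 3 * (- (k + 1)) + 1" by simp
    show ?thesis unfolding 3 * wA_simps wB_simps wC_simps by simp
  qed
qed

section \<open>Change of base\<close>

lemma sum_div2_extend: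
  fixes f :: "nat \<Rightarrow> complex"
  assumes "\<And>j. n < 2 * j \<Longrightarrow> f j = 0" "n < 2 * N"
  shows "(\<Sum>j\<le>n div 2. f j) = (\<Sum>j<N. f j)"
proof (rule sum.mono_neutral_left)
  show "\<forall>j\<in>{..<N} - {..n div 2}. f j = 0"
  proof
    fix j assume "j \<in> {..<N} - {..n div 2}"
    hence "n < 2 * j" by auto
    thus "f j = 0" by (rule assms)
  qed
qed (use assms in auto)

lemma rqfact2_recurrence:
  assumes "norm q < 1" "q \<noteq> 0"
  shows "rqfact2 q a b - rqfact2 q (a - 1) b - rqfact2 q a (b - 1) + rqfact2 q (a - 1) (b - 1) =
         q powi (a + b) * rqfact2 q a b"
  using assms by (simp add: rqfact2_pred rqfact2_pred' power_int_add algebra_simps)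

text \<open>In terms of generating functions, the recurrence says that
  \<open>F(y, w) = \<Sum> V a b y\<^sup>a w\<^sup>b\<close> satisfies \<open>(1 - y) (1 - w) F(y, w) = (1 - s y w) F(q y, q w)\<close>.\<close>

lemma convolution_eq_rqfact2:
  fixes q s :: complex and V :: "int \<Rightarrow> int \<Rightarrow> complex"
  assumes q: "norm q < 1" "q \<noteq> 0"
    and neg: "\<And>a b. a < 0 \<or> b < 0 \<Longrightarrow> V a b = 0"
    and V0: "V 0 0 = 1"
    and rec: "\<And>a b. V a b - V (a - 1) b - V a (b - 1) + V (a - 1) (b - 1) =
                q powi (a + b) * V a b - s * q powi (a + b - 2) * V (a - 1) (b - 1)"
  assumes N: "a + b < 2 * int N"
  shows "(\<Sum>j<N. s ^ j / qpoch (q\<^sup>2) (q\<^sup>2) j * V (a - j) (b - j)) = rqfact2 q a b"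
  using N
proof (induction "nat (a + b)" arbitrary: a b rule: less_induct)
  case (less a b)
  define e where "e j = s ^ j / qpoch (q\<^sup>2) (q\<^sup>2) j" for j
  define U where "U a b = (\<Sum>j<N. e j * V (a - int j) (b - int j))" for a b
  have P: "norm (q\<^sup>2) < 1" using q by (auto simp: norm_power power_less_one_iff)
  have IH: "U a' b' = rqfact2 q a' b'" if "nat (a' + b') < nat (a + b)" "a' + b' < a + b" for a' b'
    using less.hyps[of a' b'] that less.prems unfolding U_def e_def by auto
  \<comment> \<open>The series E(v) with coefficients \<open>e\<close> is 1 / (s v; q^2) and
    satisfies E(v) (1 - s v) = E(q^2 v). Multiplying F by E(y w) therefore removes the factor 1 - s
    y w and leaves the equation satisfied by 1 / ((y;q) (w;q)).\<close>
  have e_Suc: "e (Suc j) * (1 - (q\<^sup>2) ^ Suc j) = s * e j" for j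
    using qpoch_nonzero[OF P P, of "Suc j"] by (simp add: e_def qpoch_Suc field_simps)
  consider "a < 0 \<or> b < 0" | "a = 0" "b = 0" | "a \<ge> 0" "b \<ge> 0" "a + b > 0" by linarith
  hence "U a b = rqfact2 q a b"
  proof cases
    case 1
    hence "U a b = 0" unfolding U_def by (intro sum.neutral) (auto intro!: neg)
    thus ?thesis using 1 by (simp add: rqfact2_def)
  next
    case 2
    have "U a b = (\<Sum>j\<in>{0}. e j * V (a - int j) (b - int j))"
      unfolding U_def using 2 less.prems by (intro sum.mono_neutral_right) (auto intro!: neg)
    thus ?thesis using 2 V0 by (simp add: rqfact2_def e_def)
  next
    case 3
    obtain M where M: "N = Suc M" using 3 less.prems by (cases N) auto
    have "U a b - U (a - 1) b - U a (b - 1) + U (a - 1) (b - 1) =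
       (\<Sum>j<N. e j * (V (a - int j) (b - int j) - V (a - int j - 1) (b - int j)
             - V (a - int j) (b - int j - 1) + V (a - int j - 1) (b - int j - 1)))"
      unfolding U_def sum_subtractf [symmetric] sum.distrib [symmetric]
      by (intro sum.cong refl) (simp add: algebra_simps)
    also have "\<dots> = (\<Sum>j<N. e j * q powi (a + b - 2 * int j) * V (a - int j) (b - int j)) -
         (\<Sum>j<N. s * e j * q powi (a + b - 2 * int (Suc j)) * V (a - int (Suc j)) (b - int (Suc j)))"
      unfolding rec sum_subtractf [symmetric]
      by (intro sum.cong refl) (simp add: algebra_simps)
    \<comment> \<open>The term j = N - 1 vanishes, since a + b < 2N makes one of its indices
      negative.\<close>
    also have "(\<Sum>j<N. s * e j * q powi (a + b - 2 * int (Suc j)) * V (a - int (Suc j)) (b - int (Suc j))) =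
        (\<Sum>j<M. s * e j * q powi (a + b - 2 * int (Suc j)) * V (a - int (Suc j)) (b - int (Suc j)))"
      using less.prems M by (subst M, subst sum.lessThan_Suc) (auto intro!: neg)
    also have "\<dots> = (\<Sum>j<M. e (Suc j) * (1 - (q\<^sup>2) ^ Suc j) * q powi (a + b - 2 * int (Suc j)) * V (a - int (Suc j)) (b - int (Suc j)))"
      by (simp only: e_Suc)
    also have "\<dots> = (\<Sum>j<N. e j * (1 - (q\<^sup>2) ^ j) * q powi (a + b - 2 * int j) * V (a - int j) (b - int j))"
      unfolding M by (subst sum.lessThan_Suc_shift) simp
    also have "(\<Sum>j<N. e j * q powi (a + b - 2 * int j) * V (a - int j) (b - int j)) - \<dots> =
        (\<Sum>j<N. e j * ((q\<^sup>2) ^ j * q powi (a + b - 2 * int j)) * V (a - int j) (b - int j))"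
      unfolding sum_subtractf [symmetric] by (intro sum.cong refl) (simp add: algebra_simps)
    also have "\<dots> = q powi (a + b) * U a b"
      unfolding square_power_mult_powi[OF q(2)] U_def sum_distrib_left
      by (intro sum.cong refl) (simp add: mult_ac)
    finally have "(1 - q powi (a + b)) * U a b = U (a - 1) b + U a (b - 1) - U (a - 1) (b - 1)"
      by (simp add: algebra_simps)
    also have "\<dots> = rqfact2 q (a - 1) b + rqfact2 q a (b - 1) - rqfact2 q (a - 1) (b - 1)"
      using 3 by (simp add: IH)
    also have "\<dots> = (1 - q powi (a + b)) * rqfact2 q a b"
      using rqfact2_recurrence[OF q, of a b] by (simp add: algebra_simps)
    finally have "(1 - q powi (a + b)) * U a b = (1 - q powi (a + b)) * rqfact2 q a b" .
    moreover have "q powi (a + b) \<noteq> 1"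
    proof
      assume *: "q powi (a + b) = 1"
      have "q powi (a + b) = q ^ nat (a + b)" using 3 by (simp add: power_int_def)
      hence "norm q ^ nat (a + b) = 1" using * by (metis norm_one norm_power)
      moreover have "norm q ^ nat (a + b) < 1"
        using q 3 by (simp add: power_less_one_iff)
      ultimately show False by simp
    qed
    ultimately show ?thesis by simp
  qed
  thus ?case by (simp add: U_def e_def)
qed

lemma int_pair_cases:
  fixes a b :: int
  obtains "a < 0 \<or> b < 0" | "a = 0" "b = 0" | m where "a = 0" "b = int (Suc m)"
    | m where "b = 0" "a = int (Suc m)" | m n where "a = int (Suc m)" "b = int (Suc n)"
proof (cases "a < 0 \<or> b < 0")
  case False
  then obtain i j where "a = int i" "b = int j"
    by (metis not_le nat_0_le less_le_not_le linorder_not_less)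
  with that(2-) show ?thesis by (cases i; cases j) auto
qed (use that(1) in blast)

text \<open>Since (q;q)_n (-q;q)_n = (q^2;q^2)_n, the factor in front turns the right-hand sides of
  \<open>wA_sum\<close> and \<open>wB_sum\<close> into x^n / (q;q)_n with x = 1 and x = q. The
  recurrence holds with s = q.\<close>

definition V1 :: "complex \<Rightarrow> int \<Rightarrow> int \<Rightarrow> complex" where
  "V1 q a b = qpoch (- q) q (nat (a + b)) * rqfact2 (q\<^sup>2) a b"

text \<open>A second solution of the recurrence, with s = 1. The factor (q^a + q^b) / (1 + q^(a+b))
  is 1 as soon as a or b is 0.\<close>

definition V2 :: "complex \<Rightarrow> int \<Rightarrow> int \<Rightarrow> complex" where
  "V2 q a b = qpoch (- q) q (nat (a + b)) / (1 + q powi (a + b)) * (q powi a + q powi b) * rqfact2 (q\<^sup>2) a b"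

lemma square_powi: "(x\<^sup>2 :: complex) powi m = (x powi m)\<^sup>2"
  by (metis power_int_mult_distrib power2_eq_square)

lemma one_plus_power_nonzero:
  assumes "norm (q :: complex) < 1"
  shows "1 + q ^ n \<noteq> 0"
proof (cases n)
  case (Suc m)
  have "norm (q ^ n) < 1"
    using assms Suc power_Suc_less_one[of "norm q" m] by (cases "q = 0") (auto simp: norm_power norm_mult)
  hence "q ^ n \<noteq> - 1" by (metis norm_minus_cancel norm_one less_irrefl)
  thus ?thesis by (metis add_eq_0_iff)
qed auto

lemma V1_recurrence:
  assumes q: "norm q < 1" "q \<noteq> 0"
  shows "V1 q a b - V1 q (a - 1) b - V1 q a (b - 1) + V1 q (a - 1) (b - 1) =
         q powi (a + b) * V1 q a b - q * q powi (a + b - 2) * V1 q (a - 1) (b - 1)"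
proof -
  have P: "norm (q\<^sup>2) < 1" using q by (auto simp: norm_power power_less_one_iff)
  note pred = rqfact2_pred[OF P] rqfact2_pred'[OF P]
  define h where "h = rqfact2 (q\<^sup>2) a b"
  consider "a < 0 \<or> b < 0" | "a = 0" "b = 0" | m where "a = 0" "b = int (Suc m)"
    | m where "b = 0" "a = int (Suc m)" | m n where "a = int (Suc m)" "b = int (Suc n)"
    by (rule int_pair_cases)
  thus ?thesis
  proof cases
    case 1
    thus ?thesis by (auto simp: V1_def rqfact2_def)
  next
    case 2
    thus ?thesis by (auto simp: V1_def rqfact2_def)
  next
    case (3 m)
    have *: "nat b = Suc m" "nat (b - 1) = m" "q powi b = q * q ^ m" "q powi (b - 1) = q ^ m"
      using 3 by (simp_all add: power_int_add)
    show ?thesis using 3(1) unfolding V1_def pred square_powi h_def [symmetric]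
      by (simp add: * qpoch_Suc) (simp add: algebra_simps power2_eq_square)
  next
    case (4 m)
    have *: "nat a = Suc m" "nat (a - 1) = m" "q powi a = q * q ^ m" "q powi (a - 1) = q ^ m"
      using 4 by (simp_all add: power_int_add)
    show ?thesis using 4(1) unfolding V1_def pred square_powi h_def [symmetric]
      by (simp add: * qpoch_Suc) (simp add: algebra_simps power2_eq_square)
  next
    case (5 m n)
    define x y where "x = q ^ m" and "y = q ^ n"
    define w where "w = qpoch (- q) q (m + n)"
    have W: "qpoch (- q) q (nat (a + b)) = w * (1 + q * (x * y)) * (1 + q * (q * (x * y)))"
      "qpoch (- q) q (nat (a - 1 + b)) = w * (1 + q * (x * y))"
      "qpoch (- q) q (nat (a + (b - 1))) = w * (1 + q * (x * y))"
      "qpoch (- q) q (nat (a - 1 + (b - 1))) = w"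
    proof -
      have "nat (a + b) = Suc (Suc (m + n))" "nat (a - 1 + b) = Suc (m + n)"
         "nat (a + (b - 1)) = Suc (m + n)" "nat (a - 1 + (b - 1)) = m + n" using 5 by auto
      thus "qpoch (- q) q (nat (a + b)) = w * (1 + q * (x * y)) * (1 + q * (q * (x * y)))"
      "qpoch (- q) q (nat (a - 1 + b)) = w * (1 + q * (x * y))"
      "qpoch (- q) q (nat (a + (b - 1))) = w * (1 + q * (x * y))"
      "qpoch (- q) q (nat (a - 1 + (b - 1))) = w"
        by (simp_all add: qpoch_Suc w_def x_def y_def power_add)
    qed
    have pw: "q powi a = q * x" "q powi b = q * y" "q powi (a + b) = q * q * x * y"
        "q powi (a + b - 2) = x * y"
    proof -
      have "a + b = int (Suc (Suc (m + n)))" "a + b - 2 = int (m + n)" using 5 by auto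
      thus "q powi a = q * x" "q powi b = q * y" "q powi (a + b) = q * q * x * y"
        "q powi (a + b - 2) = x * y"
        using 5 by (simp_all only: power_int_of_nat) (simp_all add: x_def y_def power_add)
    qed
    show ?thesis unfolding V1_def pred W square_powi pw h_def [symmetric]
      by algebra
  qed
qed

lemma V2_recurrence:
  assumes q: "norm q < 1" "q \<noteq> 0"
  shows "V2 q a b - V2 q (a - 1) b - V2 q a (b - 1) + V2 q (a - 1) (b - 1) =
         q powi (a + b) * V2 q a b - 1 * q powi (a + b - 2) * V2 q (a - 1) (b - 1)"
proof -
  have P: "norm (q\<^sup>2) < 1" using q by (auto simp: norm_power power_less_one_iff)
  note pred = rqfact2_pred[OF P] rqfact2_pred'[OF P]
  define h where "h = rqfact2 (q\<^sup>2) a b"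
  have nz: "1 + q * q ^ k \<noteq> 0" for k using one_plus_power_nonzero[OF q(1), of "Suc k"] by simp
  consider "a < 0 \<or> b < 0" | "a = 0" "b = 0" | m where "a = 0" "b = int (Suc m)"
    | m where "b = 0" "a = int (Suc m)" | m n where "a = int (Suc m)" "b = int (Suc n)"
    by (rule int_pair_cases)
  thus ?thesis
  proof cases
    case 1
    thus ?thesis by (auto simp: V2_def rqfact2_def)
  next
    case 2
    thus ?thesis by (auto simp: V2_def rqfact2_def)
  next
    case (3 m)
    have *: "nat b = Suc m" "nat (b - 1) = m" "q powi b = q * q ^ m" "q powi (b - 1) = q ^ m"
      using 3 by (simp_all add: power_int_add)
    show ?thesis using 3(1) nz[of m] one_plus_power_nonzero[OF q(1), of m] q unfolding V2_def pred square_powi h_def [symmetric]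
      by (simp add: * qpoch_Suc) (simp add: field_simps power2_eq_square)
  next
    case (4 m)
    have *: "nat a = Suc m" "nat (a - 1) = m" "q powi a = q * q ^ m" "q powi (a - 1) = q ^ m"
      using 4 by (simp_all add: power_int_add)
    show ?thesis using 4(1) nz[of m] one_plus_power_nonzero[OF q(1), of m] q unfolding V2_def pred square_powi h_def [symmetric]
      by (simp add: * qpoch_Suc) (simp add: field_simps power2_eq_square)
  next
    case (5 m n)
    define x y where "x = q ^ m" and "y = q ^ n"
    \<comment> \<open>With the denominator 1 + x y of the lowest index absorbed into
      \<open>w\<close>, all four values of \<open>V2\<close> are polynomial multiples of
      \<open>w\<close> and \<open>h\<close>, and the recurrence becomes a polynomial
      identity.\<close>
    define w where "w = qpoch (- q) q (m + n) / (1 + x * y)"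
    have nz': "1 + x * y \<noteq> 0" "1 + q * x * y \<noteq> 0" "1 + q * q * x * y \<noteq> 0"
      using one_plus_power_nonzero[OF q(1), of "m + n"] nz[of "m + n"] nz[of "Suc (m + n)"]
      by (simp_all add: x_def y_def power_add mult_ac)
    have n: "a + b = int (Suc (Suc (m + n)))" "a - 1 + b = int (Suc (m + n))"
         "a + (b - 1) = int (Suc (m + n))" "a - 1 + (b - 1) = int (m + n)" "a + b - 2 = int (m + n)"
       "a - 1 = int m" "b - 1 = int n" using 5 by auto
    have pw: "q powi a = q * x" "q powi b = q * y" "q powi (a + b) = q * q * x * y"
      "q powi (a + b - 2) = x * y" "q powi (a - 1 + b) = q * x * y"
      "q powi (a + (b - 1)) = q * x * y" "q powi (a - 1 + (b - 1)) = x * y"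
      "q powi (a - 1) = x" "q powi (b - 1) = y"
      unfolding n using 5 q by (simp_all add: x_def y_def power_int_add power2_eq_square)
    have W0: "qpoch (- q) q (m + n) = w * (1 + x * y)"
      using nz' by (simp add: w_def)
    have W1: "qpoch (- q) q (Suc (m + n)) = w * (1 + x * y) * (1 + q * x * y)"
      by (simp add: qpoch_Suc W0 x_def y_def power_add mult_ac)
    have W2: "qpoch (- q) q (Suc (Suc (m + n))) = w * (1 + x * y) * (1 + q * x * y) * (1 + q * q * x * y)"
      by (subst qpoch_Suc, subst W1) (simp add: x_def y_def power_add mult_ac)
    have "qpoch (- q) q (Suc (Suc (m + n))) / (1 + q * q * x * y) = w * (1 + x * y) * (1 + q * x * y)"
         "qpoch (- q) q (Suc (m + n)) / (1 + q * x * y) = w * (1 + x * y)"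
         "qpoch (- q) q (m + n) / (1 + x * y) = w"
      unfolding W0 W1 W2 using nz' by simp_all
    hence W: "qpoch (- q) q (nat (a + b)) / (1 + q * q * x * y) = w * (1 + x * y) * (1 + q * x * y)"
         "qpoch (- q) q (nat (a - 1 + b)) / (1 + q * x * y) = w * (1 + x * y)"
         "qpoch (- q) q (nat (a + (b - 1))) / (1 + q * x * y) = w * (1 + x * y)"
         "qpoch (- q) q (nat (a - 1 + (b - 1))) / (1 + x * y) = w"
      unfolding n(1,2,3,4) by (simp_all only: nat_int)
    show ?thesis unfolding V2_def pred square_powi pw W h_def [symmetric]
      by algebra
  qed
qed

text \<open>The \<open>n\<close>-th coefficient of \<open>1 / ((x z; q) (s z\<^sup>2; q\<^sup>2))\<close>.\<close>

definition ncoeff :: "complex \<Rightarrow> complex \<Rightarrow> complex \<Rightarrow> nat \<Rightarrow> complex" where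
  "ncoeff q x s n = (\<Sum>j\<le>n div 2. x ^ (n - 2 * j) * s ^ j / (qpoch q q (n - 2 * j) * qpoch (q\<^sup>2) (q\<^sup>2) j))"

text \<open>Each 1 / ((q;q)_a (q;q)_b) is expanded by \<open>convolution_eq_rqfact2\<close>. The
  shift by j leaves b - a, hence the weight, unchanged, so for each j there remains the weighted sum
  of \<open>V\<close> along a + b = n - 2j, which the hypothesis \<open>sum\<close>
  evaluates.\<close>

lemma ncoeff_eq_weighted_sum:
  fixes q s x :: complex and V :: "int \<Rightarrow> int \<Rightarrow> complex" and w :: "int \<Rightarrow> complex"
  assumes q: "norm q < 1" "q \<noteq> 0"
    and neg: "\<And>a b. a < 0 \<or> b < 0 \<Longrightarrow> V a b = 0"
    and V0: "V 0 0 = 1"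
    and rec: "\<And>a b. V a b - V (a - 1) b - V a (b - 1) + V (a - 1) (b - 1) =
                q powi (a + b) * V a b - s * q powi (a + b - 2) * V (a - 1) (b - 1)"
    and sum: "\<And>m. (\<Sum>a\<le>m. w (int m - 2 * int a) * V a (int m - a)) = x ^ m / qpoch q q m"
  shows "ncoeff q x s n = (\<Sum>a\<le>n. w (int n - 2 * int a) * rqfact2 q a (int n - a))"
proof -
  define e where "e j = s ^ j / qpoch (q\<^sup>2) (q\<^sup>2) j" for j
  have "(\<Sum>a\<le>n. w (int n - 2 * int a) * rqfact2 q a (int n - a)) =
        (\<Sum>a\<le>n. w (int n - 2 * int a) * (\<Sum>j<Suc n. e j * V (int a - j) (int n - a - j)))"
  proof (intro sum.cong refl)
    fix a assume "a \<in> {..n}"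
    have "(\<Sum>j<Suc n. e j * V (int a - j) (int n - a - j)) = rqfact2 q a (int n - a)"
      unfolding e_def by (rule convolution_eq_rqfact2[OF q neg V0 rec]) auto
    thus "w (int n - 2 * int a) * rqfact2 q a (int n - a) =
          w (int n - 2 * int a) * (\<Sum>j<Suc n. e j * V (int a - j) (int n - a - j))"
      by (simp only:)
  qed
  also have "\<dots> = (\<Sum>j<Suc n. \<Sum>a\<le>n. e j * (w (int n - 2 * int a) * V (int a - j) (int n - a - j)))"
    unfolding sum_distrib_left by (subst sum.swap) (simp add: mult_ac)
  also have "\<dots> = (\<Sum>j\<le>n div 2. \<Sum>a\<le>n. e j * (w (int n - 2 * int a) * V (int a - j) (int n - a - j)))"
    by (rule sum_div2_extend [symmetric]) (auto intro!: sum.neutral neg)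
  also have "\<dots> = (\<Sum>j\<le>n div 2. e j * (x ^ (n - 2 * j) / qpoch q q (n - 2 * j)))"
  proof (intro sum.cong refl)
    fix j assume "j \<in> {..n div 2}"
    hence j: "2 * j \<le> n" by auto
    have "(\<Sum>a\<le>n. w (int n - 2 * int a) * V (int a - j) (int n - a - j)) =
          (\<Sum>a\<in>{j..n - j}. w (int n - 2 * int a) * V (int a - j) (int n - a - j))"
      using j by (intro sum.mono_neutral_right) (auto intro!: neg)
    also have "\<dots> = (\<Sum>a\<le>n - 2 * j. w (int (n - 2 * j) - 2 * int a) * V a (int (n - 2 * j) - a))"
      by (rule sum.reindex_bij_witness[of _ "\<lambda>a. a + j" "\<lambda>a. a - j"])
         (use j in \<open>auto simp: of_nat_diff algebra_simps\<close>)
    also have "\<dots> = x ^ (n - 2 * j) / qpoch q q (n - 2 * j)" by (rule sum)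
    finally show "(\<Sum>a\<le>n. e j * (w (int n - 2 * int a) * V (int a - j) (int n - a - j))) =
        e j * (x ^ (n - 2 * j) / qpoch q q (n - 2 * j))"
      by (simp add: sum_distrib_left [symmetric])
  qed
  also have "\<dots> = ncoeff q x s n"
    unfolding ncoeff_def e_def by (intro sum.cong refl) (simp add: mult_ac)
  finally show ?thesis ..
qed

lemma ncoeff_A:
  assumes q: "norm q < 1" "q \<noteq> 0"
  shows "ncoeff q 1 q n = (\<Sum>a\<le>n. wA q (int n - 2 * int a) * rqfact2 q a (int n - a))"
proof (rule ncoeff_eq_weighted_sum[OF q _ _ V1_recurrence[OF q]])
  fix m
  have "(\<Sum>a\<le>m. wA q (int m - 2 * int a) * V1 q a (int m - a)) =
      qpoch (- q) q m * (\<Sum>a\<le>m. wA q (int m - 2 * int a) * rqfact2 (q\<^sup>2) a (int m - a))"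
    by (simp add: V1_def sum_distrib_left mult_ac)
  thus "(\<Sum>a\<le>m. wA q (int m - 2 * int a) * V1 q a (int m - a)) = 1 ^ m / qpoch q q m"
    using qpoch_nonzero[of q "- q" m] q unfolding wA_sum[OF q] qpoch_square [symmetric] by simp
qed (auto simp: V1_def rqfact2_def)

lemma ncoeff_B:
  assumes q: "norm q < 1" "q \<noteq> 0"
  shows "ncoeff q q q n = (\<Sum>a\<le>n. wB q (int n - 2 * int a) * rqfact2 q a (int n - a))"
proof (rule ncoeff_eq_weighted_sum[OF q _ _ V1_recurrence[OF q]])
  fix m
  have "(\<Sum>a\<le>m. wB q (int m - 2 * int a) * V1 q a (int m - a)) =
      qpoch (- q) q m * (\<Sum>a\<le>m. wB q (int m - 2 * int a) * rqfact2 (q\<^sup>2) a (int m - a))"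
    by (simp add: V1_def sum_distrib_left mult_ac)
  thus "(\<Sum>a\<le>m. wB q (int m - 2 * int a) * V1 q a (int m - a)) = q ^ m / qpoch q q m"
    using qpoch_nonzero[of q "- q" m] q unfolding wB_sum[OF q] qpoch_square [symmetric] by simp
qed (auto simp: V1_def rqfact2_def)

text \<open>With r = m - 2a one has q^a + q^(m-a) = t^m (t^r + t^-r), so \<open>wC_eq_wA_wB\<close>
  applies. The sums over \<open>wA\<close> and \<open>wB\<close> add up to (1 + q^m) / (q^2;q^2)_m,
  and 1 + q^m cancels against the denominator in \<open>V2\<close>.\<close>

lemma ncoeff_C:
  assumes t: "norm t < 1" "t \<noteq> 0" and q: "q = t\<^sup>2"
  shows "ncoeff q t 1 n = (\<Sum>a\<le>n. wC t (int n - 2 * int a) * rqfact2 q a (int n - a))"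
proof -
  have q': "norm q < 1" "q \<noteq> 0" using t q by (auto simp: norm_power power_less_one_iff)
  show ?thesis
  proof (rule ncoeff_eq_weighted_sum[OF q' _ _ V2_recurrence[OF q']])
    fix m
    have "(\<Sum>a\<le>m. wC t (int m - 2 * int a) * V2 q a (int m - a)) =
      (\<Sum>a\<le>m. t ^ m * qpoch (- q) q m / (1 + q ^ m) *
         ((wA q (int m - 2 * int a) + wB q (int m - 2 * int (m - a))) * rqfact2 (q\<^sup>2) a (int m - a)))"
    proof (intro sum.cong refl)
      fix a assume a: "a \<in> {..m}"
      define r where "r = int m - 2 * int a"
      have "q powi int a = t ^ m * t powi (- r)" "q powi (int m - int a) = t ^ m * t powi r"
      proof -
        have *: "q powi k = t powi (2 * k)" for k
          unfolding q by (metis power_int_mult power_int_of_nat of_nat_numeral)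
        have "2 * int a = int m + (- r)" "2 * (int m - int a) = int m + r" by (auto simp: r_def)
        thus "q powi int a = t ^ m * t powi (- r)" "q powi (int m - int a) = t ^ m * t powi r"
          unfolding * power_mult_powi[OF t(2)] by metis+
      qed
      hence "wC t r * (q powi int a + q powi (int m - int a)) = t ^ m * (wC t r * (t powi r + t powi (- r)))"
        by (simp add: algebra_simps)
      also have "\<dots> = t ^ m * (wA q r + wB q (- r))"
        by (simp add: wC_eq_wA_wB[OF t(2)] q)
      also have "- r = int m - 2 * int (m - a)" using a by (auto simp: r_def of_nat_diff)
      finally have "wC t r * (q powi int a + q powi (int m - int a)) =
          t ^ m * (wA q r + wB q (int m - 2 * int (m - a)))" .
      moreover have "wC t r * V2 q (int a) (int m - int a) =
          qpoch (- q) q m / (1 + q ^ m) * (wC t r * (q powi int a + q powi (int m - int a))) *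
             rqfact2 (q\<^sup>2) a (int m - a)"
        by (simp add: V2_def)
      ultimately show "wC t (int m - 2 * int a) * V2 q a (int m - a) = t ^ m * qpoch (- q) q m / (1 + q ^ m) *
         ((wA q (int m - 2 * int a) + wB q (int m - 2 * int (m - a))) * rqfact2 (q\<^sup>2) a (int m - a))"
        unfolding r_def [symmetric] by simp
    qed
    also have "\<dots> = t ^ m * qpoch (- q) q m / (1 + q ^ m) *
       ((\<Sum>a\<le>m. wA q (int m - 2 * int a) * rqfact2 (q\<^sup>2) a (int m - a)) +
        (\<Sum>a\<le>m. wB q (int m - 2 * int (m - a)) * rqfact2 (q\<^sup>2) a (int m - a)))"
      by (simp only: sum_distrib_left [symmetric] distrib_right sum.distrib)
    also have "(\<Sum>a\<le>m. wB q (int m - 2 * int (m - a)) * rqfact2 (q\<^sup>2) a (int m - a)) =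
       (\<Sum>a\<le>m. wB q (int m - 2 * int a) * rqfact2 (q\<^sup>2) a (int m - a))"
      by (rule sum.reindex_bij_witness[of _ "\<lambda>a. m - a" "\<lambda>a. m - a"])
         (auto simp: of_nat_diff rqfact2_commute)
    also have "t ^ m * qpoch (- q) q m / (1 + q ^ m) *
       ((\<Sum>a\<le>m. wA q (int m - 2 * int a) * rqfact2 (q\<^sup>2) a (int m - a)) +
        (\<Sum>a\<le>m. wB q (int m - 2 * int a) * rqfact2 (q\<^sup>2) a (int m - a))) = t ^ m / qpoch q q m"
      unfolding wA_sum[OF q'] wB_sum[OF q'] add_divide_distrib [symmetric]
        qpoch_square [symmetric]
      using qpoch_nonzero[of q "- q" m] qpoch_nonzero[of q q m] one_plus_power_nonzero[OF q'(1), of m] q'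
      by simp
    finally show "(\<Sum>a\<le>m. wC t (int m - 2 * int a) * V2 q a (int m - a)) = t ^ m / qpoch q q m" .
  qed (auto simp: V2_def rqfact2_def)
qed

section \<open>Formal power series: q-exponentials and the second form of the coefficients\<close>

abbreviation fps_scale :: "complex \<Rightarrow> complex fps \<Rightarrow> complex fps" where
  "fps_scale c f \<equiv> fps_compose f (fps_const c * fps_X)"

abbreviation fps_square :: "complex fps \<Rightarrow> complex fps" where
  "fps_square f \<equiv> fps_compose f (fps_X\<^sup>2)"

lemma fps_square_nth: "fps_square f $ n = (if even n then f $ (n div 2) else 0)"
  by (simp add: fps_nth_compose_X_power)

lemma fps_scale_square: "fps_scale c (fps_square f) = fps_square (fps_scale (c\<^sup>2) f)"
  by (rule fps_ext) (auto simp: fps_square_nth simp flip: power_mult)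

lemma fps_scale_mult: "fps_scale c (f * g) = fps_scale c f * fps_scale c g"
  by (simp add: fps_compose_mult_distrib)

text \<open>The coefficient of z^n in f(q z) = h(z) f(z) expresses (q^n - 1) f_n by earlier
  coefficients, and q^n is not 1. The identities below between infinite products in z are thus
  proved formally, by checking that both sides satisfy the same q-difference equation.\<close>

lemma fps_scale_unique:
  fixes f g h :: "complex fps"
  assumes q: "norm q < 1" and f: "fps_scale q f = h * f" and g: "fps_scale q g = h * g"
    and h: "h $ 0 = 1" and 0: "f $ 0 = g $ 0"
  shows "f = g"
proof (rule fps_ext)
  fix n show "f $ n = g $ n"
  proof (induction n rule: less_induct)
    case (less n)
    show ?case
    proof (cases "n = 0")
      case False
      have *: "q ^ n * u $ n = u $ n + (\<Sum>i<n. u $ i * h $ (n - i))" if "fps_scale q u = h * u" for u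
      proof -
        have "q ^ n * u $ n = (u * h) $ n"
          using that by (metis fps_nth_compose_linear mult.commute)
        also have "\<dots> = (\<Sum>i<Suc n. u $ i * h $ (n - i))"
          by (simp only: fps_mult_nth atLeast0AtMost lessThan_Suc_atMost)
        finally show ?thesis using h by simp
      qed
      have "q ^ n * f $ n - f $ n = q ^ n * g $ n - g $ n"
        using *[OF f] *[OF g] less by simp
      hence "(q ^ n - 1) * (f $ n - g $ n) = 0" by (simp add: algebra_simps)
      moreover have "norm q ^ n \<noteq> 1"
        using False q by (metis norm_ge_zero power_less_one_iff less_irrefl neq0_conv)
      hence "q ^ n \<noteq> 1" by (metis norm_one norm_power)
      ultimately show ?thesis by simp
    qed (use 0 in simp)
  qed
qed

text \<open>By Euler, \<open>qexp q c\<close> expands the infinite product 1 / (c z; q), and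
  \<open>qExp q c\<close> expands (-c z; q).\<close>

definition qexp :: "complex \<Rightarrow> complex \<Rightarrow> complex fps" where
  "qexp q c = Abs_fps (\<lambda>n. c ^ n / qpoch q q n)"

definition qExp :: "complex \<Rightarrow> complex \<Rightarrow> complex fps" where
  "qExp q c = Abs_fps (\<lambda>n. q ^ (n * (n - 1) div 2) * c ^ n / qpoch q q n)"

lemma fps_scale_qexp: "fps_scale a (qexp q c) = qexp q (a * c)"
  by (rule fps_ext) (simp add: qexp_def power_mult_distrib)

lemma fps_scale_qexp':
  assumes "norm q < 1"
  shows "fps_scale q (qexp q c) = (1 - fps_const c * fps_X) * qexp q c"
proof (rule fps_ext)
  fix n
  show "fps_scale q (qexp q c) $ n = ((1 - fps_const c * fps_X) * qexp q c) $ n"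
  proof (cases n)
    case (Suc m)
    have "qpoch q q n \<noteq> 0" using assms by (intro qpoch_nonzero)
    thus ?thesis unfolding Suc
      by (simp add: qexp_def qpoch_Suc left_diff_distrib mult.assoc) (simp add: field_simps)
  qed (simp add: qexp_def)
qed

lemma fps_scale_qExp:
  assumes "norm q < 1"
  shows "qExp q c = (1 + fps_const c * fps_X) * fps_scale q (qExp q c)"
proof (rule fps_ext)
  fix n
  show "qExp q c $ n = ((1 + fps_const c * fps_X) * fps_scale q (qExp q c)) $ n"
  proof (cases n)
    case (Suc m)
    have "Suc m * m div 2 = m * (m - 1) div 2 + m"
    proof -
      have "Suc m * m = m * (m - 1) + m * 2" by (cases m) auto
      thus ?thesis by simp
    qed
    hence *: "q ^ (Suc m * m div 2) = q ^ m * q ^ (m * (m - 1) div 2)"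
      by (simp add: power_add)
    have "qpoch q q n \<noteq> 0" using assms by (intro qpoch_nonzero)
    thus ?thesis unfolding Suc
      by (simp add: qExp_def qpoch_Suc distrib_right mult.assoc * del: mult_Suc) (simp add: field_simps)
  qed (simp add: qExp_def)
qed

lemma qexp_mult_qExp:
  assumes "norm q < 1"
  shows "qexp q c * qExp q (- c) = 1"
proof (rule fps_scale_unique[OF assms, where h = 1])
  have "fps_scale q (qexp q c * qExp q (- c)) = qexp q c * ((1 - fps_const c * fps_X) * fps_scale q (qExp q (- c)))"
    unfolding fps_scale_mult fps_scale_qexp'[OF assms] by (simp only: mult_ac)
  also have "(1 - fps_const c * fps_X) * fps_scale q (qExp q (- c)) = qExp q (- c)"
    using fps_scale_qExp[OF assms, of "- c"] by (simp flip: fps_const_neg)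
  finally show "fps_scale q (qexp q c * qExp q (- c)) = 1 * (qexp q c * qExp q (- c))" by simp
qed (simp_all add: qexp_def qExp_def)

lemma qexp_base_square:
  assumes "norm q < 1"
  shows "qexp q c = qexp (q\<^sup>2) c * qexp (q\<^sup>2) (q * c)"
proof (rule fps_scale_unique[OF assms fps_scale_qexp'[OF assms]])
  have P: "norm (q\<^sup>2) < 1" using assms by (auto simp: norm_power power_less_one_iff)
  have "fps_scale q (qexp (q\<^sup>2) c * qexp (q\<^sup>2) (q * c)) = qexp (q\<^sup>2) (q * c) * qexp (q\<^sup>2) (q * (q * c))"
    by (simp only: fps_scale_mult fps_scale_qexp)
  also have "qexp (q\<^sup>2) (q * (q * c)) = fps_scale (q\<^sup>2) (qexp (q\<^sup>2) c)"
    by (simp only: fps_scale_qexp power2_eq_square mult.assoc)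
  finally show "fps_scale q (qexp (q\<^sup>2) c * qexp (q\<^sup>2) (q * c)) =
      (1 - fps_const c * fps_X) * (qexp (q\<^sup>2) c * qexp (q\<^sup>2) (q * c))"
    unfolding fps_scale_qexp'[OF P] by (simp only: mult_ac)
qed (simp_all add: qexp_def)

lemma fps_square_qexp:
  assumes "norm q < 1"
  shows "fps_square (qexp (q\<^sup>2) (c\<^sup>2)) = qexp q c * qexp q (- c)"
proof (rule fps_scale_unique[OF assms])
  have P: "norm (q\<^sup>2) < 1" using assms by (auto simp: norm_power power_less_one_iff)
  have "fps_square (1 - fps_const (c\<^sup>2) * fps_X) = 1 - fps_const (c\<^sup>2) * fps_X\<^sup>2"
    by (simp add: fps_compose_sub_distrib fps_compose_mult_distrib)
  thus "fps_scale q (fps_square (qexp (q\<^sup>2) (c\<^sup>2))) = (1 - fps_const (c\<^sup>2) * fps_X\<^sup>2) * fps_square (qexp (q\<^sup>2) (c\<^sup>2))"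
    by (simp add: fps_scale_square fps_scale_qexp'[OF P] fps_compose_mult_distrib)
  have "fps_scale q (qexp q c * qexp q (- c)) =
    ((1 - fps_const c * fps_X) * (1 - fps_const (- c) * fps_X)) * (qexp q c * qexp q (- c))"
    unfolding fps_scale_mult fps_scale_qexp'[OF assms] by (simp only: mult_ac)
  also have "(1 - fps_const c * fps_X) * (1 - fps_const (- c) * fps_X) = 1 - fps_const (c\<^sup>2) * fps_X\<^sup>2"
    by (simp add: algebra_simps power2_eq_square flip: fps_const_neg fps_const_mult)
  finally show "fps_scale q (qexp q c * qexp q (- c)) = (1 - fps_const (c\<^sup>2) * fps_X\<^sup>2) * (qexp q c * qexp q (- c))" .
qed (simp_all add: qexp_def fps_square_nth)

text \<open>The alternatives say that x^2 and s are, in either order, the parameters y and q y in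
  the splitting (y z^2; q) = (y z^2; q^2) (q y z^2; q^2).\<close>

lemma qexp_qExp_identity:
  assumes q: "norm q < 1" and xs: "x\<^sup>2 = y \<and> s = q * y \<or> x\<^sup>2 = q * y \<and> s = y"
  shows "qExp q x * fps_square (qexp q y) = qexp q x * fps_square (qexp (q\<^sup>2) s)"
proof -
  have "qexp q y = qexp (q\<^sup>2) (x\<^sup>2) * qexp (q\<^sup>2) s"
    using xs qexp_base_square[OF q, of y] by (auto simp: mult.commute)
  hence "fps_square (qexp q y) = qexp q x * qexp q (- x) * fps_square (qexp (q\<^sup>2) s)"
    by (simp add: fps_compose_mult_distrib fps_square_qexp[OF q])
  hence "qExp q x * fps_square (qexp q y) = (qexp q (- x) * qExp q (- (- x))) * (qexp q x * fps_square (qexp (q\<^sup>2) s))"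
    by (simp only: mult_ac minus_minus)
  thus ?thesis by (simp only: qexp_mult_qExp[OF q] mult_1)
qed

lemma fps_mult_square_nth:
  "(f * fps_square g) $ n = (\<Sum>j\<le>n div 2. f $ (n - 2 * j) * g $ j)"
proof -
  have "(f * fps_square g) $ n = (\<Sum>i\<in>{0..n}. fps_square g $ i * f $ (n - i))"
    by (metis mult.commute fps_mult_nth)
  also have "\<dots> = (\<Sum>i\<in>(\<lambda>j. 2 * j) ` {..n div 2}. fps_square g $ i * f $ (n - i))"
    by (rule sum.mono_neutral_right) (auto simp: fps_square_nth image_iff elim!: evenE)
  also have "\<dots> = (\<Sum>j\<le>n div 2. f $ (n - 2 * j) * g $ j)"
    by (subst sum.reindex) (auto simp: inj_on_def fps_square_nth mult.commute)
  finally show ?thesis .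
qed

lemma ncoeff_alt:
  assumes q: "norm q < 1" and xs: "x\<^sup>2 = y \<and> s = q * y \<or> x\<^sup>2 = q * y \<and> s = y"
  shows "ncoeff q x s n = (\<Sum>j\<le>n div 2. q ^ ((n - 2 * j) * (n - 2 * j - 1) div 2) * x ^ (n - 2 * j) * y ^ j /
           (qpoch q q (n - 2 * j) * qpoch q q j))"
proof -
  have "ncoeff q x s n = (qexp q x * fps_square (qexp (q\<^sup>2) s)) $ n"
    unfolding ncoeff_def fps_mult_square_nth by (simp add: qexp_def)
  also have "\<dots> = (qExp q x * fps_square (qexp q y)) $ n"
    by (simp only: qexp_qExp_identity[OF assms])
  also have "\<dots> = (\<Sum>j\<le>n div 2. q ^ ((n - 2 * j) * (n - 2 * j - 1) div 2) * x ^ (n - 2 * j) * y ^ j /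
           (qpoch q q (n - 2 * j) * qpoch q q j))"
    unfolding fps_mult_square_nth by (simp add: qexp_def qExp_def)
  finally show ?thesis .
qed

section \<open>Infinite products and Durfee rectangles\<close>

lemma summable_norm_geometric:
  fixes a q :: complex
  assumes "norm q < 1"
  shows "summable (\<lambda>n. norm (a * q ^ n))"
  using assms by (simp add: norm_mult norm_power summable_mult)

lemma convergent_prod_qpoch:
  fixes a q :: complex
  assumes "norm q < 1"
  shows "convergent_prod (\<lambda>n. 1 - a * q ^ n)"
  using summable_norm_geometric[OF assms, of a]
  by (intro abs_convergent_prod_imp_convergent_prod summable_imp_abs_convergent_prod) simp

lemma qpoch_tendsto:
  assumes "norm q < 1"
  shows "qpoch a q \<longlonglongrightarrow> qpoch_inf a q"
proof -
  have "(\<lambda>n. qpoch a q (Suc n)) \<longlonglongrightarrow> qpoch_inf a q"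
    using convergent_prod_LIMSEQ[OF convergent_prod_qpoch[OF assms, of a]]
    by (simp add: qpoch_def qpoch_inf_def lessThan_Suc_atMost del: prod.lessThan_Suc)
  thus ?thesis by (simp only: filterlim_sequentially_Suc)
qed

lemma qpoch_inf_nonzero:
  assumes "norm q < 1" "\<And>n. a * q ^ n \<noteq> 1"
  shows "qpoch_inf a q \<noteq> 0"
  unfolding qpoch_inf_def using assms
  by (intro prodinf_nonzero convergent_prod_qpoch) auto

lemma mult_power_neq_1:
  assumes "norm (q :: complex) < 1" "norm a < 1"
  shows "a * q ^ n \<noteq> 1"
proof
  assume "a * q ^ n = 1"
  hence "norm a * norm q ^ n = 1" by (metis norm_mult norm_one norm_power)
  moreover have "norm a * norm q ^ n \<le> norm a * 1"
    using assms by (intro mult_left_mono power_le_one) auto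
  ultimately show False using assms by auto
qed

lemma qpoch_inf_nonzero':
  assumes "norm q < 1" "norm a < 1"
  shows "qpoch_inf a q \<noteq> 0"
  using assms by (intro qpoch_inf_nonzero mult_power_neq_1)

lemma qpoch_add: "qpoch a q (m + n) = qpoch a q m * qpoch (a * q ^ m) q n"
  by (induction n) (simp_all add: qpoch_Suc power_add mult_ac)

lemma qpoch_inf_split:
  assumes "norm q < 1"
  shows "qpoch_inf a q = qpoch a q m * qpoch_inf (a * q ^ m) q"
proof (rule LIMSEQ_unique)
  show "(\<lambda>n. qpoch a q (n + m)) \<longlonglongrightarrow> qpoch_inf a q"
    by (intro LIMSEQ_ignore_initial_segment qpoch_tendsto assms)
  have "(\<lambda>n. qpoch a q m * qpoch (a * q ^ m) q n) \<longlonglongrightarrow> qpoch a q m * qpoch_inf (a * q ^ m) q"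
    by (intro tendsto_intros qpoch_tendsto assms)
  thus "(\<lambda>n. qpoch a q (n + m)) \<longlonglongrightarrow> qpoch a q m * qpoch_inf (a * q ^ m) q"
    by (simp only: add.commute[of _ m] qpoch_add)
qed

lemma qpoch_inf_rec:
  assumes "norm q < 1"
  shows "qpoch_inf a q = (1 - a) * qpoch_inf (a * q) q"
  using qpoch_inf_split[OF assms, of a 1] by (simp add: qpoch_Suc)

lemma qpoch_multisect: "qpoch a q (m * n) = (\<Prod>i<m. qpoch (a * q ^ i) (q ^ m) n)"
proof (induction n)
  case (Suc n)
  have "qpoch a q (m * Suc n) = qpoch a q (m * n) * qpoch (a * q ^ (m * n)) q m"
    by (simp add: add.commute flip: qpoch_add)
  also have "qpoch (a * q ^ (m * n)) q m = (\<Prod>i<m. 1 - a * q ^ i * (q ^ m) ^ n)"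
    by (simp add: qpoch_def power_mult mult_ac)
  finally show ?case by (simp add: Suc qpoch_Suc prod.distrib)
qed simp

lemma qpoch_inf_multisect:
  assumes "norm q < 1" "m > 0"
  shows "qpoch_inf a q = (\<Prod>i<m. qpoch_inf (a * q ^ i) (q ^ m))"
proof (rule LIMSEQ_unique)
  have "norm (q ^ m) < 1" using assms by (simp add: norm_power power_less_one_iff)
  thus "(\<lambda>n. qpoch a q (m * n)) \<longlonglongrightarrow> (\<Prod>i<m. qpoch_inf (a * q ^ i) (q ^ m))"
    unfolding qpoch_multisect by (intro tendsto_intros qpoch_tendsto)
  show "(\<lambda>n. qpoch a q (m * n)) \<longlonglongrightarrow> qpoch_inf a q"
    using assms by (intro filterlim_compose[OF qpoch_tendsto[OF assms(1)]] filterlim_subseq)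
                   (auto simp: strict_mono_def)
qed

lemma qpoch_bounds:
  assumes "norm q < 1" "norm a < 1"
  obtains C where "C > 0" "\<And>n. norm (qpoch a q n) \<le> C" "\<And>n. norm (inverse (qpoch a q n)) \<le> C"
proof -
  have "convergent (qpoch a q)" "convergent (\<lambda>n. inverse (qpoch a q n))"
    using qpoch_tendsto[OF assms(1), of a] qpoch_inf_nonzero'[OF assms]
    by (auto simp: convergent_def intro!: tendsto_intros exI)
  hence "Bseq (qpoch a q)" "Bseq (\<lambda>n. inverse (qpoch a q n))"
    by (auto intro: Cauchy_Bseq convergent_Cauchy)
  then obtain C1 C2 where "C1 > 0" "\<And>n. norm (qpoch a q n) \<le> C1"
     "C2 > 0" "\<And>n. norm (inverse (qpoch a q n)) \<le> C2"
    by (auto simp: Bseq_def)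
  thus ?thesis using that[of "max C1 C2"] by (auto simp: le_max_iff_disj less_max_iff_disj)
qed

section \<open>Interchange of limits and sums, and the Durfee rectangle identity\<close>

lemma infsum_tannery:
  fixes f :: "nat \<Rightarrow> 'a \<Rightarrow> complex"
  assumes lim: "\<And>x. x \<in> A \<Longrightarrow> (\<lambda>n. f n x) \<longlonglongrightarrow> g x"
    and bound: "\<And>n x. x \<in> A \<Longrightarrow> norm (f n x) \<le> h x" and h: "h summable_on A"
  shows "(\<lambda>n. infsum (f n) A) \<longlonglongrightarrow> infsum g A" and "g summable_on A"
proof -
  have g: "norm (g x) \<le> h x" if "x \<in> A" for x
    by (rule tendsto_upperbound[OF tendsto_norm[OF lim]]) (use that bound in auto)
  have "(\<lambda>x. norm (g x)) summable_on A"
    by (rule Infinite_Sum.abs_summable_on_comparison_test'[OF h g])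
  thus g': "g summable_on A" by (rule abs_summable_summable)
  show "(\<lambda>n. infsum (f n) A) \<longlonglongrightarrow> infsum g A"
  proof (rule swap_uniform_limit')
    show "uniform_limit UNIV (\<lambda>X n. sum (f n) X) (\<lambda>n. infsum (f n) A) (finite_subsets_at_top A)"
      by (rule Weierstrass_m_test_general[OF bound h])
    show "\<forall>\<^sub>F X in finite_subsets_at_top A. (\<lambda>n. sum (f n) X) \<longlonglongrightarrow> sum g X"
      by (rule eventually_finite_subsets_at_top_weakI) (auto intro!: tendsto_sum lim)
    show "(sum g \<longlongrightarrow> infsum g A) (finite_subsets_at_top A)"
      using g' by (simp add: summable_iff_has_sum_infsum has_sum_def)
  qed auto
qed

lemma has_sum_fibres:
  fixes f :: "'a \<Rightarrow> complex" and p :: "'a \<Rightarrow> 'b"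
  assumes "(f has_sum S) UNIV" "\<And>y. (f has_sum g y) {x. p x = y}"
  shows "(g has_sum S) UNIV"
proof (rule has_sum_SigmaD)
  show "((f \<circ> snd) has_sum S) (SIGMA y:UNIV. {x. p x = y})"
    using assms(1)
    by (subst has_sum_reindex_bij_witness[where i = "\<lambda>x. (p x, x)" and j = snd and T = UNIV and h = f and s' = S])
       auto
qed (use assms(2) in auto)

text \<open>Convergence of the iterated sum alone would not give the sum over all pairs; summability
  is supplied separately, and uniqueness of sums then identifies the value.\<close>

lemma has_sum_from_fibres:
  fixes f :: "'a \<Rightarrow> complex" and p :: "'a \<Rightarrow> 'b"
  assumes "f summable_on UNIV" "\<And>y. (f has_sum g y) {x. p x = y}" "(g has_sum S) UNIV"
  shows "(f has_sum S) UNIV"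
proof -
  obtain T where T: "(f has_sum T) UNIV" using assms(1) by (auto simp: summable_on_def)
  have "(g has_sum T) UNIV" by (rule has_sum_fibres[OF T assms(2)])
  thus ?thesis using T assms(3) has_sum_unique by blast
qed

text \<open>Partitions with parts at most M + r, sorted by their largest rectangle with a rows and a
  + r columns: the Gaussian binomial counts what lies to its right, 1 / (q;q)_{a+r} what lies below.
  In the induction the q-Pascal rule splits the sum for M + 1 in two; after an index shift the two
  parts recombine to the sum for M and r + 1, which is why r is arbitrary.\<close>

lemma durfee_finite:
  assumes q: "norm q < 1"
  shows "(\<Sum>a\<le>M. q ^ (a * a + a * r) * (qpoch q q M * rqfact2 q a (int M - a)) / qpoch q q (a + r)) =
           1 / qpoch q q (M + r)"
proof (induction M arbitrary: r)
  case 0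
  show ?case by (simp add: rqfact2_def)
next
  case (Suc M)
  have nz: "qpoch q q n \<noteq> 0" for n using q by (intro qpoch_nonzero)
  define h where "h a = qpoch q q M * rqfact2 q a (int M - a)" for a :: int
  have pascal: "qpoch q q (Suc M) * rqfact2 q a (int (Suc M) - a) = q ^ a * h a + h (int a - 1)"
    if "a \<le> Suc M" for a :: nat
  proof -
    define X where "X = rqfact2 q a (int (Suc M) - a)"
    have "q powi (int (Suc M) - a) = q ^ (Suc M - a)"
      using that by (metis of_nat_diff power_int_of_nat)
    hence 1: "q * q ^ M = q ^ a * q powi (int (Suc M) - a)"
      using that by (simp flip: power_add power_Suc)
    have 2: "h a = qpoch q q M * ((1 - q powi (int (Suc M) - a)) * X)"
      unfolding h_def X_def using rqfact2_pred'[OF q, of a "int (Suc M) - a"] by simp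
    have 3: "h (int a - 1) = qpoch q q M * ((1 - q ^ a) * X)"
    proof -
      have "int M - (int a - 1) = int (Suc M) - int a" by simp
      thus ?thesis unfolding h_def X_def by (simp only: rqfact2_pred[OF q] power_int_of_nat)
    qed
    show ?thesis unfolding 2 3 X_def [symmetric] qpoch_Suc 1 by algebra
  qed
  have "(\<Sum>a\<le>Suc M. q ^ (a * a + a * r) * (qpoch q q (Suc M) * rqfact2 q a (int (Suc M) - a)) / qpoch q q (a + r)) =
     (\<Sum>a\<le>Suc M. q ^ (a * a + a * r) * (q ^ a * h a + h (int a - 1)) / qpoch q q (a + r))"
    by (intro sum.cong refl) (simp only: pascal atMost_iff)
  also have "\<dots> = (\<Sum>a\<le>Suc M. q ^ (a * a + a * r) * (q ^ a * h a) / qpoch q q (a + r)) +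
     (\<Sum>a\<le>Suc M. q ^ (a * a + a * r) * h (int a - 1) / qpoch q q (a + r))"
    by (simp only: distrib_left add_divide_distrib sum.distrib)
  also have "(\<Sum>a\<le>Suc M. q ^ (a * a + a * r) * (q ^ a * h a) / qpoch q q (a + r)) =
     (\<Sum>a\<le>M. q ^ (a * a + a * r) * (q ^ a * h a) / qpoch q q (a + r))"
    by (simp add: h_def rqfact2_def)
  also have "(\<Sum>a\<le>Suc M. q ^ (a * a + a * r) * h (int a - 1) / qpoch q q (a + r)) =
     (\<Sum>a\<le>M. q ^ (Suc a * Suc a + Suc a * r) * h a / qpoch q q (Suc a + r))"
    by (subst sum.atMost_Suc_shift) (simp add: h_def rqfact2_def)
  also have "(\<Sum>a\<le>M. q ^ (a * a + a * r) * (q ^ a * h a) / qpoch q q (a + r)) + \<dots> =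
     (\<Sum>a\<le>M. q ^ (a * a + a * Suc r) * h a / qpoch q q (a + Suc r))"
    unfolding sum.distrib [symmetric]
  proof (intro sum.cong refl)
    fix a
    have "qpoch q q (Suc (a + r)) = qpoch q q (a + r) * (1 - q ^ Suc (a + r))" by (simp add: qpoch_Suc)
    thus "q ^ (a * a + a * r) * (q ^ a * h a) / qpoch q q (a + r) +
       q ^ (Suc a * Suc a + Suc a * r) * h a / qpoch q q (Suc a + r) =
       q ^ (a * a + a * Suc r) * h a / qpoch q q (a + Suc r)"
      using nz[of "Suc (a + r)"] nz[of "a + r"]
      by (simp add: power_add) (simp add: field_simps power_add)
  qed
  also have "\<dots> = 1 / qpoch q q (Suc M + r)"
    using Suc.IH[of "Suc r"] by (simp add: h_def)
  finally show ?case .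
qed

text \<open>The limit of \<open>durfee_finite\<close> for M to infinity. The finite products and
  their inverses are bounded by one constant \<open>C\<close>, so C^4 |q|^a is a summable
  majorant.\<close>

lemma durfee:
  assumes q: "norm q < 1"
  shows "((\<lambda>a. q ^ (a * a + a * r) / (qpoch q q a * qpoch q q (a + r))) has_sum (1 / qpoch_inf q q)) UNIV"
proof -
  obtain C where C: "C > 0" "\<And>n. norm (qpoch q q n) \<le> C" "\<And>n. norm (inverse (qpoch q q n)) \<le> C"
    using qpoch_bounds[OF q q] by blast
  have nz': "qpoch_inf q q \<noteq> 0" using q by (intro qpoch_inf_nonzero')
  define f where "f M a = (if a \<le> M then q ^ (a * a + a * r) * (qpoch q q M * rqfact2 q a (int M - a)) / qpoch q q (a + r) else 0)"
    for M a :: nat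
  define g where "g a = q ^ (a * a + a * r) / (qpoch q q a * qpoch q q (a + r))" for a
  have f_alt: "f M a = q ^ (a * a + a * r) * qpoch q q M * inverse (qpoch q q a) * inverse (qpoch q q (M - a)) * inverse (qpoch q q (a + r))"
    if "a \<le> M" for M a
    using that by (simp add: f_def rqfact2_def field_simps nat_diff_distrib)
  have lim: "(\<lambda>M. f M a) \<longlonglongrightarrow> g a" for a
  proof (rule Lim_transform_eventually)
    have *: "(\<lambda>M. qpoch q q (M - a)) \<longlonglongrightarrow> qpoch_inf q q"
      by (rule LIMSEQ_offset[of _ a]) (simp add: qpoch_tendsto q)
    have "(\<lambda>M. q ^ (a * a + a * r) * qpoch q q M * inverse (qpoch q q a) * inverse (qpoch q q (M - a)) * inverse (qpoch q q (a + r)))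
      \<longlonglongrightarrow> q ^ (a * a + a * r) * qpoch_inf q q * inverse (qpoch q q a) * inverse (qpoch_inf q q) * inverse (qpoch q q (a + r))"
      by (intro tendsto_intros qpoch_tendsto q * nz')
    thus "(\<lambda>M. q ^ (a * a + a * r) * qpoch q q M * inverse (qpoch q q a) * inverse (qpoch q q (M - a)) * inverse (qpoch q q (a + r)))
      \<longlonglongrightarrow> g a" using nz' by (simp add: g_def field_simps)
    show "\<forall>\<^sub>F M in sequentially. q ^ (a * a + a * r) * qpoch q q M * inverse (qpoch q q a) * inverse (qpoch q q (M - a)) * inverse (qpoch q q (a + r)) = f M a"
      using eventually_ge_at_top[of a] by eventually_elim (simp add: f_alt)
  qed
  have bound: "norm (f M a) \<le> C ^ 4 * norm q ^ a" for M a
  proof (cases "a \<le> M")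
    case True
    have "norm (f M a) \<le> norm q ^ a * C * C * C * C"
      unfolding f_alt[OF True] norm_mult norm_power using C(1) q
      by (intro mult_mono C power_decreasing) (auto intro: trans_le_add1)
    thus ?thesis by (simp add: eval_nat_numeral mult_ac)
  next
    case False
    thus ?thesis using C(1) by (simp add: f_def)
  qed
  have summable: "(\<lambda>a. C ^ 4 * norm q ^ a) summable_on UNIV"
    using q C(1) by (intro summable_on_cmult_right summable_nonneg_imp_summable_on) auto
  have "(\<lambda>M. infsum (f M) UNIV) \<longlonglongrightarrow> infsum g UNIV" and g: "g summable_on UNIV"
    by (rule infsum_tannery[OF lim bound summable])+
  moreover have "infsum (f M) UNIV = 1 / qpoch q q (M + r)" for M
  proof -
    have "infsum (f M) UNIV = infsum (f M) {..M}"
      by (rule infsum_cong_neutral) (auto simp: f_def)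
    also have "\<dots> = (\<Sum>a\<le>M. q ^ (a * a + a * r) * (qpoch q q M * rqfact2 q a (int M - a)) / qpoch q q (a + r))"
      by (simp add: f_def)
    also have "\<dots> = 1 / qpoch q q (M + r)" by (rule durfee_finite[OF q])
    finally show ?thesis .
  qed
  moreover have "(\<lambda>M. 1 / qpoch q q (M + r)) \<longlonglongrightarrow> 1 / qpoch_inf q q"
    by (intro tendsto_intros LIMSEQ_ignore_initial_segment qpoch_tendsto q nz')
  ultimately have "infsum g UNIV = 1 / qpoch_inf q q"
    using LIMSEQ_unique by simp
  thus ?thesis using g by (simp add: has_sum_iff g_def [abs_def])
qed

lemma summable_on_geometric_pairs:
  fixes f :: "nat \<times> nat \<Rightarrow> complex"
  assumes "0 \<le> \<rho>" "\<rho> < 1" "\<And>i j. norm (f (i, j)) \<le> C * (\<rho> ^ i * \<rho> ^ j)"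
  shows "f summable_on UNIV"
proof -
  have g: "((\<lambda>n. \<rho> ^ n) has_sum (1 / (1 - \<rho>))) (UNIV :: nat set)"
    using assms geometric_sums[of \<rho>] by (intro sums_nonneg_imp_has_sum) auto
  have "(\<lambda>(i, j). \<rho> ^ i * \<rho> ^ j) summable_on (UNIV :: nat set) \<times> (UNIV :: nat set)"
  proof (rule summable_on_SigmaI)
    show "((\<lambda>j. case (i, j) of (i, j) \<Rightarrow> \<rho> ^ i * \<rho> ^ j) has_sum (\<rho> ^ i * (1 / (1 - \<rho>)))) UNIV" for i :: nat
      unfolding prod.case by (intro has_sum_cmult_right g)
    show "(\<lambda>i. \<rho> ^ i * (1 / (1 - \<rho>))) summable_on (UNIV :: nat set)"
      by (intro summable_on_cmult_left has_sum_imp_summable[OF g])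
  qed (use assms in auto)
  hence "(\<lambda>x. C * (case x of (i, j) \<Rightarrow> \<rho> ^ i * \<rho> ^ j)) summable_on (UNIV :: (nat \<times> nat) set)"
    by (intro summable_on_cmult_right) simp
  hence "(\<lambda>x. norm (f x)) summable_on UNIV"
    by (rule Infinite_Sum.abs_summable_on_comparison_test') (use assms(3) in auto)
  thus ?thesis by (rule abs_summable_summable)
qed

lemma rqfact2_of_nat:
  "rqfact2 q (int a) (int b) = inverse (qpoch q q a) * inverse (qpoch q q b)"
  by (simp add: rqfact2_def field_simps)

text \<open>Both fibrations of the sum over \<open>(a, b)\<close> are used: along \<open>a + b\<close> it yields the
  coefficients, and along \<open>b - a\<close> the inner sums are Durfee rectangle sums.\<close>

lemma weighted_sum_has_sum:
  fixes w :: "int \<Rightarrow> complex"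
  assumes q: "norm q < 1" "q \<noteq> 0" and w: "\<And>r. norm (w r) \<le> 1"
    and W: "((\<lambda>r. w r * q powi (r\<^sup>2)) has_sum W) UNIV"
  shows "((\<lambda>n. q ^ (n\<^sup>2) * (\<Sum>a\<le>n. w (int n - 2 * int a) * rqfact2 (q ^ 4) a (int n - a)))
            has_sum (W / qpoch_inf (q ^ 4) (q ^ 4))) UNIV"
proof -
  define Q where "Q = q ^ 4"
  have Q: "norm Q < 1" using q by (auto simp: Q_def norm_power power_less_one_iff)
  obtain C where C: "C > 0" "\<And>n. norm (qpoch Q Q n) \<le> C" "\<And>n. norm (inverse (qpoch Q Q n)) \<le> C"
    using qpoch_bounds[OF Q Q] by blast
  define F where "F = (\<lambda>(a :: nat, b :: nat). q ^ ((a + b)\<^sup>2) * w (int b - int a) * (inverse (qpoch Q Q a) * inverse (qpoch Q Q b)))"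
  have bound: "norm (F (a, b)) \<le> (C * C) * (norm q ^ a * norm q ^ b)" for a b
  proof -
    have "norm (F (a, b)) \<le> norm q ^ (a + b) * 1 * (C * C)"
      unfolding F_def norm_mult norm_power prod.case using C(1) q
      by (intro mult_mono C(3) w power_decreasing) (auto simp: power2_eq_square)
    thus ?thesis by (simp add: power_add mult_ac)
  qed
  have F: "F summable_on UNIV"
    by (rule summable_on_geometric_pairs[OF _ _ bound]) (use q in auto)
  have fib1: "(F has_sum (q ^ (n\<^sup>2) * (\<Sum>a\<le>n. w (int n - 2 * int a) * rqfact2 Q a (int n - a)))) {x. (case x of (a, b) \<Rightarrow> a + b) = n}" for n
  proof (rule has_sum_finiteI)
    have *: "{x. (case x of (a, b) \<Rightarrow> a + b) = n} = (\<lambda>a. (a, n - a)) ` {..n}"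
      by auto
    show "finite {x. (case x of (a :: nat, b) \<Rightarrow> a + b) = n}" unfolding * by simp
    have "F (a, n - a) = q ^ (n\<^sup>2) * (w (int n - 2 * int a) * rqfact2 Q a (int n - a))" if "a \<le> n" for a
    proof -
      have "int n - int a = int (n - a)" "int (n - a) - int a = int n - 2 * int a" "a + (n - a) = n"
        using that by auto
      thus ?thesis by (simp only: F_def prod.case rqfact2_of_nat mult.assoc)
    qed
    thus "q ^ (n\<^sup>2) * (\<Sum>a\<le>n. w (int n - 2 * int a) * rqfact2 Q a (int n - a)) = sum F {x. (case x of (a, b) \<Rightarrow> a + b) = n}"
      unfolding * sum_distrib_left
      by (subst sum.reindex) (auto simp: inj_on_def intro!: sum.cong)
  qed
  have fib2: "(F has_sum (w r * q powi (r\<^sup>2) * (1 / qpoch_inf Q Q))) {x. (case x of (a, b) \<Rightarrow> int b - int a) = r}" for r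
  proof (cases "r \<ge> 0")
    case True
    then obtain k where k: "r = int k" by (metis nonneg_int_cases)
    \<comment> \<open>(2a + k)^2 = k^2 + 4 (a^2 + a k): this is where the base q^4 comes
      from.\<close>
    have e: "q ^ ((a + (a + k))\<^sup>2) = q ^ (k\<^sup>2) * Q ^ (a * a + a * k)" for a
      unfolding Q_def power_mult [symmetric] power_add [symmetric]
      by (rule arg_cong[of _ _ "(^) q"]) (simp add: power2_eq_square algebra_simps)
    have pw: "q powi (r\<^sup>2) = q ^ (k\<^sup>2)"
      by (metis k of_nat_power power2_minus power_int_of_nat)
    have val: "F (a, a + k) = w r * q powi (r\<^sup>2) * (Q ^ (a * a + a * k) / (qpoch Q Q a * qpoch Q Q (a + k)))" for a
    proof -
      have "F (a, a + k) = q ^ ((a + (a + k))\<^sup>2) * w r * (inverse (qpoch Q Q a) * inverse (qpoch Q Q (a + k)))"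
        by (simp add: F_def k mult_ac add_ac)
      thus ?thesis unfolding e pw by (simp add: divide_inverse mult_ac)
    qed
    have "((\<lambda>a. w r * q powi (r\<^sup>2) * (Q ^ (a * a + a * k) / (qpoch Q Q a * qpoch Q Q (a + k)))) has_sum
            (w r * q powi (r\<^sup>2) * (1 / qpoch_inf Q Q))) UNIV"
      by (intro has_sum_cmult_right durfee Q)
    also have "?this \<longleftrightarrow> ?thesis"
      by (rule has_sum_reindex_bij_witness[of _ fst "\<lambda>a. (a, a + k)"]) (use val in \<open>auto simp: k\<close>)
    finally show ?thesis .
  next
    case False
    then obtain k where k: "r = - int k" by (metis int_cases2 of_nat_0_le_iff)
    have e: "q ^ ((a + (a + k))\<^sup>2) = q ^ (k\<^sup>2) * Q ^ (a * a + a * k)" for a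
      unfolding Q_def power_mult [symmetric] power_add [symmetric]
      by (rule arg_cong[of _ _ "(^) q"]) (simp add: power2_eq_square algebra_simps)
    have pw: "q powi (r\<^sup>2) = q ^ (k\<^sup>2)"
      by (metis k of_nat_power power2_minus power_int_of_nat)
    have val: "F (a + k, a) = w r * q powi (r\<^sup>2) * (Q ^ (a * a + a * k) / (qpoch Q Q a * qpoch Q Q (a + k)))" for a
    proof -
      have "F (a + k, a) = q ^ ((a + (a + k))\<^sup>2) * w r * (inverse (qpoch Q Q a) * inverse (qpoch Q Q (a + k)))"
        by (simp add: F_def k mult_ac add_ac)
      thus ?thesis unfolding e pw by (simp add: divide_inverse mult_ac)
    qed
    have "((\<lambda>a. w r * q powi (r\<^sup>2) * (Q ^ (a * a + a * k) / (qpoch Q Q a * qpoch Q Q (a + k)))) has_sum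
            (w r * q powi (r\<^sup>2) * (1 / qpoch_inf Q Q))) UNIV"
      by (intro has_sum_cmult_right durfee Q)
    also have "?this \<longleftrightarrow> ?thesis"
      by (rule has_sum_reindex_bij_witness[of _ snd "\<lambda>a. (a + k, a)"]) (use val in \<open>auto simp: k\<close>)
    finally show ?thesis .
  qed
  obtain S where S: "(F has_sum S) UNIV" using F by (auto simp: summable_on_def)
  have 1: "((\<lambda>n. q ^ (n\<^sup>2) * (\<Sum>a\<le>n. w (int n - 2 * int a) * rqfact2 Q a (int n - a))) has_sum S) UNIV"
    by (rule has_sum_fibres[OF S fib1])
  have 2: "((\<lambda>r. w r * q powi (r\<^sup>2) * (1 / qpoch_inf Q Q)) has_sum S) UNIV"
    by (rule has_sum_fibres[OF S fib2])
  have "((\<lambda>r. w r * q powi (r\<^sup>2) * (1 / qpoch_inf Q Q)) has_sum (W * (1 / qpoch_inf Q Q))) UNIV"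
    by (intro has_sum_cmult_left W)
  hence "S = W / qpoch_inf Q Q" using has_sum_unique[OF 2] by simp
  thus ?thesis using 1 by (simp add: Q_def)
qed

lemma has_sum_by_weight:
  fixes f :: "nat \<times> nat \<Rightarrow> complex"
  assumes q: "norm q < 1"
    and bound: "\<And>i j. norm (f (i, j)) \<le> C"
    and fib: "\<And>n. (\<Sum>j\<le>n div 2. f (n - 2 * j, j)) = c n"
    and S: "((\<lambda>n. q ^ (n\<^sup>2) * c n) has_sum S) UNIV"
  shows "((\<lambda>(i, j). q ^ ((i + 2 * j)\<^sup>2) * f (i, j)) has_sum S) UNIV"
proof (rule has_sum_from_fibres[where p = "\<lambda>(i, j). i + 2 * j", OF _ _ S])
  have C: "C \<ge> 0" using bound[of 0 0] norm_ge_zero order_trans by blast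
  show "(\<lambda>(i, j). q ^ ((i + 2 * j)\<^sup>2) * f (i, j)) summable_on UNIV"
  proof (rule summable_on_geometric_pairs)
    fix i j :: nat
    have "i + j \<le> (i + 2 * j)\<^sup>2"
    proof -
      have "i + j \<le> i + 2 * j" by simp
      also have "\<dots> \<le> (i + 2 * j)\<^sup>2" by (simp add: power2_eq_square)
      finally show ?thesis .
    qed
    hence "norm q ^ ((i + 2 * j)\<^sup>2) * norm (f (i, j)) \<le> norm q ^ (i + j) * C"
      using q C by (intro mult_mono bound power_decreasing) auto
    thus "norm (case (i, j) of (i, j) \<Rightarrow> q ^ ((i + 2 * j)\<^sup>2) * f (i, j)) \<le> C * (norm q ^ i * norm q ^ j)"
      by (simp add: norm_mult norm_power power_add mult_ac)
  qed (use q in auto)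
  show "((\<lambda>(i, j). q ^ ((i + 2 * j)\<^sup>2) * f (i, j)) has_sum (q ^ (n\<^sup>2) * c n)) {x. (case x of (i, j) \<Rightarrow> i + 2 * j) = n}" for n
  proof (rule has_sum_finiteI)
    have *: "{x. (case x of (i, j) \<Rightarrow> i + 2 * j) = n} = (\<lambda>j. (n - 2 * j, j)) ` {..n div 2}"
      by (auto simp: image_iff)
    show "finite {x. (case x of (i :: nat, j) \<Rightarrow> i + 2 * j) = n}" unfolding * by simp
    show "q ^ (n\<^sup>2) * c n = sum (\<lambda>(i, j). q ^ ((i + 2 * j)\<^sup>2) * f (i, j)) {x. (case x of (i, j) \<Rightarrow> i + 2 * j) = n}"
      unfolding * fib [symmetric] sum_distrib_left
      by (subst sum.reindex) (auto simp: inj_on_def intro!: sum.cong)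
  qed
qed

section \<open>The quintuple product identity\<close>

text \<open>A Wilf-Zeilberger argument: the difference of the summands for n + 1 and n is a
  difference in k, so the sum does not depend on n and equals its value at n = 0.\<close>

lemma quintuple_finite:
  fixes q x :: complex
  assumes q: "norm q < 1" "q \<noteq> 0" and x: "\<And>j. j \<le> 2 * n \<Longrightarrow> x\<^sup>2 * q ^ j \<noteq> 1"
  shows "(\<Sum>k\<le>n. (1 + x * q ^ k) * (qpoch q q n * rqfact2 q k (int n - k)) * qpoch x q (Suc n) /
            qpoch (x\<^sup>2 * q ^ k) q (Suc n) * x ^ k * q ^ (k * k)) = 1"
  using x
proof (induction n)
  case 0
  have "qpoch x q (Suc 0) = 1 - x" "qpoch (x\<^sup>2) q (Suc 0) = 1 - x\<^sup>2" by (simp_all add: qpoch_Suc)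
  moreover have "x\<^sup>2 \<noteq> 1" using 0[of 0] by simp
  moreover have "1 - x\<^sup>2 = (1 + x) * (1 - x)" by (simp add: power2_eq_square algebra_simps)
  ultimately show ?case by (auto simp: rqfact2_def)
next
  case (Suc n)
  define t where "t n k = (1 + x * q ^ k) * (qpoch q q n * rqfact2 q k (int n - k)) * qpoch x q (Suc n) /
            qpoch (x\<^sup>2 * q ^ k) q (Suc n) * x ^ k * q ^ (k * k)" for n k :: nat
  \<comment> \<open>The certificate. By the convention for \<open>rqfact2\<close> it vanishes at k =
    0 and at k = n + 2, so the telescoped sum is 0.\<close>
  define G where "G k = - (x ^ k) * q ^ (Suc n + k * (k - 1)) * (qpoch q q n * rqfact2 q (int k - 1) (int (Suc n) - k)) *
      qpoch x q (Suc n) / qpoch (x\<^sup>2 * q ^ k) q (Suc n)" for k :: nat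
  have step: "t (Suc n) k - t n k = G (Suc k) - G k" if k: "k \<le> Suc n" for k
  proof -
    define u v where "u = q ^ k" and "v = q ^ (Suc n - k)"
    define B where "B = rqfact2 q k (int (Suc n) - k)"
    define e where "e = q ^ (k * (k - 1))"
    define R where "R = qpoch (x\<^sup>2 * q ^ Suc k) q n"
    define X where "X = qpoch x q (Suc n)"
    define F where "F = qpoch q q n"
    have uv: "q ^ Suc n = u * v" using k by (simp add: u_def v_def flip: power_add power_Suc)
    have kk: "q ^ (k * k) = e * u" "q ^ (Suc k * (Suc k - 1)) = e * u * u"
      unfolding e_def u_def by (cases k; simp add: power_add)+
    have Gexp: "q ^ (Suc n + k * (k - 1)) = u * v * e" "q ^ (Suc n + Suc k * (Suc k - 1)) = u * v * (e * u * u)"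
      by (simp_all only: power_add uv kk e_def)
    have v': "q powi (int (Suc n) - int k) = v"
      using k unfolding v_def by (metis of_nat_diff power_int_of_nat)
    have B1: "rqfact2 q k (int n - k) = (1 - v) * B"
    proof -
      have "int n - int k = int (Suc n) - int k - 1" by simp
      thus ?thesis unfolding B_def by (simp only: rqfact2_pred'[OF q(1)] v')
    qed
    have B2: "rqfact2 q (int k - 1) (int (Suc n) - k) = (1 - u) * B"
      unfolding B_def u_def by (simp only: rqfact2_pred[OF q(1)] power_int_of_nat)
    have B3: "rqfact2 q (int (Suc k) - 1) (int (Suc n) - Suc k) = (1 - v) * B"
    proof -
      have "int (Suc k) - 1 = int k" "int (Suc n) - int (Suc k) = int n - int k" by simp_all
      thus ?thesis by (simp only: B1)
    qed
    have R1: "qpoch (x\<^sup>2 * q ^ k) q (Suc n) = (1 - x\<^sup>2 * u) * R"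
      unfolding R_def u_def by (subst qpoch_rec) (simp add: mult_ac)
    have R2: "qpoch (x\<^sup>2 * q ^ Suc k) q (Suc n) = R * (1 - x\<^sup>2 * u * (u * v))"
    proof -
      have "x\<^sup>2 * q ^ Suc k * q ^ n = x\<^sup>2 * u * q ^ Suc n" by (simp add: u_def mult_ac)
      thus ?thesis unfolding R_def qpoch_Suc[of _ _ n] uv by (simp only:)
    qed
    have R3: "qpoch (x\<^sup>2 * q ^ k) q (Suc (Suc n)) = (1 - x\<^sup>2 * u) * R * (1 - x\<^sup>2 * u * (u * v))"
    proof -
      have "x\<^sup>2 * q ^ k * q ^ Suc n = x\<^sup>2 * u * (u * v)" unfolding uv by (simp only: u_def)
      thus ?thesis unfolding qpoch_Suc[of _ q "Suc n"] R1 by (simp only:)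
    qed
    have nz: "1 - x\<^sup>2 * u \<noteq> 0" "1 - x\<^sup>2 * u * (u * v) \<noteq> 0" "R \<noteq> 0"
    proof -
      show "1 - x\<^sup>2 * u \<noteq> 0" using Suc.prems[of k] k by (auto simp: u_def)
      have "x\<^sup>2 * u * (u * v) = x\<^sup>2 * u * q ^ Suc n" by (simp only: uv)
      also have "\<dots> = x\<^sup>2 * q ^ (k + Suc n)" by (simp only: u_def power_add mult.assoc)
      finally have eq: "x\<^sup>2 * u * (u * v) = x\<^sup>2 * q ^ (k + Suc n)" .
      show "1 - x\<^sup>2 * u * (u * v) \<noteq> 0" unfolding eq using Suc.prems[of "k + Suc n"] k by simp
      have "1 - x\<^sup>2 * q ^ Suc k * q ^ i \<noteq> 0" if "i < n" for i
      proof -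
        have "x\<^sup>2 * q ^ (Suc k + i) \<noteq> 1" using k that by (intro Suc.prems) auto
        thus ?thesis by (simp add: power_add mult_ac)
      qed
      thus "R \<noteq> 0" unfolding R_def qpoch_def prod_zero_iff[OF finite_lessThan] by blast
    qed
    have X2: "qpoch x q (Suc (Suc n)) = X * (1 - x * (u * v))" unfolding X_def qpoch_Suc[of x q "Suc n"] uv ..
    have F2: "qpoch q q (Suc n) = F * (1 - u * v)" unfolding F_def qpoch_Suc uv[symmetric] by simp
    have t1: "t (Suc n) k = (1 + x * u) * (F * (1 - u * v) * B) * (X * (1 - x * (u * v))) /
       ((1 - x\<^sup>2 * u) * R * (1 - x\<^sup>2 * u * (u * v))) * x ^ k * (e * u)"
      unfolding t_def R3 X2 F2 kk u_def B_def ..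
    have t2: "t n k = (1 + x * u) * (F * ((1 - v) * B)) * X / ((1 - x\<^sup>2 * u) * R) * x ^ k * (e * u)"
      unfolding t_def R1 B1 kk by (simp add: u_def F_def X_def)
    have G1: "G k = - (x ^ k) * (u * v * e) * (F * ((1 - u) * B)) * X / ((1 - x\<^sup>2 * u) * R)"
      unfolding G_def R1 B2 Gexp F_def X_def ..
    have G2: "G (Suc k) = - (x * x ^ k) * (u * v * (e * u * u)) * (F * ((1 - v) * B)) * X / (R * (1 - x\<^sup>2 * u * (u * v)))"
      unfolding G_def R2 B3 Gexp F_def X_def by simp
    define D where "D = (1 - x\<^sup>2 * u) * R * (1 - x\<^sup>2 * u * (u * v))"
    define K where "K = F * B * X * x ^ k * e * u"
    have D: "D \<noteq> 0" using nz by (simp add: D_def)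
    have "t (Suc n) k = K * ((1 + x * u) * (1 - u * v) * (1 - x * (u * v))) / D"
      unfolding t1 D_def K_def by (simp add: mult_ac)
    moreover have "t n k = K * ((1 + x * u) * (1 - v) * (1 - x\<^sup>2 * u * (u * v))) / D"
      unfolding t2 D_def K_def using nz by (simp add: divide_simps) 
    moreover have "G k = K * (- v * (1 - u) * (1 - x\<^sup>2 * u * (u * v))) / D"
      unfolding G1 D_def K_def using nz by (simp add: divide_simps)
    moreover have "G (Suc k) = K * (- x * u * u * v * (1 - v) * (1 - x\<^sup>2 * u)) / D"
      unfolding G2 D_def K_def using nz by (simp add: divide_simps)
    moreover have "(1 + x * u) * (1 - u * v) * (1 - x * (u * v)) - (1 + x * u) * (1 - v) * (1 - x\<^sup>2 * u * (u * v)) =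
         (- x * u * u * v * (1 - v) * (1 - x\<^sup>2 * u)) - (- v * (1 - u) * (1 - x\<^sup>2 * u * (u * v)))"
      by (simp add: algebra_simps power2_eq_square)
    ultimately show ?thesis
      by (simp only: diff_divide_distrib [symmetric] right_diff_distrib [symmetric])
  qed
  have "(\<Sum>k\<le>Suc n. t (Suc n) k) - (\<Sum>k\<le>Suc n. t n k) = (\<Sum>k\<le>Suc n. G (Suc k) - G k)"
    unfolding sum_subtractf [symmetric] by (intro sum.cong refl step) auto
  also have "\<dots> = G (Suc (Suc n)) - G 0" unfolding lessThan_Suc_atMost [symmetric] by (rule sum_lessThan_telescope)
  also have "\<dots> = 0" by (simp add: G_def rqfact2_def)
  also have "(\<Sum>k\<le>Suc n. t n k) = (\<Sum>k\<le>n. t n k)" by (simp add: t_def rqfact2_def)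
  also have "\<dots> = 1" unfolding t_def using Suc.prems by (intro Suc.IH) auto
  finally show ?case unfolding t_def by simp
qed

text \<open>The product on the left consists of the factors 1 - a / p^i = - (a / p^i) (1 - p^i / a)
  for i = 1, ..., m, in reverse order.\<close>

lemma qpoch_reflect:
  assumes "a \<noteq> 0" "p \<noteq> 0"
  shows "p ^ (m * (m + 1) div 2) * qpoch (a / p ^ m) p m = (- a) ^ m * qpoch (p / a) p m"
proof (induction m)
  case (Suc m)
  have e: "Suc m * (Suc m + 1) div 2 = m * (m + 1) div 2 + Suc m"
  proof -
    have "Suc m * (Suc m + 1) = m * (m + 1) + 2 * Suc m" by simp
    moreover have "(m * (m + 1) + 2 * Suc m) div 2 = Suc m + m * (m + 1) div 2"
      by (rule div_mult_self2) simp
    ultimately show ?thesis by (simp only: add.commute)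
  qed
  have "qpoch (a / p ^ Suc m) p (Suc m) = (1 - a / p ^ Suc m) * qpoch (a / p ^ m) p m"
    using assms by (subst qpoch_rec) (simp add: field_simps)
  hence "p ^ (Suc m * (Suc m + 1) div 2) * qpoch (a / p ^ Suc m) p (Suc m) =
     (p ^ Suc m * (1 - a / p ^ Suc m)) * (p ^ (m * (m + 1) div 2) * qpoch (a / p ^ m) p m)"
    unfolding e power_add by (simp only: mult_ac)
  also have "p ^ Suc m * (1 - a / p ^ Suc m) = - a * (1 - p / a * p ^ m)"
    using assms by (simp add: field_simps)
  also note Suc.IH
  finally show ?case by (simp add: qpoch_Suc mult_ac)
qed simp

definition quint_exp :: "int \<Rightarrow> int" where
  "quint_exp k = (3 * k\<^sup>2 - k) div 2"

lemma quint_exp: "2 * quint_exp k = 3 * k\<^sup>2 - k"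
proof -
  have "even (3 * k\<^sup>2 - k)" by simp
  thus ?thesis by (simp add: quint_exp_def)
qed

text \<open>Obtained from \<open>quintuple_finite\<close> with n = 2m, x = z / p^m and summation
  index k = j - m, so that the sum becomes bilateral as m grows. The bounds |p| < |z^2| < 1 keep z^2
  away from all integer powers of p, hence no denominator vanishes.\<close>

lemma quintuple_finite_bilateral:
  fixes p z :: complex
  assumes p: "norm p < 1" "p \<noteq> 0" and z: "norm z < 1" "z \<noteq> 0" "norm p < norm (z\<^sup>2)"
  shows "(\<Sum>k\<in>{-int m..int m}. (-1) powi k * (1 + z * p powi k) * z powi (3 * k) * p powi quint_exp k *
     (qpoch p p (2 * m) * rqfact2 p (int m + k) (int m - k) * qpoch (p / z) p m * qpoch z p (Suc m) /
      (qpoch (p / z\<^sup>2) p (nat (int m - k)) * qpoch (z\<^sup>2) p (Suc (nat (int m + k)))))) = 1"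
proof -
  define x where "x = z / p ^ m"
  have z2: "norm (z\<^sup>2) < 1" using z by (simp add: norm_power power_less_one_iff)
  have nzj: "z\<^sup>2 * p ^ j \<noteq> 1" for j by (rule mult_power_neq_1[OF p(1) z2])
  have nzj': "z\<^sup>2 \<noteq> p ^ Suc j" for j
  proof
    assume "z\<^sup>2 = p ^ Suc j"
    hence "norm (z\<^sup>2) = norm p * norm p ^ j" by (simp add: norm_mult norm_power)
    also have "\<dots> \<le> norm p * 1" using p by (intro mult_left_mono power_le_one) auto
    finally show False using z by simp
  qed
  have x2: "x\<^sup>2 * p ^ j \<noteq> 1" for j
  proof (cases "j \<ge> 2 * m")
    case True
    hence "x\<^sup>2 * p ^ j = z\<^sup>2 * p ^ (j - 2 * m)"
      using p by (simp add: x_def power_diff power_divide power_mult power_even_eq field_simps flip: power_mult)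
    thus ?thesis using nzj by simp
  next
    case False
    then obtain i where i: "2 * m = j + Suc i" by (metis not_le less_imp_Suc_add add_Suc_right)
    have "x\<^sup>2 * p ^ j = z\<^sup>2 / p ^ Suc i"
    proof -
      have "x\<^sup>2 = z\<^sup>2 / p ^ (2 * m)" by (simp add: x_def power_divide power_even_eq)
      thus ?thesis unfolding i using p by (simp add: power_add)
    qed
    thus ?thesis using nzj'[of i] p by (simp add: divide_eq_1_iff del: power_Suc)
  qed
  have summand: "(1 + x * p ^ j) * (qpoch p p (2 * m) * rqfact2 p j (int (2 * m) - j)) * qpoch x p (Suc (2 * m)) /
            qpoch (x\<^sup>2 * p ^ j) p (Suc (2 * m)) * x ^ j * p ^ (j * j) =
     (-1) powi k * (1 + z * p powi k) * z powi (3 * k) * p powi quint_exp k *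
     (qpoch p p (2 * m) * rqfact2 p (int m + k) (int m - k) * qpoch (p / z) p m * qpoch z p (Suc m) /
      (qpoch (p / z\<^sup>2) p (nat (int m - k)) * qpoch (z\<^sup>2) p (Suc (nat (int m + k)))))"
    if j: "j \<le> 2 * m" and k: "k = int j - int m" for j k
  proof -
    define m' where "m' = 2 * m - j"
    have jm: "j + m' = 2 * m" using j by (simp add: m'_def)
    have k': "int m + k = int j" "int m - k = int m'" using j by (auto simp: k m'_def)
    have k'': "int (2 * m) - int j = int m'" using jm by linarith
    define T where "T i = p ^ (i * (i + 1) div 2)" for i :: nat
    have T: "T i \<noteq> 0" for i using p by (simp add: T_def)
    have A: "qpoch x p (Suc (2 * m)) = (- z) ^ m * qpoch (p / z) p m / T m * qpoch z p (Suc m)"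
    proof -
      have "Suc (2 * m) = m + Suc m" by simp
      hence "qpoch x p (Suc (2 * m)) = qpoch x p m * qpoch (x * p ^ m) p (Suc m)" by (simp only: qpoch_add)
      also have "x * p ^ m = z" using p by (simp add: x_def)
      also have "qpoch x p m = (- z) ^ m * qpoch (p / z) p m / T m"
        using qpoch_reflect[OF z(2) p(2), of m] T[of m] by (simp add: x_def T_def field_simps)
      finally show ?thesis .
    qed
    have z2p: "x\<^sup>2 * p ^ j = z\<^sup>2 / p ^ m'"
    proof -
      have "x\<^sup>2 = z\<^sup>2 / p ^ (2 * m)" by (simp add: x_def power_divide power_even_eq)
      thus ?thesis unfolding jm [symmetric] using p by (simp add: power_add)
    qed
    have B: "qpoch (x\<^sup>2 * p ^ j) p (Suc (2 * m)) = (- (z\<^sup>2)) ^ m' * qpoch (p / z\<^sup>2) p m' / T m' * qpoch (z\<^sup>2) p (Suc j)"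
    proof -
      have "Suc (2 * m) = m' + Suc j" using jm by simp
      hence "qpoch (x\<^sup>2 * p ^ j) p (Suc (2 * m)) = qpoch (x\<^sup>2 * p ^ j) p m' * qpoch (x\<^sup>2 * p ^ j * p ^ m') p (Suc j)"
        by (simp only: qpoch_add)
      also have "x\<^sup>2 * p ^ j * p ^ m' = z\<^sup>2" unfolding z2p using p by simp
      also have "qpoch (x\<^sup>2 * p ^ j) p m' = (- (z\<^sup>2)) ^ m' * qpoch (p / z\<^sup>2) p m' / T m'"
        using qpoch_reflect[of "z\<^sup>2" p m'] z p T[of m'] unfolding z2p by (simp add: T_def field_simps)
      finally show ?thesis .
    qed
    have xj: "x * p ^ j = z * p powi k"
      using p unfolding x_def k by (simp add: power_int_diff)
    \<comment> \<open>The triangular powers of p produced by the two reflections combine with p^(j^2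
      - m j) to p^((3k^2 - k)/2).\<close>
    have monomial: "(- z) ^ m / T m / ((- (z\<^sup>2)) ^ m' / T m') * x ^ j * p ^ (j * j) =
        (-1) powi k * z powi (3 * k) * p powi quint_exp k"
    proof -
      have tri: "2 * (int (i * (i + 1) div 2)) = int i * (int i + 1)" for i
      proof -
        have "2 * (i * (i + 1) div 2) = i * (i + 1)" by simp
        thus ?thesis by (metis of_nat_1 of_nat_add of_nat_mult of_nat_numeral)
      qed
      have s: "(- z) ^ m = (-1) powi int m * z powi int m" "(- (z\<^sup>2)) ^ m' = (-1) powi int m' * z powi (2 * int m')"
        by (simp_all only: power_int_of_nat power_minus[of z] power_minus[of "z\<^sup>2"])
           (metis of_nat_mult of_nat_numeral power_int_of_nat power_mult)
      have Tp: "T i = p powi (int (i * (i + 1) div 2))" for i by (simp only: T_def power_int_of_nat)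
      have xp: "x ^ j = z powi int j / p powi (int m * int j)" "p ^ (j * j) = p powi (int j * int j)"
        by (simp_all only: x_def power_divide power_int_of_nat flip: of_nat_mult power_mult)
      have "(- z) ^ m / T m / ((- (z\<^sup>2)) ^ m' / T m') * x ^ j * p ^ (j * j) =
        ((-1) powi (int m - int m')) * z powi (int m - 2 * int m' + int j) *
          p powi (int (m' * (m' + 1) div 2) - int (m * (m + 1) div 2) - int m * int j + int j * int j)"
        unfolding s Tp xp using p z by (simp add: power_int_add power_int_diff) (simp add: field_simps)
      also have "int m - int m' = k" using jm k by linarith
      also have "int m - 2 * int m' + int j = 3 * k" using jm k by linarith
      also have "int (m' * (m' + 1) div 2) - int (m * (m + 1) div 2) - int m * int j + int j * int j = quint_exp k"
      proof -
        have m': "int m' = int m - k" "int j = int m + k" using k' by auto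
        define A B where "A = int (m' * (m' + 1) div 2)" and "B = int (m * (m + 1) div 2)"
        have "2 * A = (int m - k) * (int m - k + 1)" "2 * B = int m * (int m + 1)"
          using tri[of m'] tri[of m] by (simp_all only: A_def B_def m')
        hence "2 * (A - B - int m * int j + int j * int j) = 2 * quint_exp k"
          unfolding quint_exp m'(2) by (simp add: power2_eq_square algebra_simps)
        hence "A - B - int m * int j + int j * int j = quint_exp k" by (subst (asm) mult_cancel_left) simp
        thus ?thesis by (simp only: A_def B_def)
      qed
      finally show ?thesis .
    qed
    have "(1 + x * p ^ j) * (qpoch p p (2 * m) * rqfact2 p j (int (2 * m) - j)) * qpoch x p (Suc (2 * m)) /
            qpoch (x\<^sup>2 * p ^ j) p (Suc (2 * m)) * x ^ j * p ^ (j * j) =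
      ((- z) ^ m / T m / ((- (z\<^sup>2)) ^ m' / T m') * x ^ j * p ^ (j * j)) * (1 + z * p powi k) *
      (qpoch p p (2 * m) * rqfact2 p j m' * qpoch (p / z) p m * qpoch z p (Suc m) /
      (qpoch (p / z\<^sup>2) p m' * qpoch (z\<^sup>2) p (Suc j)))"
      unfolding A B xj k'' by (simp add: mult_ac)
    thus ?thesis unfolding monomial k' nat_int by (simp only: mult_ac)
  qed
  have "(\<Sum>k\<in>{-int m..int m}. (-1) powi k * (1 + z * p powi k) * z powi (3 * k) * p powi quint_exp k *
     (qpoch p p (2 * m) * rqfact2 p (int m + k) (int m - k) * qpoch (p / z) p m * qpoch z p (Suc m) /
      (qpoch (p / z\<^sup>2) p (nat (int m - k)) * qpoch (z\<^sup>2) p (Suc (nat (int m + k)))))) =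
    (\<Sum>j\<le>2 * m. (1 + x * p ^ j) * (qpoch p p (2 * m) * rqfact2 p j (int (2 * m) - j)) * qpoch x p (Suc (2 * m)) /
            qpoch (x\<^sup>2 * p ^ j) p (Suc (2 * m)) * x ^ j * p ^ (j * j))"
  proof (rule sum.reindex_bij_witness[of _ "\<lambda>j. int j - int m" "\<lambda>k. nat (k + int m)"], goal_cases)
    case (5 k)
    thus ?case by (intro summand) auto
  qed auto
  also have "\<dots> = 1" by (rule quintuple_finite[OF p x2])
  finally show ?thesis .
qed

text \<open>The limit of \<open>quintuple_finite_bilateral\<close> for m to infinity. The factor
  \<open>R m k\<close> is bounded uniformly in m and k, so summability of the theta terms suffices
  for dominated convergence. Its limit \<open>L\<close> does not depend on k, hence the theta series
  times \<open>L\<close> is 1.\<close>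

theorem quintuple_product:
  fixes p z :: complex
  assumes p: "norm p < 1" "p \<noteq> 0" and z: "norm z < 1" "z \<noteq> 0" "norm p < norm (z\<^sup>2)"
    and summable: "(\<lambda>k. norm ((-1) powi k * (1 + z * p powi k) * z powi (3 * k) * p powi quint_exp k)) summable_on UNIV"
  shows "((\<lambda>k. (-1) powi k * (1 + z * p powi k) * z powi (3 * k) * p powi quint_exp k) has_sum
     (qpoch_inf p p * qpoch_inf (z\<^sup>2) p * qpoch_inf (p / z\<^sup>2) p / (qpoch_inf z p * qpoch_inf (p / z) p))) UNIV"
proof -
  define h where "h k = (-1) powi k * (1 + z * p powi k) * z powi (3 * k) * p powi quint_exp k" for k :: int
  have z2: "norm (z\<^sup>2) < 1" using z by (simp add: norm_power power_less_one_iff)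
  have pz2: "norm (p / z\<^sup>2) < 1" using z by (simp add: norm_divide divide_simps)
  have pz: "norm (p / z) < 1"
  proof -
    have "norm p < norm z * norm z" using z by (simp add: norm_mult power2_eq_square)
    also have "\<dots> \<le> norm z * 1" using z by (intro mult_left_mono) auto
    finally show ?thesis using z by (simp add: norm_divide divide_simps)
  qed
  note nz = qpoch_inf_nonzero'[OF p(1) p(1)] qpoch_inf_nonzero'[OF p(1) z2] qpoch_inf_nonzero'[OF p(1) pz2]
    qpoch_inf_nonzero'[OF p(1) z(1)] qpoch_inf_nonzero'[OF p(1) pz]
  obtain C1 where C1: "C1 > 0" "\<And>n. norm (qpoch p p n) \<le> C1" "\<And>n. norm (inverse (qpoch p p n)) \<le> C1"
    using qpoch_bounds[OF p(1) p(1)] by blast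
  obtain C2 where C2: "C2 > 0" "\<And>n. norm (qpoch z p n) \<le> C2" "\<And>n. norm (inverse (qpoch z p n)) \<le> C2"
    using qpoch_bounds[OF p(1) z(1)] by blast
  obtain C3 where C3: "C3 > 0" "\<And>n. norm (qpoch (p / z) p n) \<le> C3" "\<And>n. norm (inverse (qpoch (p / z) p n)) \<le> C3"
    using qpoch_bounds[OF p(1) pz] by blast
  obtain C4 where C4: "C4 > 0" "\<And>n. norm (qpoch (z\<^sup>2) p n) \<le> C4" "\<And>n. norm (inverse (qpoch (z\<^sup>2) p n)) \<le> C4"
    using qpoch_bounds[OF p(1) z2] by blast
  obtain C5 where C5: "C5 > 0" "\<And>n. norm (qpoch (p / z\<^sup>2) p n) \<le> C5" "\<And>n. norm (inverse (qpoch (p / z\<^sup>2) p n)) \<le> C5"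
    using qpoch_bounds[OF p(1) pz2] by blast
  define R where "R m k = qpoch p p (2 * m) * inverse (qpoch p p (nat (int m + k))) * inverse (qpoch p p (nat (int m - k))) *
      qpoch (p / z) p m * qpoch z p (Suc m) *
      inverse (qpoch (p / z\<^sup>2) p (nat (int m - k))) * inverse (qpoch (z\<^sup>2) p (Suc (nat (int m + k))))" for m :: nat and k :: int
  define f where "f m k = (if \<bar>k\<bar> \<le> int m then h k * R m k else 0)" for m k
  define L where "L = qpoch_inf p p * inverse (qpoch_inf p p) * inverse (qpoch_inf p p) *
      qpoch_inf (p / z) p * qpoch_inf z p * inverse (qpoch_inf (p / z\<^sup>2) p) * inverse (qpoch_inf (z\<^sup>2) p)"
  define C where "C = C1 * C1 * C1 * C3 * C2 * C5 * C4"
  have R_bound: "norm (R m k) \<le> C" for m k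
    unfolding R_def C_def norm_mult using C1(1) C2(1) C3(1) C4(1) C5(1)
    by (intro mult_mono C1(2,3) C2(2,3) C3(2,3) C4(2,3) C5(2,3)) auto
  have C: "C \<ge> 0" using R_bound[of 0 0] norm_ge_zero order_trans by blast
  have lim: "(\<lambda>m. f m k) \<longlonglongrightarrow> h k * L" for k
  proof (rule Lim_transform_eventually)
    have sub: "filterlim (\<lambda>m. nat (int m + k)) at_top sequentially" "filterlim (\<lambda>m. nat (int m - k)) at_top sequentially"
    proof -
      show "filterlim (\<lambda>m. nat (int m + k)) at_top sequentially"
        unfolding filterlim_at_top
      proof
        fix Z show "\<forall>\<^sub>F m in sequentially. Z \<le> nat (int m + k)"
          using eventually_ge_at_top[of "nat (int Z - k)"] by eventually_elim linarith
      qed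
      show "filterlim (\<lambda>m. nat (int m - k)) at_top sequentially"
        unfolding filterlim_at_top
      proof
        fix Z show "\<forall>\<^sub>F m in sequentially. Z \<le> nat (int m - k)"
          using eventually_ge_at_top[of "nat (int Z + k)"] by eventually_elim linarith
      qed
    qed
    have sub2: "filterlim (\<lambda>m. 2 * m) at_top (sequentially :: nat filter)"
      by (rule filterlim_subseq) (auto simp: strict_mono_def)
    have sub3: "filterlim (\<lambda>m. Suc (nat (int m + k))) at_top sequentially" "filterlim Suc at_top sequentially"
      using filterlim_compose[OF filterlim_Suc sub(1)] filterlim_Suc by auto
    note q = filterlim_compose[OF qpoch_tendsto[OF p(1)]]
    show "(\<lambda>m. h k * R m k) \<longlonglongrightarrow> h k * L"
      unfolding R_def L_def
      by (intro tendsto_intros q sub sub2 sub3 qpoch_tendsto p nz)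
    show "\<forall>\<^sub>F m in sequentially. h k * R m k = f m k"
      using eventually_ge_at_top[of "nat \<bar>k\<bar>"] by eventually_elim (auto simp: f_def)
  qed
  have bound: "norm (f m k) \<le> C * norm (h k)" for m k
  proof (cases "\<bar>k\<bar> \<le> int m")
    case True
    have "norm (h k) * norm (R m k) \<le> norm (h k) * C" by (intro mult_left_mono R_bound) auto
    thus ?thesis using True by (simp add: f_def norm_mult mult.commute)
  next
    case False
    thus ?thesis using C by (simp add: f_def)
  qed
  have "(\<lambda>k. norm (h k)) summable_on UNIV" using summable by (simp add: h_def)
  hence "(\<lambda>k. C * norm (h k)) summable_on UNIV" by (rule summable_on_cmult_right)
  from infsum_tannery(1)[OF lim bound this]
  have "(\<lambda>m. infsum (f m) UNIV) \<longlonglongrightarrow> infsum (\<lambda>k. h k * L) UNIV" by simp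
  moreover have "infsum (f m) UNIV = 1" for m
  proof -
    have "infsum (f m) UNIV = infsum (f m) {-int m..int m}"
      by (rule infsum_cong_neutral) (auto simp: f_def)
    also have "\<dots> = sum (f m) {-int m..int m}" by simp
    also have "\<dots> = (\<Sum>k\<in>{-int m..int m}. h k *
     (qpoch p p (2 * m) * rqfact2 p (int m + k) (int m - k) * qpoch (p / z) p m * qpoch z p (Suc m) /
      (qpoch (p / z\<^sup>2) p (nat (int m - k)) * qpoch (z\<^sup>2) p (Suc (nat (int m + k))))))"
      by (intro sum.cong refl) (auto simp: f_def R_def rqfact2_def divide_inverse)
    also have "\<dots> = 1" unfolding h_def by (rule quintuple_finite_bilateral[OF p z])
    finally show ?thesis .
  qed
  ultimately have "infsum (\<lambda>k. h k * L) UNIV = 1" by (simp add: LIMSEQ_const_iff)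
  hence "infsum h UNIV * L = 1" by (simp add: infsum_cmult_left')
  hence "infsum h UNIV = inverse L" by (metis inverse_unique mult.commute)
  also have "\<dots> = qpoch_inf p p * qpoch_inf (z\<^sup>2) p * qpoch_inf (p / z\<^sup>2) p / (qpoch_inf z p * qpoch_inf (p / z) p)"
    unfolding L_def using nz by (simp add: field_simps)
  finally have "infsum h UNIV = \<dots>" .
  moreover have "h summable_on UNIV" unfolding h_def by (rule abs_summable_summable[OF summable])
  ultimately show ?thesis by (simp add: has_sum_iff h_def [abs_def])
qed

section \<open>The identities modulo 28\<close>

lemma summable_on_int_geometric:
  fixes \<rho> :: real
  assumes "0 \<le> \<rho>" "\<rho> < 1"
  shows "(\<lambda>k. \<rho> ^ nat \<bar>k\<bar>) summable_on (UNIV :: int set)"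
proof -
  have g: "(\<lambda>n. \<rho> ^ n) summable_on (UNIV :: nat set)"
    using assms by (intro summable_nonneg_imp_summable_on) auto
  have "(\<lambda>k. \<rho> ^ nat \<bar>k\<bar>) summable_on range int"
    using g by (subst summable_on_reindex) (auto simp: o_def)
  moreover have "(\<lambda>k. \<rho> ^ nat \<bar>k\<bar>) summable_on range (\<lambda>n. - int n)"
    using g by (subst summable_on_reindex) (auto simp: o_def inj_on_def)
  ultimately have "(\<lambda>k. \<rho> ^ nat \<bar>k\<bar>) summable_on (range int \<union> range (\<lambda>n. - int n))"
    by (rule summable_on_union)
  also have "range int \<union> range (\<lambda>n. - int n) = UNIV"
  proof (intro equalityI subset_UNIV subsetI)
    fix k :: int show "k \<in> range int \<union> range (\<lambda>n. - int n)"
      by (cases k rule: int_cases2) auto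
  qed
  finally show ?thesis .
qed

lemma norm_powi_le:
  assumes "norm (q :: complex) < 1" "E \<ge> \<bar>k\<bar>"
  shows "norm (q powi E) \<le> norm q ^ nat \<bar>k\<bar>"
proof -
  have "q powi E = q ^ nat E" using assms by (simp add: power_int_def)
  moreover have "norm q ^ nat E \<le> norm q ^ nat \<bar>k\<bar>"
    using assms by (intro power_decreasing) auto
  ultimately show ?thesis by (simp add: norm_power)
qed

lemma norm_powi_le_1:
  assumes "norm (q :: complex) < 1" "E \<ge> 0"
  shows "norm (q powi E) \<le> 1"
  using norm_powi_le[OF assms(1), of 0 E] assms(2) by simp

lemma norm_minus_one_powi [simp]: "norm ((-1 :: complex) powi k) = 1"
  by (simp add: norm_power_int)

lemma norm_wA: "norm q < 1 \<Longrightarrow> norm (wA q r) \<le> 1"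
proof (cases r rule: mod3_cases)
  case (1 k)
  have "3 * k\<^sup>2 + k = 2 * k\<^sup>2 + k * (k + 1)" by (simp add: power2_eq_square algebra_simps)
  moreover have "k * (k + 1) \<ge> 0" by (cases "k \<ge> 0") (auto intro: mult_nonpos_nonpos)
  moreover have "k\<^sup>2 \<ge> 0" by simp
  ultimately have "3 * k\<^sup>2 + k \<ge> 0" by linarith
  thus "norm q < 1 \<Longrightarrow> ?thesis" using 1 by (simp add: wA_simps norm_mult norm_powi_le_1)
next
  case (2 k)
  have "3 * k\<^sup>2 + k = 2 * k\<^sup>2 + k * (k + 1)" by (simp add: power2_eq_square algebra_simps)
  moreover have "k * (k + 1) \<ge> 0" by (cases "k \<ge> 0") (auto intro: mult_nonpos_nonpos)
  moreover have "k\<^sup>2 \<ge> 0" by simp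
  ultimately have "3 * k\<^sup>2 + k \<ge> 0" by linarith
  thus "norm q < 1 \<Longrightarrow> ?thesis" using 2 by (simp add: wA_simps norm_mult norm_powi_le_1)
qed (simp add: wA_simps)

lemma quadratic_nonneg:
  fixes k :: int
  shows "3 * k\<^sup>2 + 2 * k \<ge> 0" "6 * k\<^sup>2 - k \<ge> 0" "6 * k\<^sup>2 + 5 * k + 1 \<ge> 0"
proof -
  have 1: "k * (k + 1) \<ge> 0" by (cases "k \<ge> 0") (auto intro: mult_nonpos_nonpos)
  have 2: "k * (k - 1) \<ge> 0" by (cases "k \<ge> 1") (auto intro: mult_nonpos_nonpos)
  have sq: "k\<^sup>2 \<ge> 0" by simp
  have eqs: "3 * k\<^sup>2 + 2 * k = k\<^sup>2 + 2 * (k * (k + 1))" "6 * k\<^sup>2 - k = 5 * k\<^sup>2 + k * (k - 1)"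
      "6 * k\<^sup>2 + 5 * k + 1 = k\<^sup>2 + 5 * (k * (k + 1)) + 1"
    by (simp_all add: power2_eq_square algebra_simps)
  show "3 * k\<^sup>2 + 2 * k \<ge> 0" "6 * k\<^sup>2 - k \<ge> 0" "6 * k\<^sup>2 + 5 * k + 1 \<ge> 0"
    unfolding eqs using 1 2 sq by linarith+
qed

lemma norm_wB: "norm q < 1 \<Longrightarrow> norm (wB q r) \<le> 1"
  by (cases r rule: mod3_cases) (auto simp: wB_simps norm_mult intro!: norm_powi_le_1 quadratic_nonneg)

lemma norm_wC: "norm t < 1 \<Longrightarrow> norm (wC t r) \<le> 1"
  by (cases r rule: mod3_cases) (auto simp: wC_simps norm_mult intro!: norm_powi_le_1 quadratic_nonneg)

lemma has_sum_two_ranges: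
  fixes f :: "int \<Rightarrow> complex" and ha hb :: "int \<Rightarrow> int"
  assumes "inj ha" "inj hb" "range ha \<inter> range hb = {}"
    and 0: "\<And>r. r \<notin> range ha \<Longrightarrow> r \<notin> range hb \<Longrightarrow> f r = 0"
    and s: "(\<lambda>k. f (ha k)) summable_on UNIV" "(\<lambda>k. f (hb k)) summable_on UNIV"
    and S: "((\<lambda>k. f (ha k) + f (hb k)) has_sum S) UNIV"
  shows "(f has_sum S) UNIV"
proof -
  obtain S1 S2 where S12: "((\<lambda>k. f (ha k)) has_sum S1) UNIV" "((\<lambda>k. f (hb k)) has_sum S2) UNIV"
    using s by (auto simp: summable_on_def)
  have "S = S1 + S2" using has_sum_unique[OF S has_sum_add[OF S12]] .
  moreover have "(f has_sum S1) (range ha)" "(f has_sum S2) (range hb)"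
    using S12 assms(1,2) by (simp_all add: has_sum_reindex o_def)
  hence "(f has_sum (S1 + S2)) (range ha \<union> range hb)"
    using assms(3) by (intro has_sum_Un_disjoint)
  hence "(f has_sum (S1 + S2)) UNIV"
    by (rule has_sum_cong_neutral[THEN iffD1, rotated -1]) (use 0 in auto)
  ultimately show ?thesis by simp
qed

text \<open>The product side of the quintuple product identity at p = q^14 and z = q^e.\<close>

definition quint_val :: "nat \<Rightarrow> complex \<Rightarrow> complex" where
  "quint_val e q = qpoch_inf (q ^ 14) (q ^ 14) * qpoch_inf (q ^ (2 * e)) (q ^ 14) * qpoch_inf (q ^ (14 - 2 * e)) (q ^ 14) /
     (qpoch_inf (q ^ e) (q ^ 14) * qpoch_inf (q ^ (14 - e)) (q ^ 14))"

text \<open>With exponents at least |k|, both theta series are dominated by the geometric series in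
  |q|^|k|.\<close>

lemma quint_exponent_bounds:
  fixes k e :: int
  assumes "1 \<le> e" "e \<le> 5"
  shows "\<bar>k\<bar> \<le> 21 * k\<^sup>2 - 7 * k + 3 * e * k" "\<bar>k\<bar> \<le> 21 * k\<^sup>2 + 7 * k + 3 * e * k + e"
proof -
  have eqs: "21 * k\<^sup>2 - 7 * k + 3 * e * k = 21 * (k * k) - 7 * k + 3 * (e * k)"
    "21 * k\<^sup>2 + 7 * k + 3 * e * k + e = 21 * (k * k) + 7 * k + 3 * (e * k) + e"
    by (simp_all add: power2_eq_square)
  consider "k = 0" | "k \<ge> 1" | "k = -1" | "k \<le> -2" by linarith
  hence "\<bar>k\<bar> \<le> 21 * k\<^sup>2 - 7 * k + 3 * e * k \<and> \<bar>k\<bar> \<le> 21 * k\<^sup>2 + 7 * k + 3 * e * k + e"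
  proof cases
    case 2
    have "k * 1 \<le> k * k" using 2 by (intro mult_left_mono) auto
    moreover have "1 * k \<le> e * k" using 2 assms by (intro mult_right_mono) auto
    moreover have "\<bar>k\<bar> = k" using 2 by simp
    ultimately show ?thesis using 2 assms unfolding eqs by linarith
  next
    case 4
    have "(-k) * 2 \<le> (-k) * (-k)" using 4 by (intro mult_left_mono) auto
    moreover have "e * (-k) \<le> 5 * (-k)" using 4 assms by (intro mult_right_mono) auto
    moreover have "\<bar>k\<bar> = - k" using 4 by simp
    ultimately show ?thesis using 4 assms unfolding eqs mult_minus_left mult_minus_right minus_minus by linarith
  qed (use assms in auto)
  thus "\<bar>k\<bar> \<le> 21 * k\<^sup>2 - 7 * k + 3 * e * k" "\<bar>k\<bar> \<le> 21 * k\<^sup>2 + 7 * k + 3 * e * k + e" by auto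
qed

text \<open>The two terms of 1 + z p^k are kept apart as \<open>g1\<close> and \<open>g2\<close>,
  because in the application they come from different residue classes modulo 3. The bound e \<le> 5
  gives |p| < |z^2| for p = q^14 and z = q^e.\<close>

lemma quintuple_14:
  fixes q :: complex
  assumes q: "norm q < 1" "q \<noteq> 0" and e: "1 \<le> e" "e \<le> 5"
  defines "g1 \<equiv> \<lambda>k. (-1) powi k * q powi (21 * k\<^sup>2 - 7 * k + 3 * int e * k)"
  defines "g2 \<equiv> \<lambda>k. (-1) powi k * q powi (21 * k\<^sup>2 + 7 * k + 3 * int e * k + int e)"
  shows "g1 summable_on UNIV" "g2 summable_on UNIV"
    "((\<lambda>k. g1 k + g2 k) has_sum quint_val e q) UNIV"
proof -
  define p where "p = q ^ 14"
  define z where "z = q ^ e"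
  have geom: "(\<lambda>k. norm q ^ nat \<bar>k\<bar>) summable_on (UNIV :: int set)"
    using q by (intro summable_on_int_geometric) auto
  have b: "norm (g1 k) \<le> norm q ^ nat \<bar>k\<bar>" "norm (g2 k) \<le> norm q ^ nat \<bar>k\<bar>" for k
    unfolding g1_def g2_def norm_mult norm_minus_one_powi mult_1
    using e by (intro norm_powi_le[OF q(1)] quint_exponent_bounds; simp)+
  have abs: "(\<lambda>k. norm (g1 k)) summable_on UNIV" "(\<lambda>k. norm (g2 k)) summable_on UNIV"
    using b by (auto intro!: Infinite_Sum.abs_summable_on_comparison_test'[OF geom])
  thus "g1 summable_on UNIV" "g2 summable_on UNIV" by (auto intro: abs_summable_summable)
  have p: "norm p < 1" "p \<noteq> 0" using q by (auto simp: p_def norm_power power_less_one_iff)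
  have z: "norm z < 1" "z \<noteq> 0" using q e by (auto simp: z_def norm_power power_less_one_iff)
  have pz: "norm p < norm (z\<^sup>2)"
    unfolding p_def z_def power_mult [symmetric] norm_power
    using q e by (intro power_strict_decreasing) auto
  have h: "(-1) powi k * (1 + z * p powi k) * z powi (3 * k) * p powi quint_exp k = g1 k + g2 k" for k
  proof -
    have 1: "z = q powi int e" "p powi m = q powi (14 * m)" "z powi m = q powi (int e * m)" for m
      unfolding z_def p_def by (simp_all add: power_int_mult)
    have 2: "14 * quint_exp k = 21 * k\<^sup>2 - 7 * k" using quint_exp[of k] by linarith
    have "(-1) powi k * (1 + z * p powi k) * z powi (3 * k) * p powi quint_exp k =
       (-1) powi k * (q powi (int e * (3 * k)) * q powi (21 * k\<^sup>2 - 7 * k)) +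
       (-1) powi k * (q powi int e * q powi (14 * k) * q powi (int e * (3 * k)) * q powi (21 * k\<^sup>2 - 7 * k))"
      unfolding 1(2,3) 2 by (subst 1(1)) (simp add: algebra_simps)
    also have "\<dots> = g1 k + g2 k"
      unfolding g1_def g2_def using q by (simp only: power_int_add [OF disjI1, symmetric] not_False_eq_True) (simp add: algebra_simps)
    finally show ?thesis .
  qed
  have "(\<lambda>k. norm (g1 k + g2 k)) summable_on UNIV"
    by (rule Infinite_Sum.abs_summable_on_comparison_test'[OF summable_on_add[OF abs]]) (rule norm_triangle_ineq)
  hence "(\<lambda>k. norm ((-1) powi k * (1 + z * p powi k) * z powi (3 * k) * p powi quint_exp k)) summable_on UNIV"
    by (simp only: h)
  from quintuple_product[OF p z pz this]
  have "((\<lambda>k. g1 k + g2 k) has_sum (qpoch_inf p p * qpoch_inf (z\<^sup>2) p * qpoch_inf (p / z\<^sup>2) p / (qpoch_inf z p * qpoch_inf (p / z) p))) UNIV"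
    by (simp only: h)
  also have "qpoch_inf p p * qpoch_inf (z\<^sup>2) p * qpoch_inf (p / z\<^sup>2) p / (qpoch_inf z p * qpoch_inf (p / z) p) = quint_val e q"
  proof -
    have "p / z = q ^ (14 - e)" "p / z\<^sup>2 = q ^ (14 - 2 * e)" "z\<^sup>2 = q ^ (2 * e)"
      using q e by (simp_all add: p_def z_def power_diff power_even_eq flip: power_mult) (simp add: mult.commute)?
    thus ?thesis by (simp add: quint_val_def p_def z_def)
  qed
  finally show "((\<lambda>k. g1 k + g2 k) has_sum quint_val e q) UNIV" .
qed

text \<open>At r = 3k the exponent is 4 (3k^2 + k) + 9k^2 = 21k^2 + 4k, and at r = 3k + 1 it is
  21k^2 + 10k + 1. After replacing k by -k in the first, these are the exponents of
  \<open>quintuple_14\<close> for e = 1. The same computation gives e = 3 for \<open>wC\<close> and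
  e = 5 for \<open>wB\<close>.\<close>

lemma theta_A:
  assumes q: "norm q < 1" "q \<noteq> 0"
  shows "((\<lambda>r. wA (q ^ 4) r * q powi (r\<^sup>2)) has_sum quint_val 1 q) UNIV"
proof (rule has_sum_two_ranges[where ha = "\<lambda>k. 3 * (- k)" and hb = "\<lambda>k. 3 * k + 1"])
  have Q: "(q ^ 4) powi m = q powi (4 * m)" for m by (simp add: power_int_mult)
  have 1: "wA (q ^ 4) (3 * (- k)) * q powi ((3 * (- k))\<^sup>2) = (-1) powi k * q powi (21 * k\<^sup>2 - 7 * k + 3 * int 1 * k)" for k
    unfolding wA_simps Q mult.assoc using q
    by (simp only: power_int_add [OF disjI1, symmetric] not_False_eq_True minus_one_powi_minus)
       (simp add: power2_eq_square algebra_simps)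
  have 2: "wA (q ^ 4) (3 * k + 1) * q powi ((3 * k + 1)\<^sup>2) = (-1) powi k * q powi (21 * k\<^sup>2 + 7 * k + 3 * int 1 * k + int 1)" for k
    unfolding wA_simps Q mult.assoc using q
    by (simp only: power_int_add [OF disjI1, symmetric] not_False_eq_True)
       (simp add: power2_eq_square algebra_simps)
  show "(\<lambda>k. wA (q ^ 4) (3 * (- k)) * q powi ((3 * (- k))\<^sup>2)) summable_on UNIV"
       "(\<lambda>k. wA (q ^ 4) (3 * k + 1) * q powi ((3 * k + 1)\<^sup>2)) summable_on UNIV"
       "((\<lambda>k. wA (q ^ 4) (3 * (- k)) * q powi ((3 * (- k))\<^sup>2) + wA (q ^ 4) (3 * k + 1) * q powi ((3 * k + 1)\<^sup>2)) has_sum quint_val 1 q) UNIV"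
    unfolding 1 2 using quintuple_14[OF q, of 1] by simp_all
  fix r :: int assume "r \<notin> range (\<lambda>k. 3 * (- k))" "r \<notin> range (\<lambda>k. 3 * k + 1)"
  thus "wA (q ^ 4) r * q powi (r\<^sup>2) = 0"
  proof (cases r rule: mod3_cases)
    case (1 k)
    hence "r = 3 * (- (- k))" by simp
    hence "r \<in> range (\<lambda>k. 3 * (- k))" by blast
    thus ?thesis using \<open>r \<notin> range (\<lambda>k. 3 * (- k))\<close> by blast
  qed (auto simp: wA_simps)
qed (auto simp: inj_on_def, presburger)

lemma theta_C:
  assumes q: "norm q < 1" "q \<noteq> 0"
  shows "((\<lambda>r. wC (q ^ 2) r * q powi (r\<^sup>2)) has_sum quint_val 3 q) UNIV"
proof (rule has_sum_two_ranges[where ha = "\<lambda>k. 3 * (- k)" and hb = "\<lambda>k. 3 * k + 1"])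
  have Q: "(q ^ 2) powi m = q powi (2 * m)" for m by (simp add: power_int_mult)
  have 1: "wC (q ^ 2) (3 * (- k)) * q powi ((3 * (- k))\<^sup>2) = (-1) powi k * q powi (21 * k\<^sup>2 - 7 * k + 3 * int 3 * k)" for k
    unfolding wC_simps Q mult.assoc using q
    by (simp only: power_int_add [OF disjI1, symmetric] not_False_eq_True minus_one_powi_minus)
       (simp add: power2_eq_square algebra_simps)
  have 2: "wC (q ^ 2) (3 * k + 1) * q powi ((3 * k + 1)\<^sup>2) = (-1) powi k * q powi (21 * k\<^sup>2 + 7 * k + 3 * int 3 * k + int 3)" for k
    unfolding wC_simps Q mult.assoc using q
    by (simp only: power_int_add [OF disjI1, symmetric] not_False_eq_True)
       (simp add: power2_eq_square algebra_simps)
  show "(\<lambda>k. wC (q ^ 2) (3 * (- k)) * q powi ((3 * (- k))\<^sup>2)) summable_on UNIV"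
       "(\<lambda>k. wC (q ^ 2) (3 * k + 1) * q powi ((3 * k + 1)\<^sup>2)) summable_on UNIV"
       "((\<lambda>k. wC (q ^ 2) (3 * (- k)) * q powi ((3 * (- k))\<^sup>2) + wC (q ^ 2) (3 * k + 1) * q powi ((3 * k + 1)\<^sup>2)) has_sum quint_val 3 q) UNIV"
    unfolding 1 2 using quintuple_14[OF q, of 3] by simp_all
  fix r :: int assume "r \<notin> range (\<lambda>k. 3 * (- k))" "r \<notin> range (\<lambda>k. 3 * k + 1)"
  thus "wC (q ^ 2) r * q powi (r\<^sup>2) = 0"
  proof (cases r rule: mod3_cases)
    case (1 k)
    hence "r = 3 * (- (- k))" by simp
    hence "r \<in> range (\<lambda>k. 3 * (- k))" by blast
    thus ?thesis using \<open>r \<notin> range (\<lambda>k. 3 * (- k))\<close> by blast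
  qed (auto simp: wC_simps)
qed (auto simp: inj_on_def, presburger)

lemma theta_B:
  assumes q: "norm q < 1" "q \<noteq> 0"
  shows "((\<lambda>r. wB (q ^ 4) r * q powi (r\<^sup>2)) has_sum quint_val 5 q) UNIV"
\<comment> \<open>Here the class 2 modulo 3 is parametrized by r = -3k - 1, and the minus sign of
  \<open>wB\<close> in this class cancels against the one in (-1)^(-k-1).\<close>
proof (rule has_sum_two_ranges[where ha = "\<lambda>k. 3 * k" and hb = "\<lambda>k. 3 * (- k - 1) + 2"])
  have Q: "(q ^ 4) powi m = q powi (4 * m)" for m by (simp add: power_int_mult)
  have sgn: "(-1 :: complex) powi (- k - 1) = - ((-1) powi k)" for k :: int
    using minus_one_powi_minus[of "k + 1"] minus_one_powi_add1[of k] by simp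
  have 1: "wB (q ^ 4) (3 * k) * q powi ((3 * k)\<^sup>2) = (-1) powi k * q powi (21 * k\<^sup>2 - 7 * k + 3 * int 5 * k)" for k
    unfolding wB_simps Q mult.assoc using q
    by (simp only: power_int_add [OF disjI1, symmetric] not_False_eq_True)
       (simp add: power2_eq_square algebra_simps)
  have 2: "wB (q ^ 4) (3 * (- k - 1) + 2) * q powi ((3 * (- k - 1) + 2)\<^sup>2) = (-1) powi k * q powi (21 * k\<^sup>2 + 7 * k + 3 * int 5 * k + int 5)" for k
    unfolding wB_simps Q sgn using q
    by (simp only: mult_minus_left minus_minus mult.assoc power_int_add [OF disjI1, symmetric] not_False_eq_True)
       (simp add: power2_eq_square algebra_simps)
  show "(\<lambda>k. wB (q ^ 4) (3 * k) * q powi ((3 * k)\<^sup>2)) summable_on UNIV"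
       "(\<lambda>k. wB (q ^ 4) (3 * (- k - 1) + 2) * q powi ((3 * (- k - 1) + 2)\<^sup>2)) summable_on UNIV"
       "((\<lambda>k. wB (q ^ 4) (3 * k) * q powi ((3 * k)\<^sup>2) + wB (q ^ 4) (3 * (- k - 1) + 2) * q powi ((3 * (- k - 1) + 2)\<^sup>2)) has_sum quint_val 5 q) UNIV"
    unfolding 1 2 using quintuple_14[OF q, of 5] by simp_all
  fix r :: int assume *: "r \<notin> range (\<lambda>k. 3 * k)" "r \<notin> range (\<lambda>k :: int. 3 * (- k - 1) + 2)"
  thus "wB (q ^ 4) r * q powi (r\<^sup>2) = 0"
  proof (cases r rule: mod3_cases)
    case (3 k)
    hence "r = 3 * (- (- k - 1) - 1) + 2" by simp
    hence "r \<in> range (\<lambda>k. 3 * (- k - 1) + 2)" by blast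
    thus ?thesis using * by blast
  qed (auto simp: wB_simps)
qed (auto simp: inj_on_def, presburger)

text \<open>The two double sums agree because both group, along n = i + 2j, to the series of q^(n^2)
  \<open>ncoeff\<close>: the second one by definition, the first one by
  \<open>ncoeff_alt\<close>.\<close>

lemma nahm_double_sums:
  fixes q x y s :: complex and w :: "int \<Rightarrow> complex"
  assumes q: "norm q < 1" "q \<noteq> 0" and w: "\<And>r. norm (w r) \<le> 1"
    and W: "((\<lambda>r. w r * q powi (r\<^sup>2)) has_sum W) UNIV"
    and c: "\<And>n. ncoeff (q ^ 4) x s n = (\<Sum>a\<le>n. w (int n - 2 * int a) * rqfact2 (q ^ 4) a (int n - a))"
    and xs: "x\<^sup>2 = y \<and> s = q ^ 4 * y \<or> x\<^sup>2 = q ^ 4 * y \<and> s = y"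
    and n: "norm x \<le> 1" "norm y \<le> 1" "norm s \<le> 1"
  shows "((\<lambda>(i, j). q ^ ((i + 2 * j)\<^sup>2) * ((q ^ 4) ^ (i * (i - 1) div 2) * x ^ i * y ^ j /
              (qpoch (q ^ 4) (q ^ 4) i * qpoch (q ^ 4) (q ^ 4) j))) has_sum (W / J 4 q)) UNIV" (is ?th1)
    and "((\<lambda>(i, j). q ^ ((i + 2 * j)\<^sup>2) * (x ^ i * s ^ j /
              (qpoch (q ^ 4) (q ^ 4) i * qpoch (q ^ 8) (q ^ 8) j))) has_sum (W / J 4 q)) UNIV" (is ?th2)
proof -
  define Q where "Q = q ^ 4"
  have Q: "norm Q < 1" using q by (auto simp: Q_def norm_power power_less_one_iff)
  have Q2: "norm (Q\<^sup>2) < 1" using Q by (auto simp: norm_power power_less_one_iff)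
  have q8: "q ^ 8 = Q\<^sup>2" by (simp add: Q_def flip: power_mult)
  obtain C where C: "C > 0" "\<And>n. norm (qpoch Q Q n) \<le> C" "\<And>n. norm (inverse (qpoch Q Q n)) \<le> C"
    using qpoch_bounds[OF Q Q] by blast
  obtain D where D: "D > 0" "\<And>n. norm (qpoch (Q\<^sup>2) (Q\<^sup>2) n) \<le> D" "\<And>n. norm (inverse (qpoch (Q\<^sup>2) (Q\<^sup>2) n)) \<le> D"
    using qpoch_bounds[OF Q2 Q2] by blast
  have sum: "((\<lambda>n. q ^ (n\<^sup>2) * ncoeff Q x s n) has_sum (W / J 4 q)) UNIV"
    using weighted_sum_has_sum[OF q w W] by (simp only: c Q_def J_def)
  have pow: "norm (u ^ i) \<le> 1" if "norm u \<le> 1" for u :: complex and i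
    using that unfolding norm_power by (intro power_le_one) auto
  have le1: "norm (a * b) \<le> 1" if "norm a \<le> 1" "norm b \<le> 1" for a b :: complex
    using mult_mono[OF that] by (simp add: norm_mult)
  have le2: "norm (a * (b * d)) \<le> B * E" if "norm a \<le> 1" "norm b \<le> B" "norm d \<le> E" for a b d :: complex and B E
  proof -
    have "B \<ge> 0" using that(2) norm_ge_zero order_trans by blast
    hence "norm b * norm d \<le> B * E" using that by (intro mult_mono) auto
    moreover have "norm a * (norm b * norm d) \<le> 1 * (norm b * norm d)" using that by (intro mult_right_mono) auto
    ultimately show ?thesis by (simp add: norm_mult)
  qed
  define fA where "fA = (\<lambda>(i, j). (Q ^ (i * (i - 1) div 2) * x ^ i * y ^ j) * (inverse (qpoch Q Q i) * inverse (qpoch Q Q j)))"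
  define fB where "fB = (\<lambda>(i, j). (x ^ i * s ^ j) * (inverse (qpoch Q Q i) * inverse (qpoch (Q\<^sup>2) (Q\<^sup>2) j)))"
  have A: "norm (fA (i, j)) \<le> C * C" for i j
    unfolding fA_def prod.case using n Q by (intro le2 le1 pow C(3)) auto
  have B: "norm (fB (i, j)) \<le> C * D" for i j
    unfolding fB_def prod.case using n by (intro le2 le1 pow C(3) D(3)) auto
  have "((\<lambda>(i, j). q ^ ((i + 2 * j)\<^sup>2) * fA (i, j)) has_sum (W / J 4 q)) UNIV"
  proof (rule has_sum_by_weight[where f = fA and c = "ncoeff Q x s", OF q(1) A _ sum])
    fix n show "(\<Sum>j\<le>n div 2. fA (n - 2 * j, j)) = ncoeff Q x s n"
      unfolding ncoeff_alt[OF Q xs[folded Q_def]] fA_def prod.case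
      by (simp only: divide_inverse inverse_mult_distrib)
  qed
  thus ?th1 unfolding fA_def prod.case Q_def by (simp only: divide_inverse inverse_mult_distrib)
  have "((\<lambda>(i, j). q ^ ((i + 2 * j)\<^sup>2) * fB (i, j)) has_sum (W / J 4 q)) UNIV"
  proof (rule has_sum_by_weight[where f = fB and c = "ncoeff Q x s", OF q(1) B _ sum])
    fix n show "(\<Sum>j\<le>n div 2. fB (n - 2 * j, j)) = ncoeff Q x s n"
      unfolding ncoeff_def fB_def prod.case
      by (simp only: divide_inverse inverse_mult_distrib)
  qed
  thus ?th2 unfolding fB_def prod.case q8 Q_def by (simp only: divide_inverse inverse_mult_distrib)
qed

lemma qpoch_inf_power_nonzero:
  assumes "norm q < 1" "a > 0" "m > 0"
  shows "qpoch_inf (q ^ a) (q ^ m) \<noteq> 0"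
  using assms by (intro qpoch_inf_nonzero') (auto simp: norm_power power_less_one_iff)

lemma qpoch_inf_14:
  assumes "norm q < 1"
  shows "qpoch_inf (q ^ a) (q ^ 14) = qpoch_inf (q ^ a) (q ^ 28) * qpoch_inf (q ^ (a + 14)) (q ^ 28)"
proof -
  have "norm (q ^ 14) < 1" using assms by (simp add: norm_power power_less_one_iff)
  have two: "{..<2 :: nat} = {0, 1}" by auto
  from qpoch_inf_multisect[OF \<open>norm (q ^ 14) < 1\<close>, of 2 "q ^ a"] show ?thesis
    by (simp add: two flip: power_mult power_add)
qed

lemma J4_split:
  assumes "norm q < 1"
  shows "J 4 q = qpoch_inf (q ^ 4) (q ^ 28) * qpoch_inf (q ^ 8) (q ^ 28) * qpoch_inf (q ^ 12) (q ^ 28) *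
    qpoch_inf (q ^ 16) (q ^ 28) * qpoch_inf (q ^ 20) (q ^ 28) * qpoch_inf (q ^ 24) (q ^ 28) * qpoch_inf (q ^ 28) (q ^ 28)"
proof -
  have "norm (q ^ 4) < 1" using assms by (simp add: norm_power power_less_one_iff)
  have seven: "{..<7 :: nat} = {0, 1, 2, 3, 4, 5, 6}" by auto
  from qpoch_inf_multisect[OF \<open>norm (q ^ 4) < 1\<close>, of 7 "q ^ 4"] show ?thesis
    by (simp add: J_def seven mult.assoc flip: power_mult power_add)
qed

text \<open>Once (q^a; q^14) is split into two products and J_4 into seven products with base q^28,
  only a cancellation of non-zero factors remains.\<close>

lemma quint_val_div_J4:
  assumes q: "norm q < 1"
  shows "quint_val 1 q / J 4 q = J 14 q * J 28 q ^ 2 * J2 2 28 q / (J2 1 28 q * J2 4 28 q * J2 8 28 q * J2 13 28 q)"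
    and "quint_val 3 q / J 4 q = J 14 q * J 28 q ^ 2 * J2 6 28 q / (J2 3 28 q * J2 4 28 q * J2 11 28 q * J2 12 28 q)"
    and "quint_val 5 q / J 4 q = J 14 q * J 28 q ^ 2 * J2 10 28 q / (J2 5 28 q * J2 8 28 q * J2 9 28 q * J2 12 28 q)"
proof -
  define P where "P a = qpoch_inf (q ^ a) (q ^ 28)" for a
  have nz: "P a \<noteq> 0" if "a > 0" for a
    unfolding P_def by (rule qpoch_inf_power_nonzero[OF q that]) simp
  have s: "qpoch_inf (q ^ a) (q ^ 14) = P a * P (a + 14)" for a
    unfolding P_def by (rule qpoch_inf_14[OF q])
  have J14: "J 14 q = P 14 * P 28" using s[of 14] by (simp add: J_def)
  have J28: "J 28 q = P 28" by (simp add: J_def P_def)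
  have J4: "J 4 q = P 4 * P 8 * P 12 * P 16 * P 20 * P 24 * P 28"
    unfolding J4_split[OF q] P_def ..
  have J2: "J2 a 28 q = P a * P (28 - a) * P 28" for a by (simp add: J2_def P_def)
  note nzs = nz[of 1] nz[of 2] nz[of 3] nz[of 4] nz[of 5] nz[of 6] nz[of 7] nz[of 8] nz[of 9] nz[of 10]
    nz[of 11] nz[of 12] nz[of 13] nz[of 15] nz[of 16] nz[of 17] nz[of 18] nz[of 19] nz[of 20] nz[of 21] nz[of 22]
    nz[of 23] nz[of 24] nz[of 25] nz[of 26] nz[of 27] nz[of 28]
  have qv: "quint_val e q = J 14 q * (P (2 * e) * P (2 * e + 14)) * (P (14 - 2 * e) * P (14 - 2 * e + 14)) /
      (P e * P (e + 14) * (P (14 - e) * P (14 - e + 14)))" for e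
    using s[of 14] by (simp add: quint_val_def J_def s)
  show "quint_val 1 q / J 4 q = J 14 q * J 28 q ^ 2 * J2 2 28 q / (J2 1 28 q * J2 4 28 q * J2 8 28 q * J2 13 28 q)"
    unfolding qv J2 J28 J4 J14 using nzs nz[of 14] by (simp add: divide_simps power2_eq_square)
  show "quint_val 3 q / J 4 q = J 14 q * J 28 q ^ 2 * J2 6 28 q / (J2 3 28 q * J2 4 28 q * J2 11 28 q * J2 12 28 q)"
    unfolding qv J2 J28 J4 J14 using nzs nz[of 14] by (simp add: divide_simps power2_eq_square)
  show "quint_val 5 q / J 4 q = J 14 q * J 28 q ^ 2 * J2 10 28 q / (J2 5 28 q * J2 8 28 q * J2 9 28 q * J2 12 28 q)"
    unfolding qv J2 J28 J4 J14 using nzs nz[of 14] by (simp add: divide_simps power2_eq_square)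
qed

definition mod28_identities :: "complex \<Rightarrow> bool" where
  "mod28_identities q \<longleftrightarrow>
      ((\<lambda>(i::nat, j::nat). q powi (3 * int i ^ 2 + 4 * int j ^ 2 + 4 * int i * int j - 2 * int i) /
          (qpoch (q ^ 4) (q ^ 4) i * qpoch (q ^ 4) (q ^ 4) j)) has_sum
        (J 14 q * J 28 q ^ 2 * J2 2 28 q / (J2 1 28 q * J2 4 28 q * J2 8 28 q * J2 13 28 q))) UNIV \<and>
      ((\<lambda>(i::nat, j::nat). q ^ (i ^ 2 + 4 * i * j + 4 * j ^ 2 + 4 * j) /
          (qpoch (q ^ 4) (q ^ 4) i * qpoch (q ^ 8) (q ^ 8) j)) has_sum
        (J 14 q * J 28 q ^ 2 * J2 2 28 q / (J2 1 28 q * J2 4 28 q * J2 8 28 q * J2 13 28 q))) UNIV \<and>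
      ((\<lambda>(i::nat, j::nat). q ^ (3 * i ^ 2 + 4 * j ^ 2 + 4 * i * j) /
          (qpoch (q ^ 4) (q ^ 4) i * qpoch (q ^ 4) (q ^ 4) j)) has_sum
        (J 14 q * J 28 q ^ 2 * J2 6 28 q / (J2 3 28 q * J2 4 28 q * J2 11 28 q * J2 12 28 q))) UNIV \<and>
      ((\<lambda>(i::nat, j::nat). q ^ (i ^ 2 + 4 * i * j + 4 * j ^ 2 + 2 * i) /
          (qpoch (q ^ 4) (q ^ 4) i * qpoch (q ^ 8) (q ^ 8) j)) has_sum
        (J 14 q * J 28 q ^ 2 * J2 6 28 q / (J2 3 28 q * J2 4 28 q * J2 11 28 q * J2 12 28 q))) UNIV \<and>
      ((\<lambda>(i::nat, j::nat). q ^ (3 * i ^ 2 + 4 * j ^ 2 + 4 * i * j + 2 * i + 4 * j) /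
          (qpoch (q ^ 4) (q ^ 4) i * qpoch (q ^ 4) (q ^ 4) j)) has_sum
        (J 14 q * J 28 q ^ 2 * J2 10 28 q / (J2 5 28 q * J2 8 28 q * J2 9 28 q * J2 12 28 q))) UNIV \<and>
      ((\<lambda>(i::nat, j::nat). q ^ (i ^ 2 + 4 * i * j + 4 * j ^ 2 + 4 * i + 4 * j) /
          (qpoch (q ^ 4) (q ^ 4) i * qpoch (q ^ 8) (q ^ 8) j)) has_sum
        (J 14 q * J 28 q ^ 2 * J2 10 28 q / (J2 5 28 q * J2 8 28 q * J2 9 28 q * J2 12 28 q))) UNIV"

lemma triangular_exp: "2 * (i * (i - 1) div 2) + i = i * i" for i :: nat
proof -
  have "even (i * (i - 1))" by (cases i) auto
  hence "2 * (i * (i - 1) div 2) = i * (i - 1)" by simp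
  thus ?thesis by (cases i) auto
qed

lemma mod28_identities_nonzero:
  assumes q: "norm q < 1" "q \<noteq> 0"
  shows "mod28_identities q"
proof -
  have q4: "norm (q ^ 4) < 1" "q ^ 4 \<noteq> 0" and q2: "norm (q\<^sup>2) < 1" "q\<^sup>2 \<noteq> 0" and q42: "q ^ 4 = (q\<^sup>2)\<^sup>2"
    using q by (auto simp: norm_power power_less_one_iff simp flip: power_mult)
  note wA = norm_wA[OF q4(1)] and wB = norm_wB[OF q4(1)] and wC = norm_wC[OF q2(1)]
  \<comment> \<open>With Q = q^4, the parameters (x, s, y) are (1, Q, 1) for A, (Q, Q, Q) for B and
    (q^2, 1, 1) for C.\<close>
  note A = nahm_double_sums[OF q wA theta_A[OF q] ncoeff_A[OF q4], of 1]
  note B = nahm_double_sums[OF q wB theta_B[OF q] ncoeff_B[OF q4], of "q ^ 4"]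
  note C = nahm_double_sums[OF q wC theta_C[OF q] ncoeff_C[OF q2 q42], of 1]
  note tri = triangular_exp
  have e1: "q ^ ((i + 2 * j)\<^sup>2) * ((q ^ 4) ^ (i * (i - 1) div 2) * 1 ^ i * 1 ^ j / D) =
     q powi (3 * int i ^ 2 + 4 * int j ^ 2 + 4 * int i * int j - 2 * int i) / D" for i j D
  proof -
    have "int ((i + 2 * j)\<^sup>2 + 4 * (i * (i - 1) div 2)) = 3 * int i ^ 2 + 4 * int j ^ 2 + 4 * int i * int j - 2 * int i"
    proof -
      define T where "T = i * (i - 1) div 2"
      have "2 * int T + int i = int i * int i"
        using arg_cong[OF tri[of i], of int] unfolding T_def [symmetric]
        by (simp only: of_nat_add of_nat_mult of_nat_numeral)
      thus ?thesis unfolding T_def [symmetric] by (simp add: power2_eq_square algebra_simps)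
    qed
    hence "q ^ ((i + 2 * j)\<^sup>2 + 4 * (i * (i - 1) div 2)) = q powi (3 * int i ^ 2 + 4 * int j ^ 2 + 4 * int i * int j - 2 * int i)"
      by (metis power_int_of_nat)
    thus ?thesis by (simp add: power_add power_mult)
  qed
  have e2: "q ^ ((i + 2 * j)\<^sup>2) * (1 ^ i * (q ^ 4) ^ j / D) = q ^ (i ^ 2 + 4 * i * j + 4 * j ^ 2 + 4 * j) / D" for i j D
  proof -
    have "(i + 2 * j)\<^sup>2 + 4 * j = i ^ 2 + 4 * i * j + 4 * j ^ 2 + 4 * j" by (simp add: power2_eq_square algebra_simps)
    moreover have "q ^ ((i + 2 * j)\<^sup>2) * (q ^ 4) ^ j = q ^ ((i + 2 * j)\<^sup>2 + 4 * j)"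
      by (simp only: power_add power_mult)
    ultimately have "q ^ ((i + 2 * j)\<^sup>2) * (q ^ 4) ^ j = q ^ (i ^ 2 + 4 * i * j + 4 * j ^ 2 + 4 * j)"
      by (simp only:)
    thus ?thesis by simp
  qed
  have e3: "q ^ ((i + 2 * j)\<^sup>2) * ((q ^ 4) ^ (i * (i - 1) div 2) * (q\<^sup>2) ^ i * 1 ^ j / D) =
     q ^ (3 * i ^ 2 + 4 * j ^ 2 + 4 * i * j) / D" for i j D
  proof -
    define T where "T = i * (i - 1) div 2"
    have T: "2 * T + i = i * i" using tri[of i] unfolding T_def .
    have sq: "(i + 2 * j)\<^sup>2 = i * i + 4 * (i * j) + 4 * (j * j)"
      by (simp add: power2_eq_square algebra_simps)
    have "(i + 2 * j)\<^sup>2 + 4 * T + 2 * i = 3 * i ^ 2 + 4 * j ^ 2 + 4 * i * j"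
      using T sq unfolding power2_eq_square[of i] power2_eq_square[of j] mult.assoc by linarith
    moreover have "q ^ ((i + 2 * j)\<^sup>2) * (q ^ 4) ^ T * (q\<^sup>2) ^ i = q ^ ((i + 2 * j)\<^sup>2 + 4 * T + 2 * i)"
      by (simp only: power_add power_mult)
    ultimately have "q ^ ((i + 2 * j)\<^sup>2) * (q ^ 4) ^ T * (q\<^sup>2) ^ i = q ^ (3 * i ^ 2 + 4 * j ^ 2 + 4 * i * j)"
      by (simp only:)
    thus ?thesis unfolding T_def [symmetric] by (simp add: mult_ac)
  qed
  have e4: "q ^ ((i + 2 * j)\<^sup>2) * ((q\<^sup>2) ^ i * 1 ^ j / D) = q ^ (i ^ 2 + 4 * i * j + 4 * j ^ 2 + 2 * i) / D" for i j D
  proof -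
    have "(i + 2 * j)\<^sup>2 + 2 * i = i ^ 2 + 4 * i * j + 4 * j ^ 2 + 2 * i" by (simp add: power2_eq_square algebra_simps)
    moreover have "q ^ ((i + 2 * j)\<^sup>2) * (q\<^sup>2) ^ i = q ^ ((i + 2 * j)\<^sup>2 + 2 * i)"
      by (simp only: power_add power_mult)
    ultimately have "q ^ ((i + 2 * j)\<^sup>2) * (q\<^sup>2) ^ i = q ^ (i ^ 2 + 4 * i * j + 4 * j ^ 2 + 2 * i)"
      by (simp only:)
    thus ?thesis by simp
  qed
  have e5: "q ^ ((i + 2 * j)\<^sup>2) * ((q ^ 4) ^ (i * (i - 1) div 2) * (q ^ 4) ^ i * (q ^ 4) ^ j / D) =
     q ^ (3 * i ^ 2 + 4 * j ^ 2 + 4 * i * j + 2 * i + 4 * j) / D" for i j D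
  proof -
    define T where "T = i * (i - 1) div 2"
    have T: "2 * T + i = i * i" using tri[of i] unfolding T_def .
    have sq: "(i + 2 * j)\<^sup>2 = i * i + 4 * (i * j) + 4 * (j * j)"
      by (simp add: power2_eq_square algebra_simps)
    have "(i + 2 * j)\<^sup>2 + 4 * T + 4 * i + 4 * j = 3 * i ^ 2 + 4 * j ^ 2 + 4 * i * j + 2 * i + 4 * j"
      using T sq unfolding power2_eq_square[of i] power2_eq_square[of j] mult.assoc by linarith
    moreover have "q ^ ((i + 2 * j)\<^sup>2) * (q ^ 4) ^ T * (q ^ 4) ^ i * (q ^ 4) ^ j = q ^ ((i + 2 * j)\<^sup>2 + 4 * T + 4 * i + 4 * j)"
      by (simp only: power_add power_mult)
    ultimately have "q ^ ((i + 2 * j)\<^sup>2) * (q ^ 4) ^ T * (q ^ 4) ^ i * (q ^ 4) ^ j = q ^ (3 * i ^ 2 + 4 * j ^ 2 + 4 * i * j + 2 * i + 4 * j)"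
      by (simp only:)
    thus ?thesis unfolding T_def [symmetric] by (simp add: mult_ac)
  qed
  have e6: "q ^ ((i + 2 * j)\<^sup>2) * ((q ^ 4) ^ i * (q ^ 4) ^ j / D) = q ^ (i ^ 2 + 4 * i * j + 4 * j ^ 2 + 4 * i + 4 * j) / D" for i j D
  proof -
    have "(i + 2 * j)\<^sup>2 + 4 * i + 4 * j = i ^ 2 + 4 * i * j + 4 * j ^ 2 + 4 * i + 4 * j" by (simp add: power2_eq_square algebra_simps)
    moreover have "q ^ ((i + 2 * j)\<^sup>2) * (q ^ 4) ^ i * (q ^ 4) ^ j = q ^ ((i + 2 * j)\<^sup>2 + 4 * i + 4 * j)"
      by (simp only: power_add power_mult)
    ultimately have "q ^ ((i + 2 * j)\<^sup>2) * (q ^ 4) ^ i * (q ^ 4) ^ j = q ^ (i ^ 2 + 4 * i * j + 4 * j ^ 2 + 4 * i + 4 * j)"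
      by (simp only:)
    thus ?thesis by (simp add: mult_ac)
  qed
  have n: "norm (1 :: complex) \<le> 1" "norm (q ^ 4) \<le> 1" "norm (q\<^sup>2) \<le> 1" using q4 q2 by auto
  have hA: "(1::complex)\<^sup>2 = 1 \<and> q ^ 4 = q ^ 4 * 1 \<or> (1::complex)\<^sup>2 = q ^ 4 * 1 \<and> q ^ 4 = 1" by simp
  have hB: "(q ^ 4)\<^sup>2 = q ^ 4 \<and> q ^ 4 = q ^ 4 * q ^ 4 \<or> (q ^ 4)\<^sup>2 = q ^ 4 * q ^ 4 \<and> q ^ 4 = q ^ 4"
    by (simp add: power2_eq_square)
  have hC: "(q\<^sup>2)\<^sup>2 = 1 \<and> 1 = q ^ 4 * 1 \<or> (q\<^sup>2)\<^sup>2 = q ^ 4 * 1 \<and> (1::complex) = 1" unfolding q42 [symmetric] by simp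
  note s1 = A[OF hA n(1,1,2), unfolded e1 e2 quint_val_div_J4[OF q(1)]]
  note s2 = C[OF hC n(3,1,1), unfolded e3 e4 quint_val_div_J4[OF q(1)]]
  note s3 = B[OF hB n(2,2,2), unfolded e5 e6 quint_val_div_J4[OF q(1)]]
  show ?thesis unfolding mod28_identities_def by (intro conjI s1 s2 s3)
qed

text \<open>The general argument uses integer powers of q and needs q \<noteq> 0. At q = 0 only the
  pair (0, 0) contributes, since all exponents vanish there and nowhere else; this includes the one
  with the negative term -2i.\<close>

lemma mod28_identities_zero: "mod28_identities 0"
proof -
  have p: "qpoch 0 0 n = 1" for n by (simp add: qpoch_def)
  have pinf: "qpoch_inf 0 0 = 1" by (simp add: qpoch_inf_def)
  have single: "(f has_sum 1) UNIV" if f1: "f (0, 0) = 1" and f0: "\<And>i j. (i, j) \<noteq> (0, 0) \<Longrightarrow> f (i, j) = 0"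
    for f :: "nat \<times> nat \<Rightarrow> complex"
  proof -
    have "(f has_sum (sum f {(0, 0)})) {(0, 0)}" by (rule has_sum_finite) simp
    hence "(f has_sum 1) {(0, 0)}" using f1 by simp
    moreover have "f x = 0" if "x \<noteq> (0, 0)" for x
      using that f0[of "fst x" "snd x"] by simp
    ultimately show ?thesis by (subst has_sum_cong_neutral[where T = "{(0, 0)}" and g = f]) auto
  qed
  have e: "3 * (int i)\<^sup>2 + 4 * (int j)\<^sup>2 + 4 * int i * int j \<noteq> 2 * int i" if "i \<noteq> 0 \<or> j \<noteq> 0" for i j
  proof -
    have "(int i)\<^sup>2 \<ge> int i" "(int j)\<^sup>2 \<ge> int j" by (simp_all add: power2_eq_square flip: of_nat_mult)
    moreover have "int i * int j \<ge> 0" by simp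
    moreover have "4 * int i * int j = 4 * (int i * int j)" by simp
    moreover have "int i > 0 \<or> int j > 0" using that by auto
    ultimately show ?thesis by linarith
  qed
  have e': "3 * (int i)\<^sup>2 + 4 * (int j)\<^sup>2 + 4 * int i * int j = 2 * int i \<longleftrightarrow> i = 0 \<and> j = 0" for i j
    using e[of i j] by (cases "i = 0"; cases "j = 0") auto
  show ?thesis unfolding mod28_identities_def
    by (auto simp: p pinf J_def J2_def zero_power power_0_left power_int_0_left_if e' split: if_splits intro!: single)
qed

lemma mod28_identities: "norm q < 1 \<Longrightarrow> mod28_identities q"
  using mod28_identities_zero mod28_identities_nonzero by (cases "q = 0") auto

section \<open>Klein forms\<close>

text \<open>On a closed disc |f| and |g| attain their maxima, and that of |g| is less than 1. A
  geometric series then majorizes the factors minus 1, so the partial products converge locally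
  uniformly.\<close>

lemma holomorphic_on_qpoch_inf [holomorphic_intros]:
  fixes f g :: "complex \<Rightarrow> complex"
  assumes f: "f holomorphic_on A" and g: "g holomorphic_on A" and A: "open A"
    and lt: "\<And>w. w \<in> A \<Longrightarrow> norm (g w) < 1"
  shows "(\<lambda>w. qpoch_inf (f w) (g w)) holomorphic_on A"
proof (rule holomorphic_uniform_sequence[OF A])
  show "(\<lambda>w. qpoch (f w) (g w) n) holomorphic_on A" for n
    unfolding qpoch_def by (intro holomorphic_intros f g)
  fix x assume "x \<in> A"
  then obtain d where d: "d > 0" "cball x d \<subseteq> A" using A open_contains_cball by blast
  have contf: "continuous_on (cball x d) f" and contg: "continuous_on (cball x d) g"
    using f g d(2) by (meson holomorphic_on_imp_continuous_on continuous_on_subset)+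
  have ne: "cball x d \<noteq> {}" using d by auto
  obtain w0 where w0: "w0 \<in> cball x d" "\<And>w. w \<in> cball x d \<Longrightarrow> norm (g w) \<le> norm (g w0)"
    using continuous_attains_sup[OF compact_cball ne continuous_on_norm[OF contg]] by blast
  obtain w1 where w1: "w1 \<in> cball x d" "\<And>w. w \<in> cball x d \<Longrightarrow> norm (f w) \<le> norm (f w1)"
    using continuous_attains_sup[OF compact_cball ne continuous_on_norm[OF contf]] by blast
  have lt0: "norm (g w0) < 1" using lt w0 d by blast
  have "uniformly_convergent_on (cball x d) (\<lambda>N w. \<Prod>n<N. 1 - f w * g w ^ n)"
  proof (rule uniformly_convergent_on_prod'[OF _ compact_cball])
    show "continuous_on (cball x d) (\<lambda>w. 1 - f w * g w ^ n)" for n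
      by (intro continuous_intros contf contg)
    show "uniformly_convergent_on (cball x d) (\<lambda>N w. \<Sum>n<N. norm (1 - f w * g w ^ n - 1))"
    proof (rule Weierstrass_m_test')
      show "norm (norm (1 - f w * g w ^ n - 1)) \<le> norm (f w1) * norm (g w0) ^ n" if "w \<in> cball x d" for n w
        using that w0 w1 by (auto simp: norm_mult norm_power intro!: mult_mono power_mono)
      show "summable (\<lambda>n. norm (f w1) * norm (g w0) ^ n)"
        using lt0 by (intro summable_mult summable_geometric) auto
    qed
  qed
  then obtain l where l: "uniform_limit (cball x d) (\<lambda>N w. qpoch (f w) (g w) N) l sequentially"
    by (auto simp: uniformly_convergent_on_def qpoch_def)
  have "l w = qpoch_inf (f w) (g w)" if "w \<in> cball x d" for w
    using tendsto_uniform_limitI[OF l that] qpoch_tendsto[of "g w" "f w"] lt[of w] that d(2) LIMSEQ_unique by blast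
  hence "(\<forall>w\<in>cball x d. dist (qpoch (f w) (g w) n) (l w) < e) \<longleftrightarrow>
      (\<forall>w\<in>cball x d. dist (qpoch (f w) (g w) n) (qpoch_inf (f w) (g w)) < e)" for n e
    by (intro ball_cong) simp_all
  hence "uniform_limit (cball x d) (\<lambda>N w. qpoch (f w) (g w) N) (\<lambda>w. qpoch_inf (f w) (g w)) sequentially"
    using l unfolding uniform_limit_iff by (simp only:)
  thus "\<exists>d>0. cball x d \<subseteq> A \<and> uniform_limit (cball x d) (\<lambda>n w. qpoch (f w) (g w) n) (\<lambda>w. qpoch_inf (f w) (g w)) sequentially"
    using d by blast
qed

section \<open>The function \<open>theta1\<close>: quasi-periods, zeros and behaviour at 0\<close>

definition ee :: "complex \<Rightarrow> complex" where
  "ee z = exp (2 * of_real pi * \<i> * z)"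

lemma ee_0 [simp]: "ee 0 = 1"
  by (simp add: ee_def)

lemma ee_add: "ee (x + y) = ee x * ee y"
  by (simp add: ee_def distrib_left exp_add)

lemma ee_diff: "ee (x - y) = ee x / ee y"
  by (simp add: ee_def right_diff_distrib exp_diff)

lemma ee_minus: "ee (- x) = inverse (ee x)"
  by (simp add: ee_def exp_minus)

lemma ee_nonzero [simp]: "ee x \<noteq> 0"
  by (simp add: ee_def)

lemma ee_of_nat_mult: "ee (of_nat n * x) = ee x ^ n"
  by (simp add: ee_def mult_ac flip: exp_of_nat_mult)

lemma ee_numeral_mult: "ee (numeral n * x) = ee x ^ numeral n"
  using ee_of_nat_mult[of "numeral n" x] by simp

lemma ee_eq_1_iff: "ee z = 1 \<longleftrightarrow> z \<in> \<int>"
proof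
  assume "ee z = 1"
  then obtain n :: int where "Re (2 * of_real pi * \<i> * z) = 0" "Im (2 * of_real pi * \<i> * z) = of_int (2 * n) * pi"
    by (auto simp: ee_def exp_eq_1)
  hence "Im z = 0" "Re z = of_int n" by auto
  hence "z = of_int n" by (simp add: complex_eq_iff)
  thus "z \<in> \<int>" by simp
next
  assume "z \<in> \<int>"
  then obtain n where "z = of_int n" by (auto elim: Ints_cases)
  thus "ee z = 1" unfolding ee_def exp_eq_1 by (intro conjI exI[of _ n]) auto
qed

lemma ee_of_int [simp]: "ee (of_int n) = 1"
  by (simp add: ee_eq_1_iff)

lemma ee_1 [simp]: "ee 1 = 1"
  by (simp add: ee_eq_1_iff)

lemma ee_half: "ee (1 / 2) = - 1"
  by (simp add: ee_def)

lemma ee_half_odd: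
  assumes "odd k"
  shows "ee (of_int k / 2) = - 1"
proof -
  obtain m where "k = 2 * m + 1" using assms by (elim oddE)
  hence "of_int k / 2 = of_int m + (1 / 2 :: complex)" by (simp add: field_simps)
  thus ?thesis by (simp only: ee_add ee_half ee_of_int) simp
qed

lemma norm_ee: "norm (ee z) = exp (- 2 * pi * Im z)"
  by (simp add: ee_def norm_exp_eq_Re)

lemma norm_ee_less_1: "Im z > 0 \<Longrightarrow> norm (ee z) < 1"
  by (simp add: norm_ee)

lemma holomorphic_on_ee [holomorphic_intros]:
  "f holomorphic_on A \<Longrightarrow> (\<lambda>z. ee (f z)) holomorphic_on A"
  unfolding ee_def by (intro holomorphic_intros)

text \<open>Up to a constant, \<open>theta1 z \<tau>\<close> is Jacobi's \<open>\<theta>\<^sub>1\<close> divided by \<open>\<eta>(\<tau>)\<^sup>3\<close>: a Jacobi form of weight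
  \<open>-1\<close> and index \<open>1/2\<close> without multiplier.\<close>

definition theta1 :: "complex \<Rightarrow> complex \<Rightarrow> complex" where
  "theta1 z \<tau> = ee (- z / 2) * qpoch_inf (ee z) (ee \<tau>) * qpoch_inf (ee (\<tau> - z)) (ee \<tau>) / qpoch_inf (ee \<tau>) (ee \<tau>) ^ 2"

lemma theta1_0 [simp]: "Im \<tau> > 0 \<Longrightarrow> theta1 0 \<tau> = 0"
  using qpoch_inf_rec[of "ee \<tau>" 1] by (simp add: theta1_def norm_ee_less_1)

lemma theta1_add_1: "theta1 (z + 1) \<tau> = - theta1 z \<tau>"
proof -
  have "ee (- (z + 1) / 2) = - ee (- z / 2)"
  proof -
    have "- (z + 1) / 2 = - z / 2 + 1 / 2 - 1" by (simp add: field_simps)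
    thus ?thesis by (simp only: ee_diff ee_add ee_half ee_1) simp
  qed
  moreover have "ee (\<tau> - (z + 1)) = ee (\<tau> - z)" by (simp add: ee_diff ee_add)
  ultimately show ?thesis by (simp add: theta1_def ee_add)
qed

lemma theta1_add_tau:
  assumes "Im \<tau> > 0"
  shows "theta1 (z + \<tau>) \<tau> = - ee (- \<tau> / 2 - z) * theta1 z \<tau>"
proof -
  have q: "norm (ee \<tau>) < 1" using assms by (rule norm_ee_less_1)
  have 1: "qpoch_inf (ee z) (ee \<tau>) = (1 - ee z) * qpoch_inf (ee (z + \<tau>)) (ee \<tau>)"
    using qpoch_inf_rec[OF q, of "ee z"] by (simp add: ee_add)
  have 2: "qpoch_inf (ee (\<tau> - (z + \<tau>))) (ee \<tau>) = (1 - inverse (ee z)) * qpoch_inf (ee (\<tau> - z)) (ee \<tau>)"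
  proof -
    have "\<tau> - (z + \<tau>) = - z" by simp
    moreover have "ee (- z) * ee \<tau> = ee (\<tau> - z)" by (simp add: ee_minus ee_diff divide_inverse)
    ultimately show ?thesis using qpoch_inf_rec[OF q, of "ee (- z)"] by (simp add: ee_minus)
  qed
  have 3: "ee (- (z + \<tau>) / 2) * (1 - inverse (ee z)) = - ee (- \<tau> / 2 - z) * ee (- z / 2) * (1 - ee z)"
  proof -
    have "ee (- (z + \<tau>) / 2) = ee (- z / 2) * ee (- \<tau> / 2)"
      by (simp add: add_divide_distrib diff_divide_distrib flip: ee_add)
    moreover have "ee (- \<tau> / 2 - z) = ee (- \<tau> / 2) / ee z" by (simp add: ee_diff)
    moreover have "B * A * (1 - inverse Z) = - (A / Z) * B * (1 - Z)" if "Z \<noteq> 0" for A B Z :: complex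
      using that by (simp add: field_simps)
    ultimately show ?thesis by simp
  qed
  have "theta1 (z + \<tau>) \<tau> = (ee (- (z + \<tau>) / 2) * (1 - inverse (ee z))) * qpoch_inf (ee (z + \<tau>)) (ee \<tau>) *
      qpoch_inf (ee (\<tau> - z)) (ee \<tau>) / qpoch_inf (ee \<tau>) (ee \<tau>) ^ 2"
    unfolding theta1_def 2 by (simp only: mult_ac)
  also have "\<dots> = - ee (- \<tau> / 2 - z) * theta1 z \<tau>"
    unfolding 3 theta1_def 1 by (simp add: mult_ac)
  finally show ?thesis .
qed

lemma theta1_add_int: "theta1 (z + of_int n) \<tau> = ee (of_int n / 2) * theta1 z \<tau>"
proof (induction n rule: int_induct[of _ 0])
  case (step1 n)
  have "theta1 (z + of_int (n + 1)) \<tau> = - theta1 (z + of_int n) \<tau>"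
    using theta1_add_1[of "z + of_int n"] by (simp add: add_ac)
  thus ?case using step1 by (simp add: add_divide_distrib ee_add ee_half)
next
  case (step2 n)
  have "theta1 (z + of_int n) \<tau> = - theta1 (z + of_int (n - 1)) \<tau>"
    using theta1_add_1[of "z + of_int (n - 1)"] by (simp add: algebra_simps)
  thus ?case using step2 by (simp add: diff_divide_distrib ee_diff ee_half)
qed simp

lemma theta1_add_int_tau:
  assumes "Im \<tau> > 0"
  shows "theta1 (z + of_int m * \<tau>) \<tau> = ee (of_int m / 2 - (of_int m)\<^sup>2 * \<tau> / 2 - of_int m * z) * theta1 z \<tau>"
proof (induction m rule: int_induct[of _ 0])
  case (step1 m)
  have "theta1 (z + of_int (m + 1) * \<tau>) \<tau> = ee (1 / 2) * ee (- \<tau> / 2 - (z + of_int m * \<tau>)) * theta1 (z + of_int m * \<tau>) \<tau>"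
    using theta1_add_tau[OF assms, of "z + of_int m * \<tau>"] by (simp add: ee_half algebra_simps)
  also have "\<dots> = ee (1 / 2 + (- \<tau> / 2 - (z + of_int m * \<tau>)) + (of_int m / 2 - (of_int m)\<^sup>2 * \<tau> / 2 - of_int m * z)) * theta1 z \<tau>"
    unfolding step1 by (simp only: ee_add mult.assoc)
  also have "1 / 2 + (- \<tau> / 2 - (z + of_int m * \<tau>)) + (of_int m / 2 - (of_int m)\<^sup>2 * \<tau> / 2 - of_int m * z) =
     of_int (m + 1) / 2 - (of_int (m + 1))\<^sup>2 * \<tau> / 2 - of_int (m + 1) * z"
    by (simp add: power2_eq_square algebra_simps add_divide_distrib)
  finally show ?case .
next
  case (step2 m)
  define w where "w = z + of_int (m - 1) * \<tau>"
  have "theta1 (z + of_int m * \<tau>) \<tau> = ee (1 / 2) * ee (- \<tau> / 2 - w) * theta1 w \<tau>"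
    using theta1_add_tau[OF assms, of w] by (simp add: w_def ee_half algebra_simps)
  hence "theta1 (z + of_int m * \<tau>) \<tau> = ee (1 / 2 + (- \<tau> / 2 - w)) * theta1 w \<tau>"
    by (simp only: ee_add)
  hence "theta1 w \<tau> = theta1 (z + of_int m * \<tau>) \<tau> / ee (1 / 2 + (- \<tau> / 2 - w))"
    by (metis ee_nonzero nonzero_mult_div_cancel_left)
  also have "\<dots> = ee ((of_int m / 2 - (of_int m)\<^sup>2 * \<tau> / 2 - of_int m * z) - (1 / 2 + (- \<tau> / 2 - w))) * theta1 z \<tau>"
    unfolding step2 ee_diff[of "of_int m / 2 - (of_int m)\<^sup>2 * \<tau> / 2 - of_int m * z"] by simp
  also have "(of_int m / 2 - (of_int m)\<^sup>2 * \<tau> / 2 - of_int m * z) - (1 / 2 + (- \<tau> / 2 - w)) =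
     of_int (m - 1) / 2 - (of_int (m - 1))\<^sup>2 * \<tau> / 2 - of_int (m - 1) * z"
    unfolding w_def by (simp add: power2_eq_square algebra_simps diff_divide_distrib add_divide_distrib)
  finally show ?case unfolding w_def .
qed simp

lemma theta1_shift:
  assumes "Im \<tau> > 0"
  shows "theta1 (z + of_int m * \<tau> + of_int n) \<tau> =
           ee (of_int (m + n) / 2 - (of_int m)\<^sup>2 * \<tau> / 2 - of_int m * z) * theta1 z \<tau>"
proof -
  have "theta1 (z + of_int m * \<tau> + of_int n) \<tau> =
     ee (of_int n / 2 + (of_int m / 2 - (of_int m)\<^sup>2 * \<tau> / 2 - of_int m * z)) * theta1 z \<tau>"
    unfolding theta1_add_int theta1_add_int_tau[OF assms] by (simp only: ee_add mult.assoc)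
  thus ?thesis by (simp add: algebra_simps add_divide_distrib)
qed

lemma theta1_eq_0_iff:
  assumes "Im \<tau> > 0"
  shows "theta1 z \<tau> = 0 \<longleftrightarrow> (\<exists>m n. z = of_int m * \<tau> + of_int n)"
proof
  assume "\<exists>m n. z = of_int m * \<tau> + of_int n"
  then obtain m n where "z = 0 + of_int m * \<tau> + of_int n" by auto
  thus "theta1 z \<tau> = 0" using assms by (simp only: theta1_shift theta1_0) simp
next
  have q: "norm (ee \<tau>) < 1" using assms by (rule norm_ee_less_1)
  assume "theta1 z \<tau> = 0"
  moreover have "qpoch_inf (ee \<tau>) (ee \<tau>) \<noteq> 0" using q by (intro qpoch_inf_nonzero')
  ultimately have "qpoch_inf (ee z) (ee \<tau>) = 0 \<or> qpoch_inf (ee (\<tau> - z)) (ee \<tau>) = 0"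
    by (simp add: theta1_def)
  thus "\<exists>m n. z = of_int m * \<tau> + of_int n"
  proof
    assume "qpoch_inf (ee z) (ee \<tau>) = 0"
    then obtain k where "ee z * ee \<tau> ^ k = 1" using qpoch_inf_nonzero[OF q] by blast
    hence "ee (z + of_nat k * \<tau>) = 1" by (simp add: ee_add ee_of_nat_mult)
    then obtain n where "z + of_nat k * \<tau> = of_int n" unfolding ee_eq_1_iff by (elim Ints_cases)
    hence "z = of_int (- int k) * \<tau> + of_int n" by (simp add: algebra_simps)
    thus ?thesis by blast
  next
    assume "qpoch_inf (ee (\<tau> - z)) (ee \<tau>) = 0"
    then obtain k where "ee (\<tau> - z) * ee \<tau> ^ k = 1" using qpoch_inf_nonzero[OF q] by blast
    hence "ee (\<tau> - z + of_nat k * \<tau>) = 1" by (simp add: ee_add ee_of_nat_mult)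
    then obtain n where "\<tau> - z + of_nat k * \<tau> = of_int n" unfolding ee_eq_1_iff by (elim Ints_cases)
    hence "z = of_int (int k + 1) * \<tau> + of_int (- n)" by (simp add: algebra_simps)
    thus ?thesis by blast
  qed
qed

lemma holomorphic_on_theta1 [holomorphic_intros]:
  assumes "f holomorphic_on A" "g holomorphic_on A" "open A" "\<And>w. w \<in> A \<Longrightarrow> Im (g w) > 0"
  shows "(\<lambda>w. theta1 (f w) (g w)) holomorphic_on A"
proof -
  have "norm (ee (g w)) < 1" "qpoch_inf (ee (g w)) (ee (g w)) \<noteq> 0" if "w \<in> A" for w
    by (intro qpoch_inf_nonzero' norm_ee_less_1 assms(4)[OF that])+
  thus ?thesis unfolding theta1_def using assms(1-3) by (intro holomorphic_intros) auto
qed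

text \<open>The division by (q;q)^2 in \<open>theta1\<close> makes this limit independent of \<tau>.
  That fixes the constant in \<open>theta1_modular\<close> as 1 / j, with no multiplier.\<close>

lemma theta1_over_z_tendsto:
  assumes "Im \<tau> > 0"
  shows "((\<lambda>z. theta1 z \<tau> / z) \<longlongrightarrow> - (2 * of_real pi * \<i>)) (at 0)"
proof -
  have q: "norm (ee \<tau>) < 1" using assms by (rule norm_ee_less_1)
  define H where "H z = ee (- z / 2) * qpoch_inf (ee (z + \<tau>)) (ee \<tau>) * qpoch_inf (ee (\<tau> - z)) (ee \<tau>) / qpoch_inf (ee \<tau>) (ee \<tau>) ^ 2" for z
  have nz: "qpoch_inf (ee \<tau>) (ee \<tau>) \<noteq> 0" using q by (intro qpoch_inf_nonzero')
  have "H holomorphic_on UNIV" unfolding H_def using q nz by (intro holomorphic_intros) auto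
  hence "continuous_on UNIV H" by (rule holomorphic_on_imp_continuous_on)
  hence "isCont H 0" by (simp add: continuous_on_eq_continuous_at)
  moreover have "H 0 = 1" using nz by (simp add: H_def power2_eq_square)
  ultimately have H: "(H \<longlongrightarrow> 1) (at 0)" by (simp add: isCont_def)
  have "(ee has_field_derivative 2 * of_real pi * \<i>) (at 0)"
    unfolding ee_def [abs_def] by (auto intro!: derivative_eq_intros)
  hence "((\<lambda>z. (ee z - ee 0) / (z - 0)) \<longlongrightarrow> 2 * of_real pi * \<i>) (at 0)"
    by (simp add: has_field_derivative_iff)
  hence "((\<lambda>z. - ((ee z - ee 0) / (z - 0)) * H z) \<longlongrightarrow> - (2 * of_real pi * \<i>) * 1) (at 0)"
    by (intro tendsto_intros H)
  moreover have "- ((ee z - ee 0) / (z - 0)) * H z = theta1 z \<tau> / z" for z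
  proof -
    have r: "qpoch_inf (ee z) (ee \<tau>) = (1 - ee z) * qpoch_inf (ee (z + \<tau>)) (ee \<tau>)"
      using qpoch_inf_rec[OF q, of "ee z"] by (simp add: ee_add)
    have "theta1 z \<tau> = (1 - ee z) * H z" unfolding theta1_def r H_def by (simp add: mult_ac)
    thus ?thesis by (simp add: minus_divide_left)
  qed
  ultimately show ?thesis by simp
qed

section \<open>Liouville's theorem and the modular transformation of \<open>theta1\<close>\<close>

lemma periodic_int:
  fixes f :: "complex \<Rightarrow> 'a"
  assumes "\<And>z. f (z + p) = f z"
  shows "f (z + of_int n * p) = f z"
proof (induction n rule: int_induct[of _ 0])
  case (step1 n)
  have "f (z + of_int n * p + p) = f (z + of_int n * p)" by (rule assms)
  thus ?case using step1 by (simp add: algebra_simps)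
next
  case (step2 n)
  have "f (z + of_int (n - 1) * p + p) = f (z + of_int (n - 1) * p)" by (rule assms)
  thus ?case using step2 by (simp add: algebra_simps)
qed simp

lemma doubly_periodic_entire_constant:
  fixes f :: "complex \<Rightarrow> complex"
  assumes f: "f holomorphic_on UNIV" and \<tau>: "Im \<tau> > 0"
    and p1: "\<And>z. f (z + 1) = f z" and p2: "\<And>z. f (z + \<tau>) = f z"
  shows "f z = f w"
proof -
  define K where "K = (\<lambda>(s, t). of_real s + of_real t * \<tau>) ` ({0..1::real} \<times> {0..1::real})"
  have "compact K" unfolding K_def
    by (intro compact_continuous_image compact_Times compact_Icc)
       (auto simp: case_prod_unfold intro!: continuous_intros)
  moreover have "continuous_on K f"
    using f holomorphic_on_imp_continuous_on continuous_on_subset by blast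
  ultimately have "bounded (f ` K)" by (intro compact_imp_bounded compact_continuous_image)
  then obtain B where B: "\<And>z. z \<in> K \<Longrightarrow> norm (f z) \<le> B" by (auto simp: bounded_iff)
  have "norm (f z) \<le> B" for z
  proof -
    define t where "t = Im z / Im \<tau>"
    define s where "s = Re z - t * Re \<tau>"
    have z: "z = of_real s + of_real t * \<tau>"
      using \<tau> by (simp add: complex_eq_iff s_def t_def)
    have "f z = f (z + of_int (- \<lfloor>s\<rfloor>) * 1 + of_int (- \<lfloor>t\<rfloor>) * \<tau>)"
      using periodic_int[of f 1, OF p1] periodic_int[of f \<tau>, OF p2] by (simp only:)
    also have "z + of_int (- \<lfloor>s\<rfloor>) * 1 + of_int (- \<lfloor>t\<rfloor>) * \<tau> = of_real (frac s) + of_real (frac t) * \<tau>"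
      unfolding z by (simp add: frac_def algebra_simps)
    also have "norm (f \<dots>) \<le> B"
      by (intro B) (auto simp: K_def frac_lt_1 less_imp_le)
    finally show ?thesis .
  qed
  hence "bounded (range f)" by (auto simp: bounded_iff)
  hence "f constant_on UNIV" by (rule Liouville_theorem[OF f])
  thus ?thesis by (auto simp: constant_on_def)
qed

lemma Im_moebius_pos:
  fixes a b c d :: int
  assumes "Im \<tau> > 0" "a * d - b * c = 1"
  shows "of_int c * \<tau> + of_int d \<noteq> 0"
    and "Im ((of_int a * \<tau> + of_int b) / (of_int c * \<tau> + of_int d)) = Im \<tau> / (norm (of_int c * \<tau> + of_int d))\<^sup>2"
    and "Im ((of_int a * \<tau> + of_int b) / (of_int c * \<tau> + of_int d)) > 0"
proof -
  show nz: "of_int c * \<tau> + of_int d \<noteq> 0"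
  proof
    assume *: "of_int c * \<tau> + of_int d = 0"
    hence "Im (of_int c * \<tau> + of_int d) = 0" "Re (of_int c * \<tau> + of_int d) = 0" by simp_all
    hence "c = 0" using assms(1) by simp
    with \<open>Re (of_int c * \<tau> + of_int d) = 0\<close> have "d = 0" by simp
    thus False using \<open>c = 0\<close> assms(2) by simp
  qed
  have "(of_int a * \<tau> + of_int b) / (of_int c * \<tau> + of_int d) =
     (of_int a * \<tau> + of_int b) * cnj (of_int c * \<tau> + of_int d) / of_real ((norm (of_int c * \<tau> + of_int d))\<^sup>2)"
    by (rule complex_div_cnj)
  hence "Im ((of_int a * \<tau> + of_int b) / (of_int c * \<tau> + of_int d)) =
     Im ((of_int a * \<tau> + of_int b) * cnj (of_int c * \<tau> + of_int d)) / (norm (of_int c * \<tau> + of_int d))\<^sup>2"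
    by (simp only: Im_divide_of_real)
  also have "Im ((of_int a * \<tau> + of_int b) * cnj (of_int c * \<tau> + of_int d)) = of_int (a * d - b * c) * Im \<tau>"
    by (simp add: algebra_simps)
  finally show im: "Im ((of_int a * \<tau> + of_int b) / (of_int c * \<tau> + of_int d)) = Im \<tau> / (norm (of_int c * \<tau> + of_int d))\<^sup>2"
    using assms(2) by simp
  show "Im ((of_int a * \<tau> + of_int b) / (of_int c * \<tau> + of_int d)) > 0"
    unfolding im using nz assms(1) by simp
qed

text \<open>The quotient of both sides is an elliptic function for the lattice spanned by \<open>1\<close> and \<open>\<tau>\<close>,
  and its singularities are removable.\<close>

theorem theta1_modular:
  fixes a b c d :: int
  assumes \<tau>: "Im \<tau> > 0" and det: "a * d - b * c = 1"
  defines "j \<equiv> of_int c * \<tau> + of_int d"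
  defines "\<tau>' \<equiv> (of_int a * \<tau> + of_int b) / j"
  shows "theta1 (z / j) \<tau>' = ee (of_int c * z\<^sup>2 / (2 * j)) / j * theta1 z \<tau>"
proof -
  have j: "j \<noteq> 0" and \<tau>': "Im \<tau>' > 0"
    using Im_moebius_pos[OF \<tau> det] by (auto simp: j_def \<tau>'_def)
  define F where "F z = theta1 z \<tau>" for z
  \<comment> \<open>The Gaussian factor is chosen so that \<open>G\<close> has the same
    quasi-periods as \<open>F\<close>. The value of \<open>R\<close> at zeros of \<open>F\<close> is
    the limit that \<open>theta1_over_z_tendsto\<close> yields at 0.\<close>
  define G where "G z = theta1 (z / j) \<tau>' * ee (- of_int c * z\<^sup>2 / (2 * j))" for z
  define R where "R z = (if F z = 0 then 1 / j else G z / F z)" for z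
  have detc: "of_int a * of_int d - of_int b * of_int c = (1 :: complex)"
    using arg_cong[OF det, of "of_int :: int \<Rightarrow> complex"] by simp
  \<comment> \<open>The lattice spanned by 1 and \<tau>, divided by j, is the lattice spanned by 1
    and \<tau>', expressed here in the new basis.\<close>
  have one_j: "1 / j = of_int (- c) * \<tau>' + of_int a" and tau_j: "\<tau> / j = of_int d * \<tau>' + of_int (- b)"
  proof -
    have tj: "\<tau>' * j = of_int a * \<tau> + of_int b" using j by (simp add: \<tau>'_def)
    have "(of_int (- c) * \<tau>' + of_int a) * j = of_int a * j - of_int c * (\<tau>' * j)"
      by (simp add: algebra_simps)
    also note tj
    also have "of_int a * j - of_int c * (of_int a * \<tau> + of_int b) = of_int a * of_int d - of_int b * of_int c" by (simp add: j_def algebra_simps)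
    finally show "1 / j = of_int (- c) * \<tau>' + of_int a" using j detc by (simp add: divide_eq_eq)
    have "(of_int d * \<tau>' + of_int (- b)) * j = of_int d * (\<tau>' * j) - of_int b * j"
      by (simp add: algebra_simps)
    also note tj
    also have "of_int d * (of_int a * \<tau> + of_int b) - of_int b * j = (of_int a * of_int d - of_int b * of_int c) * \<tau>" by (simp add: j_def algebra_simps)
    finally show "\<tau> / j = of_int d * \<tau>' + of_int (- b)" using j detc by (simp add: divide_eq_eq)
  qed
  have F1: "F (z + 1) = - F z" for z by (simp add: F_def theta1_add_1)
  have Ft: "F (z + \<tau>) = - ee (- \<tau> / 2 - z) * F z" for z by (simp add: F_def theta1_add_tau[OF \<tau>])
  \<comment> \<open>Half of these integers appears in the exponents of \<open>G1\<close> and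
    \<open>Gt\<close> and yields the sign -1. They are odd because determinant 1 forbids a and c,
    and likewise b and d, to be both even.\<close>
  have odd1: "odd (a - c - c * a)" "odd (d - b - b * d)"
  proof -
    have "odd (a * d - b * c)" using det by simp
    thus "odd (a - c - c * a)" "odd (d - b - b * d)" by auto
  qed
  have G1: "G (z + 1) = - G z" for z
  proof -
    have "theta1 ((z + 1) / j) \<tau>' = theta1 (z / j + of_int (- c) * \<tau>' + of_int a) \<tau>'"
      unfolding add_divide_distrib one_j by (simp only: add.assoc)
    also have "\<dots> = ee (of_int (- c + a) / 2 - (of_int (- c))\<^sup>2 * \<tau>' / 2 - of_int (- c) * (z / j)) * theta1 (z / j) \<tau>'"
      by (rule theta1_shift[OF \<tau>'])
    finally have "G (z + 1) = ee (of_int (- c + a) / 2 - (of_int (- c))\<^sup>2 * \<tau>' / 2 - of_int (- c) * (z / j) +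
        (- of_int c * (z + 1)\<^sup>2 / (2 * j))) * theta1 (z / j) \<tau>'"
      unfolding G_def by (simp only: ee_add mult_ac)
    also have "of_int (- c + a) / 2 - (of_int (- c))\<^sup>2 * \<tau>' / 2 - of_int (- c) * (z / j) + (- of_int c * (z + 1)\<^sup>2 / (2 * j))
       = of_int (a - c) / 2 - of_int c / 2 * (of_int c * \<tau>' + 1 / j) + (- of_int c * z\<^sup>2 / (2 * j))"
      by (simp add: power2_eq_square add_divide_distrib diff_divide_distrib algebra_simps)
    also have "of_int c * \<tau>' + 1 / j = of_int a" unfolding one_j by simp
    also have "of_int (a - c) / 2 - of_int c / 2 * of_int a + (- of_int c * z\<^sup>2 / (2 * j)) =
       of_int (a - c - c * a) / 2 + (- of_int c * z\<^sup>2 / (2 * j))"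
      by (simp add: diff_divide_distrib)
    finally show ?thesis unfolding G_def ee_add ee_half_odd[OF odd1(1)] by simp
  qed
  have Gt: "G (z + \<tau>) = - ee (- \<tau> / 2 - z) * G z" for z
  proof -
    have "theta1 ((z + \<tau>) / j) \<tau>' = theta1 (z / j + of_int d * \<tau>' + of_int (- b)) \<tau>'"
      unfolding add_divide_distrib tau_j by (simp only: add.assoc)
    also have "\<dots> = ee (of_int (d + (- b)) / 2 - (of_int d)\<^sup>2 * \<tau>' / 2 - of_int d * (z / j)) * theta1 (z / j) \<tau>'"
      by (rule theta1_shift[OF \<tau>'])
    finally have "G (z + \<tau>) = ee (of_int (d + (- b)) / 2 - (of_int d)\<^sup>2 * \<tau>' / 2 - of_int d * (z / j) +
        (- of_int c * (z + \<tau>)\<^sup>2 / (2 * j))) * theta1 (z / j) \<tau>'"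
      unfolding G_def by (simp only: ee_add mult_ac)
    also have "of_int (d + (- b)) / 2 - (of_int d)\<^sup>2 * \<tau>' / 2 - of_int d * (z / j) + (- of_int c * (z + \<tau>)\<^sup>2 / (2 * j)) =
       of_int (d - b) / 2 - of_int d / 2 * (of_int d * \<tau>') - of_int c * \<tau> / 2 * (\<tau> / j) - z * ((of_int c * \<tau> + of_int d) / j) +
         (- of_int c * z\<^sup>2 / (2 * j))"
      by (simp add: power2_eq_square add_divide_distrib diff_divide_distrib algebra_simps)
    also have "of_int d * \<tau>' = \<tau> / j + of_int b" using tau_j by simp
    also have "of_int (d - b) / 2 - of_int d / 2 * (\<tau> / j + of_int b) - of_int c * \<tau> / 2 * (\<tau> / j) =
       of_int (d - b - b * d) / 2 - \<tau> / 2 * ((of_int c * \<tau> + of_int d) / j)"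
      by (simp add: add_divide_distrib diff_divide_distrib algebra_simps)
    also have "(of_int c * \<tau> + of_int d) / j = 1" using j by (simp add: j_def)
    also have "of_int (d - b - b * d) / 2 - \<tau> / 2 * 1 - z * 1 + (- of_int c * z\<^sup>2 / (2 * j)) =
       of_int (d - b - b * d) / 2 + ((- \<tau> / 2 - z) + (- of_int c * z\<^sup>2 / (2 * j)))" by simp
    finally show ?thesis unfolding G_def ee_add ee_half_odd[OF odd1(2)] by simp
  qed
  have R1: "R (z + 1) = R z" for z by (simp add: R_def F1 G1)
  have Rt: "R (z + \<tau>) = R z" for z by (simp add: R_def Ft Gt)
  have F_hol: "F holomorphic_on UNIV" unfolding F_def using \<tau> by (intro holomorphic_intros) auto
  have G_hol: "G holomorphic_on UNIV" unfolding G_def using \<tau>' j by (intro holomorphic_intros) auto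
  define N where "N = {z. F z \<noteq> 0}"
  have N_open: "open N"
  proof -
    have "continuous_on UNIV F" using F_hol by (rule holomorphic_on_imp_continuous_on)
    hence "open (F -` (- {0}))" by (intro open_vimage) auto
    thus ?thesis by (simp add: N_def vimage_def Compl_eq)
  qed
  have R_hol_N: "R holomorphic_on N"
  proof -
    have "(\<lambda>z. G z / F z) holomorphic_on N"
      using F_hol G_hol by (intro holomorphic_intros) (auto intro: holomorphic_on_subset simp: N_def)
    thus ?thesis by (rule holomorphic_transform) (simp add: R_def N_def)
  qed
  have limF: "((\<lambda>z. F z / z) \<longlongrightarrow> - (2 * of_real pi * \<i>)) (at 0)"
    unfolding F_def by (rule theta1_over_z_tendsto[OF \<tau>])
  have ev: "eventually (\<lambda>z. F z \<noteq> 0) (at 0)"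
    using tendsto_imp_eventually_ne[OF limF, of 0] by (auto elim!: eventually_mono)
  have lim0: "(R \<longlongrightarrow> 1 / j) (at 0)"
  proof (rule Lim_transform_eventually)
    have "filterlim (\<lambda>z. z / j) (at 0) (at 0)"
      using j by (auto simp: filterlim_at eventually_at_filter intro!: tendsto_eq_intros)
    hence "((\<lambda>z. theta1 (z / j) \<tau>' / (z / j)) \<longlongrightarrow> - (2 * of_real pi * \<i>)) (at 0)"
      by (rule filterlim_compose[OF theta1_over_z_tendsto[OF \<tau>']])
    moreover have "((\<lambda>z. ee (- of_int c * z\<^sup>2 / (2 * j))) \<longlongrightarrow> 1) (at 0)"
      unfolding ee_def using j by (auto intro!: tendsto_eq_intros)
    ultimately have "((\<lambda>z. (theta1 (z / j) \<tau>' / (z / j)) * ee (- of_int c * z\<^sup>2 / (2 * j)) / j / (F z / z)) \<longlongrightarrow>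
        - (2 * of_real pi * \<i>) * 1 / j / (- (2 * of_real pi * \<i>))) (at 0)"
      using j by (intro tendsto_intros limF) auto
    thus "((\<lambda>z. (theta1 (z / j) \<tau>' / (z / j)) * ee (- of_int c * z\<^sup>2 / (2 * j)) / j / (F z / z)) \<longlongrightarrow> 1 / j) (at 0)"
      by simp
    show "\<forall>\<^sub>F z in at 0. (theta1 (z / j) \<tau>' / (z / j)) * ee (- of_int c * z\<^sup>2 / (2 * j)) / j / (F z / z) = R z"
      using ev eventually_neq_at_within[of 0 0 UNIV]
      by eventually_elim (use j in \<open>auto simp: R_def G_def field_simps\<close>)
  qed
  have "R field_differentiable (at z)" for z
  proof (cases "F z = 0")
    case False
    thus ?thesis using R_hol_N N_open by (auto simp: N_def holomorphic_on_open field_differentiable_def)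
  next
    case True
    then obtain m n where z: "z = of_int m * \<tau> + of_int n"
      using theta1_eq_0_iff[OF \<tau>] by (auto simp: F_def)
    \<comment> \<open>Every zero of \<open>F\<close> is a lattice point, so periodicity carries the
      removable singularity at 0 over to z.\<close>
    have per: "R (w + z) = R w" for w
      using periodic_int[of R 1, OF R1] periodic_int[of R \<tau>, OF Rt]
      by (metis add.assoc mult.right_neutral z)
    have perF: "F (w + z) = 0 \<longleftrightarrow> F w = 0" for w
      using theta1_shift[OF \<tau>, of w m n] by (simp add: F_def z add.assoc)
    obtain r where r: "r > 0" "\<And>w. w \<noteq> 0 \<Longrightarrow> norm w < r \<Longrightarrow> F w \<noteq> 0"
      using ev unfolding eventually_at by (auto simp: dist_norm)
    have "R holomorphic_on ball z r"
    proof (rule no_isolated_singularity'[where K = "{z}"])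
      have "ball z r - {z} \<subseteq> N"
      proof
        fix w assume "w \<in> ball z r - {z}"
        hence "F (w - z) \<noteq> 0" by (intro r(2)) (auto simp: dist_norm norm_minus_commute)
        thus "w \<in> N" using perF[of "w - z"] by (simp add: N_def)
      qed
      thus "R holomorphic_on ball z r - {z}" by (rule holomorphic_on_subset[OF R_hol_N])
      fix w assume w: "w \<in> {z}"
      have "((\<lambda>w. R (w + z)) \<longlongrightarrow> 1 / j) (at 0)" using lim0 by (simp only: per)
      hence "(R \<longlongrightarrow> 1 / j) (at z)" by (simp add: LIM_offset_zero_iff add.commute)
      moreover have "R z = 1 / j" using True by (simp add: R_def)
      ultimately show "(R \<longlongrightarrow> R w) (at w within ball z r)"
        using w by (auto intro: tendsto_within_subset)
    qed auto
    thus ?thesis using r(1) by (auto simp: holomorphic_on_open field_differentiable_def)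
  qed
  hence "R holomorphic_on UNIV" by (auto simp: holomorphic_on_def field_differentiable_at_within)
  hence "R z = R 0" by (rule doubly_periodic_entire_constant[OF _ \<tau> R1 Rt])
  also have "R 0 = 1 / j" using \<tau> by (simp add: R_def F_def)
  finally have Rz: "R z = 1 / j" .
  \<comment> \<open>At zeros of \<open>F\<close> the value of \<open>R\<close> is a convention and
    says nothing about \<open>G\<close>; there \<open>G\<close> vanishes because z / j lies in the
    lattice of \<tau>'.\<close>
  have "G z = F z / j"
  proof (cases "F z = 0")
    case True
    then obtain m n where z: "z = of_int m * \<tau> + of_int n"
      using theta1_eq_0_iff[OF \<tau>] by (auto simp: F_def)
    have "z / j = of_int m * (\<tau> / j) + of_int n * (1 / j)" by (simp add: z add_divide_distrib)
    also have "\<dots> = of_int (m * d - n * c) * \<tau>' + of_int (n * a - m * b)"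
      unfolding one_j tau_j by (simp add: algebra_simps)
    finally have "theta1 (z / j) \<tau>' = 0" using theta1_eq_0_iff[OF \<tau>'] by blast
    thus ?thesis using True by (simp add: G_def)
  next
    case False
    thus ?thesis using Rz by (simp add: R_def field_simps)
  qed
  hence "theta1 (z / j) \<tau>' = F z / j / ee (- of_int c * z\<^sup>2 / (2 * j))"
    unfolding G_def by (metis ee_nonzero nonzero_mult_div_cancel_right)
  also have "ee (- of_int c * z\<^sup>2 / (2 * j)) = inverse (ee (of_int c * z\<^sup>2 / (2 * j)))"
  proof -
    have "- of_int c * z\<^sup>2 / (2 * j) = - (of_int c * z\<^sup>2 / (2 * j))" by simp
    thus ?thesis by (simp only: ee_minus)
  qed
  finally show ?thesis by (simp only: F_def divide_inverse inverse_inverse_eq mult_ac)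
qed

text \<open>The classical Klein form with characteristic (\<alpha>, \<beta>), up to a constant
  factor; its weight is -1.\<close>

definition klein :: "complex \<Rightarrow> complex \<Rightarrow> complex \<Rightarrow> complex" where
  "klein \<alpha> \<beta> \<tau> = ee (\<alpha> * (\<alpha> * \<tau> + \<beta>) / 2) * theta1 (\<alpha> * \<tau> + \<beta>) \<tau>"

text \<open>The exponential prefactor of \<open>klein\<close> absorbs the Gaussian factor of
  \<open>theta1_modular\<close>: with z = \<alpha>' \<tau> + \<beta>' one has \<alpha> z / j + c z^2
  / j = \<alpha>' z. The matrix acts on the row vector (\<alpha>, \<beta>) from the right.\<close>

lemma klein_modular:
  fixes a b c d :: int
  assumes \<tau>: "Im \<tau> > 0" and det: "a * d - b * c = 1"
  shows "klein \<alpha> \<beta> ((of_int a * \<tau> + of_int b) / (of_int c * \<tau> + of_int d)) =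
     klein (\<alpha> * of_int a + \<beta> * of_int c) (\<alpha> * of_int b + \<beta> * of_int d) \<tau> / (of_int c * \<tau> + of_int d)"
proof -
  define j where "j = of_int c * \<tau> + of_int d"
  define \<tau>' where "\<tau>' = (of_int a * \<tau> + of_int b) / j"
  define \<alpha>' \<beta>' where "\<alpha>' = \<alpha> * of_int a + \<beta> * of_int c" and "\<beta>' = \<alpha> * of_int b + \<beta> * of_int d"
  define z where "z = \<alpha>' * \<tau> + \<beta>'"
  have j: "j \<noteq> 0" using Im_moebius_pos(1)[OF \<tau> det] by (simp add: j_def)
  have detc: "of_int a * of_int d - of_int b * of_int c = (1 :: complex)"
    using arg_cong[OF det, of "of_int :: int \<Rightarrow> complex"] by simp
  have z: "\<alpha> * \<tau>' + \<beta> = z / j"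
    using j by (simp add: \<tau>'_def field_simps) (simp add: z_def \<alpha>'_def \<beta>'_def j_def algebra_simps)
  have "\<alpha> = \<alpha>' * of_int d - \<beta>' * of_int c"
  proof -
    have "\<alpha>' * of_int d - \<beta>' * of_int c = \<alpha> * (of_int a * of_int d - of_int b * of_int c)"
      by (simp add: \<alpha>'_def \<beta>'_def algebra_simps)
    thus ?thesis by (simp add: detc)
  qed
  hence cz: "of_int c * z + \<alpha> = \<alpha>' * j" by (simp add: z_def j_def algebra_simps)
  have "\<alpha> * (z / j) / 2 + of_int c * z\<^sup>2 / (2 * j) = z / (2 * j) * (of_int c * z + \<alpha>)"
    using j by (simp add: field_simps power2_eq_square)
  also have "\<dots> = \<alpha>' * z / 2" unfolding cz using j by simp
  finally have e: "\<alpha> * (z / j) / 2 + of_int c * z\<^sup>2 / (2 * j) = \<alpha>' * z / 2" .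
  have "klein \<alpha> \<beta> \<tau>' = ee (\<alpha> * (z / j) / 2) * theta1 (z / j) \<tau>'" by (simp only: klein_def z)
  also have "theta1 (z / j) \<tau>' = ee (of_int c * z\<^sup>2 / (2 * j)) / j * theta1 z \<tau>"
    unfolding j_def \<tau>'_def by (rule theta1_modular[OF \<tau> det])
  also have "ee (\<alpha> * (z / j) / 2) * (ee (of_int c * z\<^sup>2 / (2 * j)) / j * theta1 z \<tau>) =
      ee (\<alpha> * (z / j) / 2 + of_int c * z\<^sup>2 / (2 * j)) * theta1 z \<tau> / j"
    by (simp add: ee_add)
  also have "\<dots> = klein \<alpha>' \<beta>' \<tau> / j" unfolding e klein_def z_def [symmetric] ..
  finally show ?thesis by (simp only: \<alpha>'_def \<beta>'_def \<tau>'_def j_def)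
qed

lemma klein_shift:
  assumes "Im \<tau> > 0"
  shows "klein (\<alpha> + of_int m) (\<beta> + of_int n) \<tau> =
     ee (of_int (m + n + m * n) / 2 + (\<alpha> * of_int n - \<beta> * of_int m) / 2) * klein \<alpha> \<beta> \<tau>"
proof -
  have "(\<alpha> + of_int m) * \<tau> + (\<beta> + of_int n) = \<alpha> * \<tau> + \<beta> + of_int m * \<tau> + of_int n"
    by (simp add: algebra_simps)
  hence "klein (\<alpha> + of_int m) (\<beta> + of_int n) \<tau> =
     ee ((\<alpha> + of_int m) * (\<alpha> * \<tau> + \<beta> + of_int m * \<tau> + of_int n) / 2 +
         (of_int (m + n) / 2 - (of_int m)\<^sup>2 * \<tau> / 2 - of_int m * (\<alpha> * \<tau> + \<beta>))) * theta1 (\<alpha> * \<tau> + \<beta>) \<tau>"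
    unfolding klein_def by (simp only: theta1_shift[OF assms] ee_add mult.assoc)
  also have "(\<alpha> + of_int m) * (\<alpha> * \<tau> + \<beta> + of_int m * \<tau> + of_int n) / 2 +
         (of_int (m + n) / 2 - (of_int m)\<^sup>2 * \<tau> / 2 - of_int m * (\<alpha> * \<tau> + \<beta>)) =
     (of_int (m + n + m * n) / 2 + (\<alpha> * of_int n - \<beta> * of_int m) / 2) + \<alpha> * (\<alpha> * \<tau> + \<beta>) / 2"
    by (simp add: power2_eq_square add_divide_distrib diff_divide_distrib algebra_simps)
  finally show ?thesis unfolding klein_def by (simp only: ee_add mult_ac)
qed

text \<open>28224 is the least common multiple of 18 * 392 = 7056 and 32 * 294 = 9408. These are the
  conditions of \<open>klein_Gamma1_II\<close> for the 3-torsion point at 392 \<tau> and the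
  4-torsion point at 294 \<tau>; the other divisors required below divide it as well.\<close>

definition in_Gamma1 :: "int \<Rightarrow> int \<Rightarrow> int \<Rightarrow> int \<Rightarrow> bool" where
  "in_Gamma1 a b c d \<longleftrightarrow> a * d - b * c = 1 \<and> 28224 dvd a - 1 \<and> 28224 dvd c \<and> 28224 dvd d - 1"

lemma klein_modular_scaled:
  fixes a b c d M :: int
  assumes \<tau>: "Im \<tau> > 0" and det: "a * d - b * (M * c) = 1" and M: "M > 0"
  shows "klein \<alpha> \<beta> (of_int M * ((of_int a * \<tau> + of_int b) / (of_int (M * c) * \<tau> + of_int d))) =
     klein (\<alpha> * of_int a + \<beta> * of_int c) (\<alpha> * of_int (M * b) + \<beta> * of_int d) (of_int M * \<tau>) /
       (of_int (M * c) * \<tau> + of_int d)"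
proof -
  have 1: "Im (of_int M * \<tau>) > 0" using \<tau> M by simp
  have 2: "a * d - (M * b) * c = 1" using det by (simp add: mult_ac)
  have 3: "of_int M * ((of_int a * \<tau> + of_int b) / (of_int (M * c) * \<tau> + of_int d)) =
      (of_int a * (of_int M * \<tau>) + of_int (M * b)) / (of_int c * (of_int M * \<tau>) + of_int d)"
  proof -
    have "of_int M * (of_int a * \<tau> + of_int b) = of_int a * (of_int M * \<tau>) + of_int (M * b)"
      "of_int (M * c) * \<tau> + of_int d = of_int c * (of_int M * \<tau>) + of_int d"
      by (simp_all add: algebra_simps)
    thus ?thesis by (simp only: times_divide_eq_right)
  qed
  have 4: "of_int c * (of_int M * \<tau>) + of_int d = of_int (M * c) * \<tau> + of_int d" by simp
  show ?thesis using klein_modular[OF 1 2, of \<alpha> \<beta>] unfolding 3 4 .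
qed

text \<open>The matrix changes the characteristic by integers m and n, and the factors 2 in the
  hypotheses make both even, so the signs in \<open>klein_shift\<close> disappear. What survives is
  ee(\<alpha> n / 2), a root of unity that depends on b and has to cancel later across the whole
  quotient.\<close>

lemma klein_Gamma1_I:
  fixes a b c d r s u M :: int
  assumes \<tau>: "Im \<tau> > 0" and g: "in_Gamma1 a b c d" and M: "M > 0" "M dvd 28224"
    and s: "s > 0" "2 * s dvd 28224" and u: "r * M = 2 * s * u"
  shows "klein (of_int r / of_int s) 0 (of_int M * ((of_int a * \<tau> + of_int b) / (of_int c * \<tau> + of_int d))) =
     ee (of_int (r * u * b) / of_int s) * klein (of_int r / of_int s) 0 (of_int M * \<tau>) / (of_int c * \<tau> + of_int d)"
proof -
  have det: "a * d - b * c = 1" and dv: "28224 dvd a - 1" "28224 dvd c"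
    using g by (auto simp: in_Gamma1_def)
  obtain c' where c: "c = M * c'" using M(2) dv(2) by (meson dvd_trans dvdE)
  obtain a' where a: "a - 1 = 2 * s * a'" using s(2) dv(1) by (meson dvd_trans dvdE)
  define m n where "m = 2 * (r * a')" and "n = 2 * (u * b)"
  define \<alpha> :: complex where "\<alpha> = of_int r / of_int s"
  have s': "(of_int s :: complex) \<noteq> 0" using s by simp
  have "\<alpha> * of_int a = \<alpha> + of_int m"
  proof -
    have "a = 1 + 2 * s * a'" using a by simp
    thus ?thesis using s' by (simp add: \<alpha>_def m_def field_simps)
  qed
  moreover have "\<alpha> * of_int (M * b) = 0 + of_int n"
  proof -
    have "of_int r * of_int (M * b) = (of_int (r * M * b) :: complex)" by simp
    also have "r * M * b = s * n" unfolding u n_def by simp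
    finally show ?thesis using s' by (simp add: \<alpha>_def field_simps)
  qed
  ultimately have k: "klein (\<alpha> * of_int a + 0 * of_int c') (\<alpha> * of_int (M * b) + 0 * of_int d) (of_int M * \<tau>) =
     ee (of_int (m + n + m * n) / 2 + (\<alpha> * of_int n - 0 * of_int m) / 2) * klein \<alpha> 0 (of_int M * \<tau>)"
    using klein_shift[of "of_int M * \<tau>" \<alpha> m 0 n] \<tau> M by simp
  have "of_int (m + n + m * n) / 2 + (\<alpha> * of_int n - 0 * of_int m) / 2 =
     of_int (r * a' + u * b + 2 * (r * a') * (u * b)) + of_int (r * u * b) / (of_int s :: complex)"
    using s' by (simp add: m_def n_def \<alpha>_def field_simps)
  hence e: "ee (of_int (m + n + m * n) / 2 + (\<alpha> * of_int n - 0 * of_int m) / 2) = ee (of_int (r * u * b) / of_int s)"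
    by (simp only: ee_add ee_of_int mult_1)
  have "a * d - b * (M * c') = 1" using det c by simp
  from klein_modular_scaled[OF \<tau> this M(1), of \<alpha> 0, unfolded k e] show ?thesis
    unfolding c \<alpha>_def .
qed

text \<open>The extra factor s in the condition on c makes \<beta> m / 2 an integer, so that here no
  root of unity survives at all.\<close>

lemma klein_Gamma1_II:
  fixes a b c d s M :: int
  assumes \<tau>: "Im \<tau> > 0" and g: "in_Gamma1 a b c d" and M: "M > 0"
    and s: "s > 0" "2 * s * s * M dvd 28224"
  shows "klein 0 (1 / of_int s) (of_int M * ((of_int a * \<tau> + of_int b) / (of_int c * \<tau> + of_int d))) =
     klein 0 (1 / of_int s) (of_int M * \<tau>) / (of_int c * \<tau> + of_int d)"
proof -
  have det: "a * d - b * c = 1" and dv: "28224 dvd d - 1" "28224 dvd c"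
    using g by (auto simp: in_Gamma1_def)
  obtain c' where c: "c = M * (2 * s * s * c')"
    using s(2) dv(2) by (metis dvd_trans dvdE mult.assoc mult.commute)
  have "2 * s dvd 28224" using s(2) by (metis dvd_mult_left mult.assoc)
  then obtain d' where d: "d - 1 = 2 * s * d'" using dv(1) by (meson dvd_trans dvdE)
  define m n where "m = 2 * (s * c')" and "n = 2 * d'"
  define \<beta> :: complex where "\<beta> = 1 / of_int s"
  have s': "(of_int s :: complex) \<noteq> 0" using s by simp
  have "\<beta> * of_int d = \<beta> + of_int n"
  proof -
    have "d = 1 + 2 * s * d'" using d by simp
    thus ?thesis using s' by (simp add: \<beta>_def n_def field_simps)
  qed
  moreover have "\<beta> * of_int (2 * s * s * c') = 0 + of_int m"
    using s' by (simp add: \<beta>_def m_def field_simps)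
  ultimately have k: "klein (0 * of_int a + \<beta> * of_int (2 * s * s * c')) (0 * of_int (M * b) + \<beta> * of_int d) (of_int M * \<tau>) =
     ee (of_int (m + n + m * n) / 2 + (0 * of_int n - \<beta> * of_int m) / 2) * klein 0 \<beta> (of_int M * \<tau>)"
    using klein_shift[of "of_int M * \<tau>" 0 m \<beta> n] \<tau> M by simp
  have "of_int (m + n + m * n) / 2 + (0 * of_int n - \<beta> * of_int m) / 2 =
     (of_int (s * c' + d' + 2 * (s * c') * d' - c') :: complex)"
    using s' by (simp add: m_def n_def \<beta>_def field_simps)
  hence e: "ee (of_int (m + n + m * n) / 2 + (0 * of_int n - \<beta> * of_int m) / 2) = 1"
    by (simp only: ee_of_int)
  have "a * d - b * (M * (2 * s * s * c')) = 1" using det c by simp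
  from klein_modular_scaled[OF \<tau> this M, of 0 \<beta>, unfolded k e mult_1] show ?thesis
    unfolding c \<beta>_def .
qed

section \<open>Klein forms as infinite products\<close>

lemma qpoch_inf_square:
  assumes "norm q < 1"
  shows "qpoch_inf a q * qpoch_inf (- a) q = qpoch_inf (a\<^sup>2) (q\<^sup>2)"
proof (rule LIMSEQ_unique)
  have "(\<lambda>n. qpoch a q n * qpoch (- a) q n) \<longlonglongrightarrow> qpoch_inf a q * qpoch_inf (- a) q"
    by (intro tendsto_intros qpoch_tendsto assms)
  thus "(\<lambda>n. qpoch (a\<^sup>2) (q\<^sup>2) n) \<longlonglongrightarrow> qpoch_inf a q * qpoch_inf (- a) q"
    by (simp only: qpoch_square)
  show "(\<lambda>n. qpoch (a\<^sup>2) (q\<^sup>2) n) \<longlonglongrightarrow> qpoch_inf (a\<^sup>2) (q\<^sup>2)"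
    using assms by (intro qpoch_tendsto) (simp add: norm_power power_less_one_iff)
qed

lemma cube_root_product:
  assumes w: "w ^ 3 = (1 :: complex)" "w \<noteq> 1"
  shows "(1 - x) * (1 - w * x) * (1 - w\<^sup>2 * x) = 1 - x ^ 3"
proof -
  have "(w - 1) * (w\<^sup>2 + (w + 1)) = w ^ 3 - 1" by (simp add: algebra_simps power2_eq_square power3_eq_cube)
  hence "w\<^sup>2 + (w + 1) = 0" using w by simp
  hence "w\<^sup>2 = - (w + 1)" by (simp only: eq_neg_iff_add_eq_0)
  thus ?thesis using w(1) by algebra
qed

lemma qpoch_inf_cube:
  assumes "norm q < 1" and w: "w ^ 3 = 1" "w \<noteq> 1"
  shows "qpoch_inf a q * qpoch_inf (w * a) q * qpoch_inf (w\<^sup>2 * a) q = qpoch_inf (a ^ 3) (q ^ 3)"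
proof (rule LIMSEQ_unique)
  have "(\<lambda>n. qpoch a q n * qpoch (w * a) q n * qpoch (w\<^sup>2 * a) q n) \<longlonglongrightarrow>
      qpoch_inf a q * qpoch_inf (w * a) q * qpoch_inf (w\<^sup>2 * a) q"
    by (intro tendsto_intros qpoch_tendsto assms)
  moreover have "qpoch a q n * qpoch (w * a) q n * qpoch (w\<^sup>2 * a) q n = qpoch (a ^ 3) (q ^ 3) n" for n
    unfolding qpoch_def prod.distrib [symmetric]
  proof (intro prod.cong refl)
    fix k show "(1 - a * q ^ k) * (1 - w * a * q ^ k) * (1 - w\<^sup>2 * a * q ^ k) = 1 - a ^ 3 * (q ^ 3) ^ k"
      using cube_root_product[OF w, of "a * q ^ k"] by (simp only: power_mult_distrib mult.assoc power_commutes power_mult [symmetric] mult.commute[of 3 k])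
  qed
  ultimately show "(\<lambda>n. qpoch (a ^ 3) (q ^ 3) n) \<longlonglongrightarrow> qpoch_inf a q * qpoch_inf (w * a) q * qpoch_inf (w\<^sup>2 * a) q"
    by simp
  show "(\<lambda>n. qpoch (a ^ 3) (q ^ 3) n) \<longlonglongrightarrow> qpoch_inf (a ^ 3) (q ^ 3)"
    using assms by (intro qpoch_tendsto) (simp add: norm_power power_less_one_iff)
qed

lemma ee_third: "ee (1 / 3) ^ 3 = 1" "ee (1 / 3) \<noteq> 1"
proof -
  show "ee (1 / 3) ^ 3 = 1" using ee_of_nat_mult[of 3 "1 / 3"] by simp
  show "ee (1 / 3) \<noteq> 1"
  proof
    assume "ee (1 / 3) = 1"
    then obtain n where n: "(1 / 3 :: complex) = of_int n" unfolding ee_eq_1_iff by (elim Ints_cases)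
    hence "of_int (3 * n) = (of_int 1 :: complex)" by (simp add: field_simps)
    hence "3 * n = 1" by (simp only: of_int_eq_iff)
    thus False by presburger
  qed
qed

lemma ee_quarter: "ee (1 / 4) = \<i>"
proof -
  have "ee (1 / 4) = cis (pi / 2)"
    unfolding ee_def cis_conv_exp by (rule arg_cong[of _ _ exp]) simp
  thus ?thesis by simp
qed

lemma klein_28:
  assumes \<tau>: "Im \<tau> > 0" and a: "a \<le> 28"
  defines "q \<equiv> ee (42 * \<tau>)"
  shows "klein (of_nat a / 28) 0 (1176 * \<tau>) = ee ((3 * of_nat a ^ 2 / 4 - 21 * of_nat a) * \<tau>) * J2 a 28 q / J 28 q ^ 3"
proof -
  have q: "norm q < 1" unfolding q_def using \<tau> by (intro norm_ee_less_1) simp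
  have nz: "J 28 q \<noteq> 0" using qpoch_inf_power_nonzero[OF q, of 28 28] by (simp add: J_def)
  have z: "of_nat a / 28 * (1176 * \<tau>) + 0 = of_nat a * (42 * \<tau>)" by simp
  have e1: "ee (of_nat a * (42 * \<tau>)) = q ^ a" by (simp only: ee_of_nat_mult q_def)
  have e2: "ee (1176 * \<tau>) = q ^ 28" using ee_numeral_mult[of "num.Bit0 (num.Bit0 (num.Bit1 (num.Bit1 num.One)))" "42 * \<tau>"] by (simp add: q_def)
  have "1176 * \<tau> - of_nat a * (42 * \<tau>) = of_nat (28 - a) * (42 * \<tau>)" using a by (simp add: of_nat_diff algebra_simps)
  hence e3: "ee (1176 * \<tau> - of_nat a * (42 * \<tau>)) = q ^ (28 - a)" by (simp only: ee_of_nat_mult q_def)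
  have "klein (of_nat a / 28) 0 (1176 * \<tau>) =
     ee (of_nat a / 28 * (of_nat a * (42 * \<tau>)) / 2 + - (of_nat a * (42 * \<tau>)) / 2) *
     (qpoch_inf (q ^ a) (q ^ 28) * qpoch_inf (q ^ (28 - a)) (q ^ 28) / qpoch_inf (q ^ 28) (q ^ 28) ^ 2)"
    unfolding klein_def theta1_def z e1 e2 e3 by (simp only: ee_add mult.assoc times_divide_eq_right)
  also have "of_nat a / 28 * (of_nat a * (42 * \<tau>)) / 2 + - (of_nat a * (42 * \<tau>)) / 2 = (3 * of_nat a ^ 2 / 4 - 21 * of_nat a) * \<tau>"
    by (simp add: field_simps power2_eq_square)
  also have "qpoch_inf (q ^ a) (q ^ 28) * qpoch_inf (q ^ (28 - a)) (q ^ 28) / qpoch_inf (q ^ 28) (q ^ 28) ^ 2 = J2 a 28 q / J 28 q ^ 3"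
    using nz unfolding J2_def J_def by (simp add: field_simps power2_eq_square power3_eq_cube)
  finally show ?thesis by simp
qed

text \<open>Products of Klein forms at 3-torsion and 4-torsion points that are pure eta quotients.\<close>

definition klein3 :: "complex \<Rightarrow> complex" where
  "klein3 \<sigma> = klein (1 / 3) 0 (3 * \<sigma>) ^ 3 * klein 0 (1 / 3) \<sigma>"

definition klein4 :: "complex \<Rightarrow> complex" where
  "klein4 \<sigma> = klein (1 / 4) 0 (4 * \<sigma>) ^ 2 * klein 0 (1 / 4) \<sigma>"

text \<open>In terms of \<eta>, \<open>klein (1 / 3) 0 (3 * \<sigma>)\<close> is \<eta>(\<sigma>) /
  \<eta>(3\<sigma>)^3 and \<open>klein 0 (1 / 3) \<sigma>\<close> is \<eta>(3\<sigma>) /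
  \<eta>(\<sigma>)^3, up to constants. The cube in \<open>klein3\<close> eliminates \<eta>(\<sigma>)
  and leaves \<eta>(3\<sigma>)^-8.\<close>

lemma klein3_eq:
  assumes \<sigma>: "Im \<sigma> > 0"
  shows "klein3 \<sigma> = ee (- 1 / 6) * (1 - ee (1 / 3)) * ee (- \<sigma>) / qpoch_inf (ee \<sigma> ^ 3) (ee \<sigma> ^ 3) ^ 8"
proof -
  define q where "q = ee \<sigma>"
  define w where "w = ee (1 / 3)"
  have w: "w ^ 3 = 1" "w \<noteq> 1" using ee_third by (simp_all add: w_def)
  have q: "norm q < 1" unfolding q_def using \<sigma> by (rule norm_ee_less_1)
  have q3: "norm (q ^ 3) < 1" using q by (simp add: norm_power power_less_one_iff)
  define P where "P = qpoch_inf q q"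
  define P3 where "P3 = qpoch_inf (q ^ 3) (q ^ 3)"
  have nz: "P \<noteq> 0" "P3 \<noteq> 0" unfolding P_def P3_def by (intro qpoch_inf_nonzero' q q3)+
  have three: "{..<3 :: nat} = {0, 1, 2}" by auto
  have split: "P = qpoch_inf q (q ^ 3) * qpoch_inf (q ^ 2) (q ^ 3) * P3"
    using qpoch_inf_multisect[OF q, of 3 q] by (simp add: P_def P3_def three power2_eq_square power3_eq_cube mult.assoc)
  have e: "ee (3 * \<sigma>) = q ^ 3" "ee \<sigma> = q" "ee (3 * \<sigma> - \<sigma>) = q ^ 2"
    using ee_numeral_mult[of "num.Bit1 num.One" \<sigma>] ee_numeral_mult[of "num.Bit0 num.One" \<sigma>] by (simp_all add: q_def)
  have z: "1 / 3 * (3 * \<sigma>) + 0 = \<sigma>" by simp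
  have "klein (1 / 3) 0 (3 * \<sigma>) = ee (1 / 3 * \<sigma> / 2 + - \<sigma> / 2) * (qpoch_inf q (q ^ 3) * qpoch_inf (q ^ 2) (q ^ 3) / P3 ^ 2)"
    unfolding klein_def theta1_def z e P3_def by (simp only: ee_add mult.assoc times_divide_eq_right)
  also have "1 / 3 * \<sigma> / 2 + - \<sigma> / 2 = - \<sigma> / 3" by (simp add: field_simps)
  also have "qpoch_inf q (q ^ 3) * qpoch_inf (q ^ 2) (q ^ 3) / P3 ^ 2 = P / P3 ^ 3"
    unfolding split using nz by (simp add: field_simps power2_eq_square power3_eq_cube)
  finally have "klein (1 / 3) 0 (3 * \<sigma>) ^ 3 = ee (- \<sigma> / 3) ^ 3 * (P ^ 3 / P3 ^ 9)"
    by (simp add: power_mult_distrib power_divide flip: power_mult)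
  also have "ee (- \<sigma> / 3) ^ 3 = ee (- \<sigma>)" using ee_numeral_mult[of "num.Bit1 num.One" "- \<sigma> / 3"] by simp
  finally have A: "klein (1 / 3) 0 (3 * \<sigma>) ^ 3 = ee (- \<sigma>) * (P ^ 3 / P3 ^ 9)" .
  have "ee (\<sigma> - 1 / 3) = w\<^sup>2 * q"
  proof -
    have "w * w\<^sup>2 = 1" using w(1) by (simp add: power2_eq_square power3_eq_cube mult.assoc)
    hence inv: "inverse w = w\<^sup>2" by (rule inverse_unique)
    have "ee (\<sigma> - 1 / 3) = q / w" by (simp only: ee_diff w_def q_def)
    thus ?thesis by (simp only: divide_inverse inv mult.commute)
  qed
  hence "klein 0 (1 / 3) \<sigma> = ee (- 1 / 6) * (qpoch_inf w q * qpoch_inf (w\<^sup>2 * q) q) / P ^ 2"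
    unfolding klein_def theta1_def by (simp add: e w_def P_def)
  also have "qpoch_inf w q = (1 - w) * qpoch_inf (w * q) q" by (rule qpoch_inf_rec[OF q])
  also have "(1 - w) * qpoch_inf (w * q) q * qpoch_inf (w\<^sup>2 * q) q = (1 - w) * (P3 / P)"
    using qpoch_inf_cube[OF q w, of q] nz by (simp add: P_def P3_def field_simps)
  finally have B: "klein 0 (1 / 3) \<sigma> = ee (- 1 / 6) * (1 - w) * (P3 / P ^ 3)"
    by (simp add: power2_eq_square power3_eq_cube mult_ac)
  have "P ^ 3 / P3 ^ 9 * (P3 / P ^ 3) = 1 / P3 ^ 8"
    using nz by (simp add: field_simps eval_nat_numeral)
  moreover have "klein3 \<sigma> = ee (- 1 / 6) * (1 - w) * ee (- \<sigma>) * (P ^ 3 / P3 ^ 9 * (P3 / P ^ 3))"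
    unfolding klein3_def A B by (simp only: mult_ac)
  ultimately have "klein3 \<sigma> = ee (- 1 / 6) * (1 - w) * ee (- \<sigma>) * (1 / P3 ^ 8)" by (simp only:)
  thus ?thesis by (simp add: w_def P3_def q_def)
qed

text \<open>Up to constants the two Klein forms are \<eta>(\<sigma>) / (\<eta>(2\<sigma>)
  \<eta>(4\<sigma>)^2) and \<eta>(4\<sigma>) / (\<eta>(2\<sigma>) \<eta>(\<sigma>)^2). The square in
  \<open>klein4\<close> eliminates \<eta>(\<sigma>) and leaves (\<eta>(2\<sigma>)
  \<eta>(4\<sigma>))^-3.\<close>

lemma klein4_eq:
  assumes \<sigma>: "Im \<sigma> > 0"
  shows "klein4 \<sigma> = ee (- 1 / 8) * (1 - \<i>) * ee (- 3 * \<sigma> / 4) /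
     (qpoch_inf (ee \<sigma> ^ 2) (ee \<sigma> ^ 2) * qpoch_inf (ee \<sigma> ^ 4) (ee \<sigma> ^ 4)) ^ 3"
proof -
  define q where "q = ee \<sigma>"
  have q: "norm q < 1" unfolding q_def using \<sigma> by (rule norm_ee_less_1)
  have q2: "norm (q\<^sup>2) < 1" and q4: "norm (q ^ 4) < 1" using q by (simp_all add: norm_power power_less_one_iff)
  define P where "P = qpoch_inf q q"
  define P2 where "P2 = qpoch_inf (q\<^sup>2) (q\<^sup>2)"
  define P4 where "P4 = qpoch_inf (q ^ 4) (q ^ 4)"
  have nz: "P \<noteq> 0" "P2 \<noteq> 0" "P4 \<noteq> 0" unfolding P_def P2_def P4_def by (intro qpoch_inf_nonzero' q q2 q4)+
  have two: "{..<2 :: nat} = {0, 1}" by auto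
  have split1: "P = qpoch_inf q (q\<^sup>2) * P2"
    using qpoch_inf_multisect[OF q, of 2 q] by (simp add: P_def P2_def two power2_eq_square)
  have split2: "qpoch_inf q (q\<^sup>2) = qpoch_inf q (q ^ 4) * qpoch_inf (q ^ 3) (q ^ 4)"
  proof -
    have "q * q\<^sup>2 = q ^ 3" by (simp add: power2_eq_square power3_eq_cube)
    moreover have "(q\<^sup>2)\<^sup>2 = q ^ 4" by (simp flip: power_mult)
    ultimately show ?thesis using qpoch_inf_multisect[OF q2, of 2 q] by (simp add: two)
  qed
  have e: "ee (4 * \<sigma>) = q ^ 4" "ee \<sigma> = q" "ee (4 * \<sigma> - \<sigma>) = q ^ 3"
    using ee_numeral_mult[of "num.Bit0 (num.Bit0 num.One)" \<sigma>] ee_numeral_mult[of "num.Bit1 num.One" \<sigma>] by (simp_all add: q_def)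
  have z: "1 / 4 * (4 * \<sigma>) + 0 = \<sigma>" by simp
  have "klein (1 / 4) 0 (4 * \<sigma>) = ee (1 / 4 * \<sigma> / 2 + - \<sigma> / 2) * (qpoch_inf q (q ^ 4) * qpoch_inf (q ^ 3) (q ^ 4) / P4 ^ 2)"
    unfolding klein_def theta1_def z e P4_def by (simp only: ee_add mult.assoc times_divide_eq_right)
  also have "1 / 4 * \<sigma> / 2 + - \<sigma> / 2 = - 3 * \<sigma> / 8" by (simp add: field_simps)
  also have "qpoch_inf q (q ^ 4) * qpoch_inf (q ^ 3) (q ^ 4) = P / P2"
    using split1 split2 nz by (simp add: field_simps)
  finally have "klein (1 / 4) 0 (4 * \<sigma>) ^ 2 = ee (- 3 * \<sigma> / 8) ^ 2 * (P ^ 2 / (P2 ^ 2 * P4 ^ 4))"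
    by (simp add: power_mult_distrib power_divide flip: power_mult)
  also have "ee (- 3 * \<sigma> / 8) ^ 2 = ee (- 3 * \<sigma> / 4)" using ee_numeral_mult[of "num.Bit0 num.One" "- 3 * \<sigma> / 8"] by simp
  finally have A: "klein (1 / 4) 0 (4 * \<sigma>) ^ 2 = ee (- 3 * \<sigma> / 4) * (P ^ 2 / (P2 ^ 2 * P4 ^ 4))" .
  have "ee (\<sigma> - 1 / 4) = q / \<i>" by (simp only: ee_diff ee_quarter q_def)
  also have "\<dots> = - (\<i> * q)" by (simp add: field_simps)
  finally have "ee (\<sigma> - 1 / 4) = - (\<i> * q)" .
  hence "klein 0 (1 / 4) \<sigma> = ee (- 1 / 8) * (qpoch_inf \<i> q * qpoch_inf (- (\<i> * q)) q) / P ^ 2"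
    unfolding klein_def theta1_def by (simp add: e ee_quarter P_def)
  also have "qpoch_inf \<i> q = (1 - \<i>) * qpoch_inf (\<i> * q) q" by (rule qpoch_inf_rec[OF q])
  also have "(1 - \<i>) * qpoch_inf (\<i> * q) q * qpoch_inf (- (\<i> * q)) q = (1 - \<i>) * qpoch_inf (- q\<^sup>2) (q\<^sup>2)"
    using qpoch_inf_square[OF q, of "\<i> * q"] by (simp add: power_mult_distrib mult.assoc)
  also have "qpoch_inf (- q\<^sup>2) (q\<^sup>2) = P4 / P2"
    using qpoch_inf_square[OF q2, of "q\<^sup>2"] nz by (simp add: P2_def P4_def field_simps flip: power_mult)
  finally have B: "klein 0 (1 / 4) \<sigma> = ee (- 1 / 8) * (1 - \<i>) * (P4 / (P2 * P ^ 2))"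
    by (simp add: mult_ac)
  have "P ^ 2 / (P2 ^ 2 * P4 ^ 4) * (P4 / (P2 * P ^ 2)) = 1 / (P2 * P4) ^ 3"
    using nz by (simp add: field_simps eval_nat_numeral)
  moreover have "klein4 \<sigma> = ee (- 1 / 8) * (1 - \<i>) * ee (- 3 * \<sigma> / 4) * (P ^ 2 / (P2 ^ 2 * P4 ^ 4) * (P4 / (P2 * P ^ 2)))"
    unfolding klein4_def A B by (simp only: mult_ac)
  ultimately have "klein4 \<sigma> = ee (- 1 / 8) * (1 - \<i>) * ee (- 3 * \<sigma> / 4) * (1 / (P2 * P4) ^ 3)" by (simp only:)
  thus ?thesis by (simp add: P2_def P4_def q_def)
qed

section \<open>Invariance of the products\<close>

definition eta_quot :: "nat \<Rightarrow> nat \<Rightarrow> nat \<Rightarrow> nat \<Rightarrow> nat \<Rightarrow> complex \<Rightarrow> complex" where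
  "eta_quot n a b c d q = J 14 q * J 28 q ^ 2 * J2 n 28 q / (J2 a 28 q * J2 b 28 q * J2 c 28 q * J2 d 28 q)"

text \<open>The factor \<open>1176 = 28 \<cdot> 42\<close> is such that \<open>ee (1176 \<tau>) = q\<^bsup>28\<^esup>\<close> for \<open>q = ee (42 \<tau>)\<close>.\<close>

definition klein28 :: "nat \<Rightarrow> complex \<Rightarrow> complex" where
  "klein28 a \<tau> = klein (of_nat a / 28) 0 (1176 * \<tau>)"

lemma J_nonzero:
  assumes "norm q < 1" "m > 0"
  shows "J m q \<noteq> 0"
  unfolding J_def using assms by (intro qpoch_inf_power_nonzero)

lemma J2_nonzero:
  assumes "norm q < 1" "a > 0" "a < m"
  shows "J2 a m q \<noteq> 0"
  unfolding J2_def using assms by (auto simp: qpoch_inf_power_nonzero)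

lemma klein28_Gamma1:
  fixes a b c d :: int
  assumes \<tau>: "Im \<tau> > 0" and g: "in_Gamma1 a b c d"
  shows "klein28 r ((of_int a * \<tau> + of_int b) / (of_int c * \<tau> + of_int d)) =
     ee (3 * of_nat r ^ 2 / 4 * of_int b) * klein28 r \<tau> / (of_int c * \<tau> + of_int d)"
proof -
  have e: "of_int (int r * (21 * int r) * b) / of_int 28 = (3 * of_nat r ^ 2 / 4 * of_int b :: complex)"
    by (simp add: power2_eq_square)
  have "int r * 1176 = 2 * 28 * (21 * int r)" by simp
  from klein_Gamma1_I[OF \<tau> g _ _ _ _ this] show ?thesis
    unfolding e by (simp add: klein28_def)
qed

text \<open>The cube in \<open>klein3\<close> kills the third root of unity left by
  \<open>klein_Gamma1_I\<close>.\<close>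

lemma klein3_Gamma1:
  fixes a b c d M u :: int
  assumes \<tau>: "Im \<tau> > 0" and g: "in_Gamma1 a b c d" and M: "M > 0" "M = 2 * u" "18 * M dvd 28224"
  shows "klein3 (of_int M * ((of_int a * \<tau> + of_int b) / (of_int c * \<tau> + of_int d))) =
     klein3 (of_int M * \<tau>) / (of_int c * \<tau> + of_int d) ^ 4"
proof -
  define j where "j = of_int c * \<tau> + of_int d"
  define \<tau>' where "\<tau>' = (of_int a * \<tau> + of_int b) / j"
  have M3: "3 * M dvd 28224" 
    by (rule dvd_trans[OF _ M(3)], rule dvdI[of _ _ 6]) simp
  have "1 * (3 * M) = 2 * 3 * u" using M by simp
  from klein_Gamma1_I[OF \<tau> g _ M3 _ _ this]
  have 1: "klein (1 / 3) 0 (of_int (3 * M) * \<tau>') = ee (of_int (u * b) / 3) * klein (1 / 3) 0 (of_int (3 * M) * \<tau>) / j"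
    using M by (simp add: \<tau>'_def j_def)
  have 2: "klein 0 (1 / 3) (of_int M * \<tau>') = klein 0 (1 / 3) (of_int M * \<tau>) / j"
    using klein_Gamma1_II[OF \<tau> g M(1), of 3] M(3) by (simp add: \<tau>'_def j_def)
  have "ee (of_int (u * b) / 3) ^ 3 = 1"
    using ee_of_nat_mult[of 3 "of_int (u * b) / 3"] by (simp del: of_int_mult)
  moreover have "3 * (of_int M * x) = of_int (3 * M) * x" for x :: complex by simp
  ultimately have "klein3 (of_int M * \<tau>') = klein3 (of_int M * \<tau>) / (j ^ 3 * j)"
    unfolding klein3_def by (simp only: 1 2 power_mult_distrib power_divide mult_1) simp
  also have "j ^ 3 * j = j ^ 4" by (simp add: eval_nat_numeral)
  finally show ?thesis by (simp add: \<tau>'_def j_def)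
qed

text \<open>Here 1176 = 2 * 4 * 147, and squaring ee(147 b / 4) leaves the sign (-1)^b. It is kept
  in the form ee(147 b / 2) so that exponents can be added later.\<close>

lemma klein4_Gamma1:
  fixes a b c d :: int
  assumes \<tau>: "Im \<tau> > 0" and g: "in_Gamma1 a b c d"
  shows "klein4 (294 * ((of_int a * \<tau> + of_int b) / (of_int c * \<tau> + of_int d))) =
     ee (147 / 2 * of_int b) * klein4 (294 * \<tau>) / (of_int c * \<tau> + of_int d) ^ 3"
proof -
  define j where "j = of_int c * \<tau> + of_int d"
  define \<tau>' where "\<tau>' = (of_int a * \<tau> + of_int b) / j"
  have "1 * 1176 = 2 * 4 * (147 :: int)" by simp
  from klein_Gamma1_I[OF \<tau> g _ _ _ _ this]
  have 1: "klein (1 / 4) 0 (1176 * \<tau>') = ee (147 * of_int b / 4) * klein (1 / 4) 0 (1176 * \<tau>) / j"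
    by (simp add: \<tau>'_def j_def)
  have 2: "klein 0 (1 / 4) (294 * \<tau>') = klein 0 (1 / 4) (294 * \<tau>) / j"
    using klein_Gamma1_II[OF \<tau> g, of 294 4] by (simp add: \<tau>'_def j_def)
  have "ee (147 * of_int b / 4) ^ 2 = ee (147 / 2 * of_int b)"
    using ee_of_nat_mult[of 2 "147 * of_int b / 4"] by simp
  moreover have "4 * (294 * x) = 1176 * x" for x :: complex by simp
  ultimately have "klein4 (294 * \<tau>') = ee (147 / 2 * of_int b) * klein4 (294 * \<tau>) / (j ^ 2 * j)"
    unfolding klein4_def by (simp only: 1 2 power_mult_distrib power_divide) simp
  also have "j ^ 2 * j = j ^ 3" by (simp add: eval_nat_numeral)
  finally show ?thesis by (simp add: \<tau>'_def j_def)
qed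

text \<open>The order at infinity of \<open>klein28 a\<close>, that is the exponent of the leading power of \<open>ee \<tau>\<close>.\<close>

definition eta_weight :: "nat \<Rightarrow> complex" where
  "eta_weight a = 3 * of_nat a ^ 2 / 4 - 21 * of_nat a"

lemma klein_numbers_nonzero: "1 - ee (1 / 3) \<noteq> 0" "1 - \<i> \<noteq> 0"
  using ee_third(2) by (auto simp: complex_eq_iff)

text \<open>The five forms \<open>klein28\<close> contribute J_28^(-3 + 12) relative to the
  J_{a,28}, so J_14 J_28^-7 must be supplied in addition. The available blocks are J_14^-8 from
  \<open>klein3 (196 * \<tau>)\<close>, J_28^-8 from \<open>klein3 (392 * \<tau>)\<close> and (J_14
  J_28)^-3 from \<open>klein4 (294 * \<tau>)\<close>; the exponents 1, 2 and -3 give (1, -7) = (-8,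
  0) + (0, -16) + (9, 9). Their orders at infinity add up to -196 - 2 * 392 + 3 * 441/2 =
  -637/2.\<close>

lemma eta_quot_klein:
  assumes \<tau>: "Im \<tau> > 0"
    and r: "0 < n" "n < 28" "0 < a" "a < 28" "0 < b" "b < 28" "0 < c" "c < 28" "0 < d" "d < 28"
    and C: "C = eta_weight n - eta_weight a - eta_weight b - eta_weight c - eta_weight d - 637 / 2"
  shows "ee (C * \<tau>) * eta_quot n a b c d (ee (42 * \<tau>)) =
     (ee (- 1 / 8) * (1 - \<i>)) ^ 3 / (ee (- 1 / 6) * (1 - ee (1 / 3))) ^ 3 *
     (klein28 n \<tau> * klein3 (196 * \<tau>) * klein3 (392 * \<tau>) ^ 2 /
       (klein28 a \<tau> * klein28 b \<tau> * klein28 c \<tau> * klein28 d \<tau> * klein4 (294 * \<tau>) ^ 3))"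
proof -
  define q where "q = ee (42 * \<tau>)"
  have q: "norm q < 1" unfolding q_def using \<tau> by (intro norm_ee_less_1) simp
  define cA where "cA = ee (- 1 / 8) * (1 - \<i>)"
  define cB where "cB = ee (- 1 / 6) * (1 - ee (1 / 3))"
  define P Q where "P = J 14 q" and "Q = J 28 q"
  define X where "X m = J2 m 28 q" for m
  define E where "E x = ee (x * \<tau>)" for x
  have nz: "cA \<noteq> 0" "cB \<noteq> 0" "P \<noteq> 0" "Q \<noteq> 0" "X n \<noteq> 0" "X a \<noteq> 0" "X b \<noteq> 0" "X c \<noteq> 0" "X d \<noteq> 0"
    using klein_numbers_nonzero J_nonzero[OF q] J2_nonzero[OF q] r
    by (auto simp: cA_def cB_def P_def Q_def X_def)
  have Enz: "E x \<noteq> 0" for x by (simp add: E_def)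
  have K: "klein28 m \<tau> = E (eta_weight m) * X m / Q ^ 3" if "m < 28" for m
    unfolding klein28_def using klein_28[OF \<tau>, of m] that by (simp add: E_def X_def Q_def q_def eta_weight_def)
  have pw: "ee (294 * \<tau>) ^ 2 = q ^ 14" "ee (294 * \<tau>) ^ 4 = q ^ 28" "ee (196 * \<tau>) ^ 3 = q ^ 14" "ee (392 * \<tau>) ^ 3 = q ^ 28"
    unfolding q_def by (simp_all flip: ee_numeral_mult)
  have k4: "klein4 (294 * \<tau>) = cA * E (- 441 / 2) / (P * Q) ^ 3"
    using \<tau> by (subst klein4_eq) (simp_all add: pw cA_def E_def P_def Q_def J_def)
  have k3: "klein3 (196 * \<tau>) = cB * E (- 196) / P ^ 8" "klein3 (392 * \<tau>) = cB * E (- 392) / Q ^ 8"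
    using \<tau> by (subst klein3_eq; simp add: pw cB_def E_def P_def Q_def J_def)+
  have E_pow: "E x ^ k = E (of_nat k * x)" for x k
    unfolding E_def by (simp add: mult.assoc flip: ee_of_nat_mult)
  have E_mult: "E x * E y = E (x + y)" for x y unfolding E_def by (simp add: ee_add distrib_right)
  have E_div: "E x / E y = E (x - y)" for x y unfolding E_def by (simp add: ee_diff left_diff_distrib)
  have "klein28 n \<tau> * klein3 (196 * \<tau>) * klein3 (392 * \<tau>) ^ 2 /
       (klein28 a \<tau> * klein28 b \<tau> * klein28 c \<tau> * klein28 d \<tau> * klein4 (294 * \<tau>) ^ 3) =
     cB ^ 3 / cA ^ 3 * (E (eta_weight n) * E (- 196) * E (- 392) ^ 2 /
        (E (eta_weight a) * E (eta_weight b) * E (eta_weight c) * E (eta_weight d) * E (- 441 / 2) ^ 3)) *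
       (P * Q ^ 2 * X n / (X a * X b * X c * X d))"
    unfolding K[OF r(2)] K[OF r(4)] K[OF r(6)] K[OF r(8)] K[OF r(10)] k3 k4
    using nz Enz by (simp add: divide_simps power_mult_distrib flip: power_mult) (simp add: eval_nat_numeral)
  also have "E (eta_weight n) * E (- 196) * E (- 392) ^ 2 /
        (E (eta_weight a) * E (eta_weight b) * E (eta_weight c) * E (eta_weight d) * E (- 441 / 2) ^ 3) = E C"
    unfolding E_pow E_mult E_div C by (rule arg_cong[of _ _ E]) simp
  finally have "klein28 n \<tau> * klein3 (196 * \<tau>) * klein3 (392 * \<tau>) ^ 2 /
       (klein28 a \<tau> * klein28 b \<tau> * klein28 c \<tau> * klein28 d \<tau> * klein4 (294 * \<tau>) ^ 3) =
     cB ^ 3 / cA ^ 3 * (E C * eta_quot n a b c d q)"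
    by (simp add: eta_quot_def P_def Q_def X_def mult.assoc)
  moreover have "cA ^ 3 / cB ^ 3 * (cB ^ 3 / cA ^ 3 * y) = y" for y
    using nz by simp
  ultimately show ?thesis unfolding cA_def [symmetric] cB_def [symmetric] q_def [symmetric]
    by (simp only: E_def)
qed

text \<open>The total weight is 0: numerator and denominator both carry j^-13, from 1 + 4 + 8 and
  from 4 + 9.\<close>

lemma weight_cancel:
  fixes j :: complex
  assumes "j \<noteq> 0"
  shows "(en * Kn / j) * (Z / j ^ 4) * (Y / j ^ 4) ^ 2 /
       ((ea * Ka / j) * (eb * Kb / j) * (ec * Kc / j) * (ed * Kd / j) * (ex * X / j ^ 3) ^ 3) =
     en / (ea * eb * ec * ed * ex ^ 3) * (Kn * Z * Y ^ 2 / (Ka * Kb * Kc * Kd * X ^ 3))"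
proof -
  define i where "i = inverse j"
  have i: "i \<noteq> 0" "x / j = x * i" "x / j ^ m = x * i ^ m" for x m
    using assms by (simp_all add: i_def divide_inverse power_inverse)
  have num: "(en * Kn * i) * (Z * i ^ 4) * (Y * i ^ 4) ^ 2 = (en * (Kn * Z * Y ^ 2)) * i ^ 13"
    by algebra
  have den: "(ea * Ka * i) * (eb * Kb * i) * (ec * Kc * i) * (ed * Kd * i) * (ex * X * i ^ 3) ^ 3 =
      ((ea * eb * ec * ed * ex ^ 3) * (Ka * Kb * Kc * Kd * X ^ 3)) * i ^ 13"
    by algebra
  show ?thesis unfolding i(2,3) num den using i(1) by simp
qed

text \<open>Multiplying the roots of unity of all Klein forms gives ee of B times (3/4) (n^2 - a^2 -
  b^2 - c^2 - d^2) - 3 * 147/2. Since 3 * 147/2 = 882/4, the hypothesis on \<open>k\<close> says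
  that this number is an integer.\<close>

theorem eta_quot_Gamma1:
  fixes A B C' D :: int
  assumes \<tau>: "Im \<tau> > 0" and g: "in_Gamma1 A B C' D"
    and r: "0 < n" "n < 28" "0 < a" "a < 28" "0 < b" "b < 28" "0 < c" "c < 28" "0 < d" "d < 28"
    and C: "C = eta_weight n - eta_weight a - eta_weight b - eta_weight c - eta_weight d - 637 / 2"
    and k: "3 * (int n ^ 2 - int a ^ 2 - int b ^ 2 - int c ^ 2 - int d ^ 2) - 882 = 4 * k"
  defines "\<tau>' \<equiv> (of_int A * \<tau> + of_int B) / (of_int C' * \<tau> + of_int D)"
  shows "ee (C * \<tau>') * eta_quot n a b c d (ee (42 * \<tau>')) = ee (C * \<tau>) * eta_quot n a b c d (ee (42 * \<tau>))"
proof -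
  define j where "j = of_int C' * \<tau> + of_int D"
  have det: "A * D - B * C' = 1" using g by (simp add: in_Gamma1_def)
  have j: "j \<noteq> 0" and \<tau>': "Im \<tau>' > 0" using Im_moebius_pos[OF \<tau> det] by (auto simp: j_def \<tau>'_def)
  define E where "E x = ee (x * of_int B)" for x
  have K: "klein28 m \<tau>' = E (3 * of_nat m ^ 2 / 4) * klein28 m \<tau> / j" for m
    unfolding \<tau>'_def j_def E_def by (rule klein28_Gamma1[OF \<tau> g])
  have k4: "klein4 (294 * \<tau>') = E (147 / 2) * klein4 (294 * \<tau>) / j ^ 3"
    unfolding \<tau>'_def j_def E_def by (rule klein4_Gamma1[OF \<tau> g])
  have k3: "klein3 (196 * \<tau>') = klein3 (196 * \<tau>) / j ^ 4" "klein3 (392 * \<tau>') = klein3 (392 * \<tau>) / j ^ 4"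
  proof -
    have "klein3 (of_int 196 * \<tau>') = klein3 (of_int 196 * \<tau>) / j ^ 4"
      unfolding \<tau>'_def j_def by (rule klein3_Gamma1[OF \<tau> g, of 196 98]) simp_all
    moreover have "klein3 (of_int 392 * \<tau>') = klein3 (of_int 392 * \<tau>) / j ^ 4"
      unfolding \<tau>'_def j_def by (rule klein3_Gamma1[OF \<tau> g, of 392 196]) simp_all
    ultimately show "klein3 (196 * \<tau>') = klein3 (196 * \<tau>) / j ^ 4" "klein3 (392 * \<tau>') = klein3 (392 * \<tau>) / j ^ 4"
      by (simp_all only: of_int_numeral)
  qed
  have E_pow: "E x ^ m = E (of_nat m * x)" for x m
    unfolding E_def by (simp add: mult.assoc flip: ee_of_nat_mult)
  have E_mult: "E x * E y = E (x + y)" for x y unfolding E_def by (simp add: ee_add distrib_right)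
  have E_div: "E x / E y = E (x - y)" for x y unfolding E_def by (simp add: ee_diff left_diff_distrib)
  define Kn Ka Kb Kc Kd where "Kn = klein28 n \<tau>" "Ka = klein28 a \<tau>" "Kb = klein28 b \<tau>" "Kc = klein28 c \<tau>" "Kd = klein28 d \<tau>"
  define Y Z X where "Y = klein3 (392 * \<tau>)" "Z = klein3 (196 * \<tau>)" "X = klein4 (294 * \<tau>)"
  have "(E (3 * of_nat n ^ 2 / 4) * Kn / j) * (Z / j ^ 4) * (Y / j ^ 4) ^ 2 /
       ((E (3 * of_nat a ^ 2 / 4) * Ka / j) * (E (3 * of_nat b ^ 2 / 4) * Kb / j) * (E (3 * of_nat c ^ 2 / 4) * Kc / j) *
        (E (3 * of_nat d ^ 2 / 4) * Kd / j) * (E (147 / 2) * X / j ^ 3) ^ 3) =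
     E (3 * of_nat n ^ 2 / 4) / (E (3 * of_nat a ^ 2 / 4) * E (3 * of_nat b ^ 2 / 4) * E (3 * of_nat c ^ 2 / 4) * E (3 * of_nat d ^ 2 / 4) * E (147 / 2) ^ 3) *
     (Kn * Z * Y ^ 2 / (Ka * Kb * Kc * Kd * X ^ 3))"
    by (rule weight_cancel[OF j])
  also have "E (3 * of_nat n ^ 2 / 4) / (E (3 * of_nat a ^ 2 / 4) * E (3 * of_nat b ^ 2 / 4) * E (3 * of_nat c ^ 2 / 4) * E (3 * of_nat d ^ 2 / 4) * E (147 / 2) ^ 3) = 1"
  proof -
    have "E (3 * of_nat n ^ 2 / 4) / (E (3 * of_nat a ^ 2 / 4) * E (3 * of_nat b ^ 2 / 4) * E (3 * of_nat c ^ 2 / 4) * E (3 * of_nat d ^ 2 / 4) * E (147 / 2) ^ 3) =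
      E (of_int (3 * (int n ^ 2 - int a ^ 2 - int b ^ 2 - int c ^ 2 - int d ^ 2) - 882) / 4)"
      unfolding E_pow E_mult E_div by (rule arg_cong[of _ _ E]) (simp add: field_simps)
    also have "\<dots> = E (of_int k)" unfolding k by simp
    also have "\<dots> = 1" unfolding E_def of_int_mult [symmetric] by (rule ee_of_int)
    finally show ?thesis .
  qed
  finally have "klein28 n \<tau>' * klein3 (196 * \<tau>') * klein3 (392 * \<tau>') ^ 2 /
       (klein28 a \<tau>' * klein28 b \<tau>' * klein28 c \<tau>' * klein28 d \<tau>' * klein4 (294 * \<tau>') ^ 3) =
     klein28 n \<tau> * klein3 (196 * \<tau>) * klein3 (392 * \<tau>) ^ 2 /
       (klein28 a \<tau> * klein28 b \<tau> * klein28 c \<tau> * klein28 d \<tau> * klein4 (294 * \<tau>) ^ 3)"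
    unfolding K k3 k4 Kn_Ka_Kb_Kc_Kd_def Y_Z_X_def by simp
  thus ?thesis unfolding eta_quot_klein[OF \<tau> r C] eta_quot_klein[OF \<tau>' r C] by (simp only:)
qed

section \<open>Meromorphy at the cusps\<close>

lemma sum_powers_le:
  fixes \<rho> :: real
  assumes "0 \<le> \<rho>" "\<rho> < 1"
  shows "(\<Sum>k<n. \<rho> ^ Suc k) \<le> \<rho> / (1 - \<rho>)"
proof -
  have "(\<Sum>k<n. \<rho> ^ Suc k) = \<rho> * (\<Sum>k<n. \<rho> ^ k)" by (simp add: sum_distrib_left)
  also have "(\<Sum>k<n. \<rho> ^ k) = (1 - \<rho> ^ n) / (1 - \<rho>)" using assms by (simp add: sum_gp_strict)
  also have "\<rho> * \<dots> \<le> \<rho> * (1 / (1 - \<rho>))"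
    using assms by (intro mult_left_mono divide_right_mono) auto
  finally show ?thesis by simp
qed

lemma prod_one_plus_powers_le:
  fixes \<rho> :: real
  assumes "0 \<le> \<rho>" "\<rho> < 1"
  shows "(\<Prod>k<n. 1 + \<rho> ^ Suc k) \<le> exp (\<rho> / (1 - \<rho>))"
proof -
  have "(\<Prod>k<n. 1 + \<rho> ^ Suc k) \<le> exp (\<Sum>k<n. \<rho> ^ Suc k)"
    using assms by (intro prod_le_exp_sum) auto
  also have "\<dots> \<le> exp (\<rho> / (1 - \<rho>))" using sum_powers_le[OF assms] by simp
  finally show ?thesis .
qed

text \<open>For \<rho> \<le> 1/2 the bound follows from 1 / (1 - x) \<le> 1 + 2x. Larger \<rho> are
  squared repeatedly, N counting the squarings: the product for \<rho>^2 is the product for \<rho>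
  times that of the factors 1 + \<rho>^k, and the bound is stable because 2 / (1 - \<rho>^2) +
  \<rho> / (1 - \<rho>) \<le> 2 / (1 - \<rho>). An exponent of order 1 / (1 - \<rho>) is what
  matters: at a cusp it becomes linear in Im \<tau>.\<close>

lemma euler_prod_inverse_le:
  fixes \<rho> :: real
  assumes "0 < \<rho>" "\<rho> < 1"
  shows "inverse (\<Prod>k<n. 1 - \<rho> ^ Suc k) \<le> exp (2 / (1 - \<rho>))"
proof -
  have *: "inverse (\<Prod>k<n. 1 - \<rho> ^ Suc k) \<le> exp (2 / (1 - \<rho>))"
    if "0 < \<rho>" "\<rho> < 1" "\<rho> ^ (2 ^ N) \<le> 1 / 2" for N and \<rho> :: real
    using that
  proof (induction N arbitrary: \<rho>)
    case 0
    hence \<rho>: "\<rho> \<le> 1 / 2" by simp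
    have le: "\<rho> ^ Suc k \<le> 1 / 2" for k
    proof -
      have "\<rho> ^ Suc k \<le> \<rho> ^ 1" using 0 by (intro power_decreasing) auto
      thus ?thesis using \<rho> unfolding power_one_right by linarith
    qed
    have "inverse (\<Prod>k<n. 1 - \<rho> ^ Suc k) = (\<Prod>k<n. inverse (1 - \<rho> ^ Suc k))"
      using prod_inversef[of "\<lambda>k. 1 - \<rho> ^ Suc k" "{..<n}"] by (simp add: o_def)
    also have "\<dots> \<le> (\<Prod>k<n. 1 + 2 * \<rho> ^ Suc k)"
    proof (rule prod_mono, safe)
      fix k
      define x where "x = \<rho> ^ Suc k"
      have x: "0 \<le> x" "x \<le> 1 / 2" using le[of k] 0 by (auto simp: x_def)
      hence "x * (1 - 2 * x) \<ge> 0" by (intro mult_nonneg_nonneg) auto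
      hence "1 \<le> (1 + 2 * x) * (1 - x)" by (simp add: algebra_simps)
      thus "inverse (1 - \<rho> ^ Suc k) \<le> 1 + 2 * \<rho> ^ Suc k"
        unfolding x_def [symmetric] using x by (simp add: inverse_eq_divide divide_le_eq)
      show "0 \<le> inverse (1 - \<rho> ^ Suc k)" unfolding x_def [symmetric] using x by simp
    qed
    also have "\<dots> \<le> exp (\<Sum>k<n. 2 * \<rho> ^ Suc k)" using 0 by (intro prod_le_exp_sum) auto
    also have "(\<Sum>k<n. 2 * \<rho> ^ Suc k) \<le> 2 * (\<rho> / (1 - \<rho>))"
      using sum_powers_le[of \<rho> n] 0 unfolding sum_distrib_left [symmetric] by (intro mult_left_mono) auto
    also have "\<dots> \<le> 2 / (1 - \<rho>)" using 0 by (simp add: divide_right_mono)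
    finally show ?case by simp
  next
    case (Suc N)
    have \<rho>: "0 < \<rho>" "\<rho> < 1" by fact+
    have IH: "inverse (\<Prod>k<n. 1 - (\<rho>\<^sup>2) ^ Suc k) \<le> exp (2 / (1 - \<rho>\<^sup>2))"
    proof (rule Suc.IH)
      show "(\<rho>\<^sup>2) ^ (2 ^ N) \<le> 1 / 2" using Suc.prems by (simp flip: power_mult)
      show "\<rho>\<^sup>2 < 1" using \<rho> by (simp add: power_less_one_iff)
    qed (use \<rho> in simp)
    have eq: "(\<Prod>k<n. 1 - (\<rho>\<^sup>2) ^ Suc k) = (\<Prod>k<n. 1 - \<rho> ^ Suc k) * (\<Prod>k<n. 1 + \<rho> ^ Suc k)"
      unfolding prod.distrib [symmetric]
      by (intro prod.cong refl) (simp add: algebra_simps power2_eq_square power_mult_distrib)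
    have pos: "(\<Prod>k<n. 1 + \<rho> ^ Suc k) > 0" using \<rho> by (intro prod_pos) (auto intro: add_pos_nonneg)
    have "inverse x = inverse (x * y) * y" if "y \<noteq> 0" for x y :: real
      using that by simp
    hence "inverse (\<Prod>k<n. 1 - \<rho> ^ Suc k) = inverse (\<Prod>k<n. 1 - (\<rho>\<^sup>2) ^ Suc k) * (\<Prod>k<n. 1 + \<rho> ^ Suc k)"
      using pos unfolding eq by (metis less_irrefl)
    also have "\<dots> \<le> exp (2 / (1 - \<rho>\<^sup>2)) * (\<Prod>k<n. 1 + \<rho> ^ Suc k)"
      using pos IH by (intro mult_right_mono) auto
    also have "\<dots> \<le> exp (2 / (1 - \<rho>\<^sup>2)) * exp (\<rho> / (1 - \<rho>))"
      using \<rho> by (intro mult_left_mono prod_one_plus_powers_le) auto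
    also have "\<dots> = exp (2 / (1 - \<rho>\<^sup>2) + \<rho> / (1 - \<rho>))" by (simp add: exp_add)
    also have "2 / (1 - \<rho>\<^sup>2) + \<rho> / (1 - \<rho>) \<le> 2 / (1 - \<rho>)"
    proof -
      have eq: "1 - \<rho>\<^sup>2 = (1 - \<rho>) * (1 + \<rho>)" by (simp add: power2_eq_square algebra_simps)
      have "2 / (x * y) + \<rho> / x = (2 + \<rho> * y) / (x * y)" if "y \<noteq> 0" for x y :: real
        using that by (simp add: add_divide_distrib)
      hence "2 / (1 - \<rho>\<^sup>2) + \<rho> / (1 - \<rho>) = (2 + \<rho> * (1 + \<rho>)) / ((1 - \<rho>) * (1 + \<rho>))"
        unfolding eq using \<rho> by simp
      also have "\<dots> \<le> (2 * (1 + \<rho>)) / ((1 - \<rho>) * (1 + \<rho>))"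
      proof (rule divide_right_mono)
        have "\<rho> * \<rho> \<le> \<rho> * 1" using \<rho> by (intro mult_left_mono) auto
        thus "2 + \<rho> * (1 + \<rho>) \<le> 2 * (1 + \<rho>)" by (simp add: algebra_simps)
      qed (use \<rho> in simp)
      also have "\<dots> = 2 / (1 - \<rho>)"
        by (rule nonzero_mult_divide_mult_cancel_right) (use \<rho> in simp)
      finally show ?thesis .
    qed
    finally show ?case by simp
  qed
  obtain m where m: "\<rho> ^ m < 1 / 2"
    using real_arch_pow_inv[of "1 / 2" \<rho>] assms by auto
  have "\<rho> ^ (2 ^ m) \<le> \<rho> ^ m" using assms by (intro power_decreasing) (auto intro: less_imp_le)
  also have "\<dots> \<le> 1 / 2" using m by simp
  finally show ?thesis by (rule *[OF assms])
qed

text \<open>Every factor differs from 1 by at most |q|^(k+1), since a + m k \<ge> k + 1; one bound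
  thus serves for all a and m.\<close>

lemma norm_qpoch_inf_le:
  assumes q: "norm q < 1" "q \<noteq> 0" and am: "a > 0" "m > 0"
  shows "norm (qpoch_inf (q ^ a) (q ^ m)) \<le> exp (2 / (1 - norm q))"
    and "norm (inverse (qpoch_inf (q ^ a) (q ^ m))) \<le> exp (2 / (1 - norm q))"
proof -
  define \<rho> where "\<rho> = norm q"
  have \<rho>: "0 < \<rho>" "\<rho> < 1" using q by (auto simp: \<rho>_def)
  have qm: "norm (q ^ m) < 1" using q am by (simp add: norm_power power_less_one_iff)
  have le: "norm (q ^ a * (q ^ m) ^ k) \<le> \<rho> ^ Suc k" for k
  proof -
    have "Suc k \<le> a + m * k" using am by (cases m) auto
    hence "\<rho> ^ (a + m * k) \<le> \<rho> ^ Suc k" using \<rho> by (intro power_decreasing) auto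
    thus ?thesis by (simp add: norm_mult norm_power \<rho>_def power_add power_mult)
  qed
  have ub: "norm (qpoch (q ^ a) (q ^ m) n) \<le> exp (2 / (1 - \<rho>))" for n
  proof -
    have "norm (qpoch (q ^ a) (q ^ m) n) \<le> (\<Prod>k<n. 1 + \<rho> ^ Suc k)"
      unfolding qpoch_def prod_norm [symmetric]
    proof (rule prod_mono, safe)
      fix k
      have "norm (1 - q ^ a * (q ^ m) ^ k) \<le> norm (1 :: complex) + norm (q ^ a * (q ^ m) ^ k)" by (rule norm_triangle_ineq4)
      thus "norm (1 - q ^ a * (q ^ m) ^ k) \<le> 1 + \<rho> ^ Suc k" using le[of k] by simp
    qed simp
    also have "\<dots> \<le> exp (\<rho> / (1 - \<rho>))" using \<rho> by (intro prod_one_plus_powers_le) auto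
    also have "\<dots> \<le> exp (2 / (1 - \<rho>))" using \<rho> by (simp add: divide_right_mono)
    finally show ?thesis .
  qed
  have lb: "norm (inverse (qpoch (q ^ a) (q ^ m) n)) \<le> exp (2 / (1 - \<rho>))" for n
  proof -
    have small: "\<rho> ^ Suc k < 1" for k using \<rho> by (intro power_Suc_less_one) auto
    have "(\<Prod>k<n. 1 - \<rho> ^ Suc k) \<le> norm (qpoch (q ^ a) (q ^ m) n)"
      unfolding qpoch_def prod_norm [symmetric]
    proof (rule prod_mono, safe)
      fix k
      have "norm (1 :: complex) - norm (q ^ a * (q ^ m) ^ k) \<le> norm (1 - q ^ a * (q ^ m) ^ k)" by (rule norm_triangle_ineq2)
      thus "1 - \<rho> ^ Suc k \<le> norm (1 - q ^ a * (q ^ m) ^ k)" using le[of k] by simp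
      show "0 \<le> 1 - \<rho> ^ Suc k" using small[of k] by simp
    qed
    moreover have "(\<Prod>k<n. 1 - \<rho> ^ Suc k) > 0" using small by (intro prod_pos) simp
    ultimately have "inverse (norm (qpoch (q ^ a) (q ^ m) n)) \<le> inverse (\<Prod>k<n. 1 - \<rho> ^ Suc k)"
      by (rule le_imp_inverse_le)
    also have "\<dots> \<le> exp (2 / (1 - \<rho>))" by (rule euler_prod_inverse_le[OF \<rho>])
    finally show ?thesis by (simp add: norm_inverse)
  qed
  have nz: "qpoch_inf (q ^ a) (q ^ m) \<noteq> 0" using q am by (intro qpoch_inf_power_nonzero)
  show "norm (qpoch_inf (q ^ a) (q ^ m)) \<le> exp (2 / (1 - norm q))"
    by (rule tendsto_upperbound[OF tendsto_norm[OF qpoch_tendsto[OF qm]]]) (use ub in \<open>auto simp: \<rho>_def\<close>)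
  show "norm (inverse (qpoch_inf (q ^ a) (q ^ m))) \<le> exp (2 / (1 - norm q))"
    by (rule tendsto_upperbound[OF tendsto_norm[OF tendsto_inverse[OF qpoch_tendsto[OF qm] nz]]]) (use lb in \<open>auto simp: \<rho>_def\<close>)
qed

text \<open>18 counts the infinite products: one in J_14, two in J_28^2, and three in each of the
  five J_{a,28}.\<close>

lemma norm_eta_quot_le:
  assumes q: "norm q < 1" "q \<noteq> 0"
    and r: "0 < n" "n < 28" "0 < a" "a < 28" "0 < b" "b < 28" "0 < c" "c < 28" "0 < d" "d < 28"
  shows "norm (eta_quot n a b c d q) \<le> exp (2 / (1 - norm q)) ^ 18"
proof -
  define B where "B = exp (2 / (1 - norm q))"
  have B: "B \<ge> 0" by (simp add: B_def)
  have 1: "norm (qpoch_inf (q ^ e) (q ^ m)) \<le> B" "norm (inverse (qpoch_inf (q ^ e) (q ^ m))) \<le> B" if "e > 0" "m > 0" for e m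
    unfolding B_def by (rule norm_qpoch_inf_le[OF q that])+
  have J: "norm (J m q) \<le> B" if "m > 0" for m using 1[of m m] that by (simp add: J_def)
  have J2: "norm (J2 e 28 q) \<le> B * B * B" if "0 < e" "e < 28" for e
    unfolding J2_def norm_mult using that B by (intro mult_mono 1) auto
  have J2i: "norm (inverse (J2 e 28 q)) \<le> B * B * B" if "0 < e" "e < 28" for e
    unfolding J2_def inverse_mult_distrib norm_mult using that B by (intro mult_mono 1) auto
  have "norm (eta_quot n a b c d q) \<le> B * (B * B) * (B * B * B) * ((B * B * B) * (B * B * B) * (B * B * B) * (B * B * B))"
    unfolding eta_quot_def divide_inverse inverse_mult_distrib norm_mult power2_eq_square
    using B r by (intro mult_mono J J2 J2i) auto
  also have "\<dots> = B ^ 18" by (simp add: eval_nat_numeral)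
  finally show ?thesis by (simp add: B_def)
qed

text \<open>The Nahm sums are taken at \<open>ee (168 \<tau>) = q\<^sup>4\<close>, so the products are evaluated at \<open>q = ee (42 \<tau>)\<close>.\<close>

definition modular_eta_quot :: "int \<Rightarrow> nat \<Rightarrow> nat \<Rightarrow> nat \<Rightarrow> nat \<Rightarrow> nat \<Rightarrow> complex \<Rightarrow> complex" where
  "modular_eta_quot C n a b c d \<tau> = ee (of_int C * \<tau>) * eta_quot n a b c d (ee (42 * \<tau>))"

text \<open>From exp x \<ge> 1 + x one gets 1 / (1 - exp (-x)) \<le> 1 + 1/x, used with x = 84 pi Im
  \<tau>, which is at least Im \<tau>. The constant 36 is 2 * 18.\<close>

lemma norm_modular_eta_quot_le:
  assumes \<tau>: "Im \<tau> > 0"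
    and r: "0 < n" "n < 28" "0 < a" "a < 28" "0 < b" "b < 28" "0 < c" "c < 28" "0 < d" "d < 28"
  shows "norm (modular_eta_quot C n a b c d \<tau>) \<le> exp (2 * pi * \<bar>of_int C\<bar> * Im \<tau> + 36 * (1 + 1 / Im \<tau>))"
proof -
  define y where "y = Im \<tau>"
  have y: "y > 0" using \<tau> by (simp add: y_def)
  define q where "q = ee (42 * \<tau>)"
  have q: "norm q < 1" "q \<noteq> 0" unfolding q_def using \<tau> by (auto intro: norm_ee_less_1)
  have nq: "norm q = exp (- (84 * pi * y))" by (simp add: q_def norm_ee y_def)
  have "1 / (1 - norm q) \<le> 1 + 1 / y"
  proof -
    define x where "x = 84 * pi * y"
    have x: "x \<ge> y" "x > 0"
      using y pi_gt3 mult_right_mono[of 1 "84 * pi" y] by (auto simp: x_def)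
    have "exp x \<ge> 1 + x" by (rule exp_ge_add_one_self)
    hence "exp (- x) \<le> 1 / (1 + x)" using x by (simp add: exp_minus field_simps)
    moreover have "norm q = exp (- x)" by (simp add: nq x_def)
    moreover have "1 - 1 / (1 + x) = x / (1 + x)" using x by (simp add: field_simps)
    ultimately have "1 - norm q \<ge> x / (1 + x)" by linarith
    hence "1 / (1 - norm q) \<le> 1 / (x / (1 + x))"
      using x q(1) by (intro divide_left_mono) (auto intro!: mult_pos_pos divide_pos_pos)
    also have "\<dots> = 1 + 1 / x" using x by (simp add: field_simps)
    also have "1 / x \<le> 1 / y" using x y by (intro divide_left_mono) auto
    finally show ?thesis by simp
  qed
  hence "exp (2 / (1 - norm q)) ^ 18 \<le> exp (36 * (1 + 1 / y))"
    by (simp flip: exp_of_nat_mult)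
  moreover have "norm (ee (of_int C * \<tau>)) \<le> exp (2 * pi * \<bar>of_int C\<bar> * y)"
  proof -
    have "- (of_int C * y) \<le> \<bar>of_int C\<bar> * y"
      using y mult_right_mono[of "- of_int C" "\<bar>of_int C\<bar>" y] by simp
    hence "2 * pi * (- (of_int C * y)) \<le> 2 * pi * (\<bar>of_int C\<bar> * y)" by (intro mult_left_mono) auto
    thus ?thesis by (simp add: norm_ee y_def mult.assoc)
  qed
  ultimately have "norm (ee (of_int C * \<tau>)) * norm (eta_quot n a b c d q) \<le>
      exp (2 * pi * \<bar>of_int C\<bar> * y) * exp (36 * (1 + 1 / y))"
    using norm_eta_quot_le[OF q r] by (intro mult_mono) auto
  thus ?thesis by (simp add: modular_eta_quot_def q_def norm_mult y_def exp_add)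
qed

lemma holomorphic_modular_eta_quot:
  assumes r: "0 < n" "n < 28" "0 < a" "a < 28" "0 < b" "b < 28" "0 < c" "c < 28" "0 < d" "d < 28"
  shows "modular_eta_quot C n a b c d holomorphic_on {\<tau>. Im \<tau> > 0}"
proof -
  have o: "open {\<tau>. Im \<tau> > 0}" by (rule open_halfspace_Im_gt)
  have q: "norm (ee (42 * \<tau>)) < 1" if "\<tau> \<in> {\<tau>. Im \<tau> > 0}" for \<tau>
    using that by (intro norm_ee_less_1) simp
  have qm: "norm (ee (42 * \<tau>) ^ m) < 1" if "\<tau> \<in> {\<tau>. Im \<tau> > 0}" "m > 0" for \<tau> m
    using q[OF that(1)] that(2) by (simp add: norm_power power_less_one_iff)
  have e: "(\<lambda>\<tau>. ee (42 * \<tau>) ^ m) holomorphic_on {\<tau>. Im \<tau> > 0}" for m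
    by (intro holomorphic_intros)
  have P: "(\<lambda>\<tau>. qpoch_inf (ee (42 * \<tau>) ^ e) (ee (42 * \<tau>) ^ m)) holomorphic_on {\<tau>. Im \<tau> > 0}" if "m > 0" for e m
    by (rule holomorphic_on_qpoch_inf[OF e e o qm]) (use that in auto)
  have J: "(\<lambda>\<tau>. J m (ee (42 * \<tau>))) holomorphic_on {\<tau>. Im \<tau> > 0}" if "m > 0" for m
    unfolding J_def by (rule P[OF that])
  have J2: "(\<lambda>\<tau>. J2 e 28 (ee (42 * \<tau>))) holomorphic_on {\<tau>. Im \<tau> > 0}" for e
    unfolding J2_def by (intro holomorphic_on_mult P) auto
  have nz: "J2 e 28 (ee (42 * \<tau>)) \<noteq> 0" if "\<tau> \<in> {\<tau>. Im \<tau> > 0}" "0 < e" "e < 28" for e \<tau>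
    using q[OF that(1)] that by (intro J2_nonzero)
  show ?thesis unfolding modular_eta_quot_def [abs_def] eta_quot_def
    using r nz by (intro holomorphic_intros J J2) auto
qed

text \<open>Periodicity makes h a function g of w = exp(2 pi i \<tau> / N) on the punctured disc.
  Growth at most exponential in Im \<tau> is a power bound for g in |w|, so some w^k g has a
  removable singularity at 0. The growth is needed only on a strip, because the principal logarithm
  keeps the real part of \<tau> bounded.\<close>

lemma periodic_meromorphic_at_cusp:
  fixes h :: "complex \<Rightarrow> complex" and N :: nat and K :: real
  assumes N: "N > 0" and hol: "h holomorphic_on {\<tau>. Im \<tau> > 0}"
    and per: "\<And>\<tau>. Im \<tau> > 0 \<Longrightarrow> h (\<tau> + of_nat N) = h \<tau>"
    and growth: "\<And>\<tau>. Im \<tau> \<ge> 1 \<Longrightarrow> \<bar>Re \<tau>\<bar> \<le> of_nat N \<Longrightarrow> norm (h \<tau>) \<le> exp (K * Im \<tau>)"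
  shows "\<exists>g. g meromorphic_on {0} \<and> (\<forall>\<tau>. Im \<tau> > 0 \<longrightarrow> h \<tau> = g (exp (2 * of_real pi * \<i> * \<tau> / of_nat N)))"
proof -
  define T where "T u = of_nat N * u / (2 * of_real pi * \<i>)" for u :: complex
  define g where "g w = h (T (Ln w))" for w
  have N': "(of_nat N :: complex) \<noteq> 0" using N by simp
  have ImT: "Im (T u) = - (of_nat N * Re u / (2 * pi))" and ReT: "Re (T u) = of_nat N * Im u / (2 * pi)" for u
  proof -
    have "T u = of_real (of_nat N / (2 * pi)) * (- \<i> * u)" by (simp add: T_def field_simps)
    thus "Im (T u) = - (of_nat N * Re u / (2 * pi))" "Re (T u) = of_nat N * Im u / (2 * pi)"
      by simp_all
  qed
  have expT: "exp (2 * of_real pi * \<i> * T u / of_nat N) = exp u" for u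
    using N' by (simp add: T_def)
  have per_int: "h (\<tau> + of_int k * of_nat N) = h \<tau>" if "Im \<tau> > 0" for \<tau> k
  proof (induction k rule: int_induct[of _ 0])
    case (step1 k)
    have "Im (\<tau> + of_int k * of_nat N) > 0" using that by simp
    from per[OF this] show ?case using step1 by (simp add: algebra_simps)
  next
    case (step2 k)
    have "Im (\<tau> + of_int (k - 1) * of_nat N) > 0" using that by simp
    from per[OF this] show ?case using step2 by (simp add: algebra_simps)
  qed simp
  have same: "h \<tau> = h \<tau>'" if pos: "Im \<tau> > 0" and eq: "exp (2 * of_real pi * \<i> * \<tau> / of_nat N) = exp (2 * of_real pi * \<i> * \<tau>' / of_nat N)" for \<tau> \<tau>'
  proof -
    obtain k :: int where "2 * of_real pi * \<i> * \<tau>' / of_nat N = 2 * of_real pi * \<i> * \<tau> / of_nat N + (of_int (2 * k) * pi) * \<i>"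
      using eq [symmetric] unfolding exp_eq by auto
    hence "2 * of_real pi * \<i> * \<tau>' = 2 * of_real pi * \<i> * (\<tau> + of_int k * of_nat N)"
      using N' by (simp add: field_simps)
    hence "\<tau>' = \<tau> + of_int k * of_nat N" by simp
    thus ?thesis using per_int[OF pos] by simp
  qed
  have main: "h \<tau> = g (exp (2 * of_real pi * \<i> * \<tau> / of_nat N))" if "Im \<tau> > 0" for \<tau>
    unfolding g_def using that by (intro same) (simp_all add: expT)
  have g_T: "g w = h (T u)" if "exp u = w" "norm w < 1" for u w
  proof -
    have "Re u < 0" using that by (metis norm_exp_eq_Re exp_less_one_iff)
    hence "Im (T u) > 0" unfolding ImT using N by (simp add: mult_pos_neg divide_neg_pos)
    thus ?thesis using main[of "T u"] that by (simp add: expT)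
  qed
  have g_diff: "g field_differentiable (at w)" if w: "w \<noteq> 0" "norm w < 1" for w
  proof -
    \<comment> \<open>Holomorphy of g across the cut of \<open>Ln\<close>: near a point of the
      negative real axis the branch Ln(-z) + i pi is used instead, which gives the same g by
      periodicity of h.\<close>
    define s :: complex where "s = (if w \<in> \<real>\<^sub>\<le>\<^sub>0 then \<i> * of_real pi else 0)"
    define \<epsilon> :: complex where "\<epsilon> = (if w \<in> \<real>\<^sub>\<le>\<^sub>0 then - 1 else 1)"
    have \<epsilon>w: "\<epsilon> * w \<notin> \<real>\<^sub>\<le>\<^sub>0"
    proof (cases "w \<in> \<real>\<^sub>\<le>\<^sub>0")
      case True
      hence "Re w < 0" "Im w = 0" using w(1) by (auto simp: complex_nonpos_Reals_iff complex_eq_iff)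
      thus ?thesis using True by (simp add: \<epsilon>_def complex_nonpos_Reals_iff)
    qed (simp add: \<epsilon>_def)
    have se: "exp s = \<epsilon>" "\<epsilon> * \<epsilon> = 1" by (auto simp: s_def \<epsilon>_def exp_pi_i')
    define U where "U = (ball 0 1 - {0 :: complex}) \<inter> {z. \<epsilon> * z \<in> - \<real>\<^sub>\<le>\<^sub>0}"
    have U: "open U"
    proof -
      have "open ((\<lambda>z. \<epsilon> * z) -` (- \<real>\<^sub>\<le>\<^sub>0))"
        by (intro open_vimage open_Compl closed_nonpos_Reals_complex continuous_intros)
      thus ?thesis unfolding U_def by (intro open_Int open_Diff) (auto simp: vimage_def)
    qed
    have eq: "g z = h (T (Ln (\<epsilon> * z) + s))" if "z \<in> U" for z
    proof (rule g_T)
      have "z \<noteq> 0" "\<epsilon> \<noteq> 0" using that se by (auto simp: U_def)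
      thus "exp (Ln (\<epsilon> * z) + s) = z" using se by (simp add: exp_add mult_ac)
    qed (use that in \<open>auto simp: U_def\<close>)
    have im: "Im (T (Ln (\<epsilon> * z) + s)) > 0" if "z \<in> U" for z
    proof -
      have z: "z \<noteq> 0" "norm z < 1" using that by (auto simp: U_def)
      have "norm \<epsilon> = 1" "Re s = 0" by (auto simp: \<epsilon>_def s_def)
      moreover have "\<epsilon> * z \<noteq> 0" using z se by auto
      ultimately have "Re (Ln (\<epsilon> * z) + s) = ln (norm z)" by (simp add: norm_mult)
      also have "\<dots> < 0" using z by simp
      finally have "Re (Ln (\<epsilon> * z) + s) < 0" .
      thus ?thesis unfolding ImT using N by (simp add: mult_pos_neg divide_neg_pos)
    qed
    have "(\<lambda>z. T (Ln (\<epsilon> * z) + s)) holomorphic_on U"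
      unfolding T_def by (intro holomorphic_intros) (auto simp: U_def)
    hence "(h \<circ> (\<lambda>z. T (Ln (\<epsilon> * z) + s))) holomorphic_on U"
      by (rule holomorphic_on_compose_gen[OF _ hol]) (use im in auto)
    hence "g holomorphic_on U" by (rule holomorphic_transform) (use eq in auto)
    moreover have "w \<in> U" using w \<epsilon>w by (auto simp: U_def)
    ultimately show ?thesis using U by (auto simp: holomorphic_on_open field_differentiable_def)
  qed
  define R where "R = exp (- 2 * pi / of_nat N)"
  have R: "0 < R" "R < 1" using N by (auto simp: R_def)
  \<comment> \<open>On |w| < R one has Im \<tau> > 1 and exp(K Im \<tau>) = |w|^(- K N / (2 pi)).
    The additional 1 makes w^k g tend to 0.\<close>
  obtain k :: nat where k: "of_nat k \<ge> K * of_nat N / (2 * pi) + 1"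
    using real_nat_ceiling_ge by blast
  have bound: "norm (w ^ k * g w) \<le> norm w" if w: "w \<noteq> 0" "norm w < R" for w
  proof -
    define l where "l = - ln (norm w)"
    have lnR: "ln (norm w) < - 2 * pi / of_nat N"
      using w R by (metis R_def ln_exp ln_less_cancel_iff zero_less_norm_iff)
    have l: "l > 2 * pi / of_nat N" using lnR by (simp add: l_def)
    have wl: "norm w = exp (- l)" using w by (simp add: l_def)
    have l0: "l > 0" using l N by (meson divide_pos_pos less_trans mult_pos_pos of_nat_0_less_iff pi_gt_zero zero_less_numeral)
    have "Im (T (Ln w)) = of_nat N * l / (2 * pi)" unfolding ImT l_def using w by simp
    moreover have "of_nat N * l / (2 * pi) \<ge> 1" using l N by (simp add: field_simps)
    moreover have "\<bar>Re (T (Ln w))\<bar> \<le> of_nat N"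
    proof -
      have "\<bar>Im (Ln w)\<bar> \<le> pi" using mpi_less_Im_Ln[OF w(1)] Im_Ln_le_pi[OF w(1)] by auto
      hence "of_nat N * \<bar>Im (Ln w)\<bar> \<le> of_nat N * (2 * pi)" by (intro mult_left_mono) auto
      thus ?thesis unfolding ReT by (simp add: abs_mult field_simps)
    qed
    ultimately have "norm (g w) \<le> exp (K * (of_nat N * l / (2 * pi)))"
      unfolding g_def using growth[of "T (Ln w)"] by simp
    hence "norm (w ^ k * g w) \<le> exp (- l) ^ k * exp (K * (of_nat N * l / (2 * pi)))"
      unfolding norm_mult norm_power wl by (intro mult_left_mono) auto
    also have "\<dots> = exp (- (of_nat k * l) + K * (of_nat N * l / (2 * pi)))"
    proof -
      have "exp (- l) ^ k = exp (- (of_nat k * l))" by (simp flip: exp_of_nat_mult)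
      thus ?thesis by (simp only: exp_add)
    qed
    also have "- (of_nat k * l) + K * (of_nat N * l / (2 * pi)) \<le> - l"
    proof -
      have "(K * of_nat N / (2 * pi) + 1) * l \<le> of_nat k * l" using k l0 by (intro mult_right_mono) auto
      thus ?thesis by (simp add: algebra_simps)
    qed
    finally show ?thesis using wl by simp
  qed
  define G where "G w = (if w = 0 then 0 else w ^ k * g w)" for w
  have "G holomorphic_on ball 0 R"
  proof (rule no_isolated_singularity'[where K = "{0}"])
    have "g holomorphic_on ball 0 R - {0}"
      unfolding holomorphic_on_def
    proof
      fix w :: complex assume "w \<in> ball 0 R - {0}"
      hence "w \<noteq> 0" "norm w < 1" using R by auto
      thus "g field_differentiable (at w within ball 0 R - {0})"
        by (rule field_differentiable_at_within[OF g_diff])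
    qed
    hence "(\<lambda>w. w ^ k * g w) holomorphic_on ball 0 R - {0}" by (intro holomorphic_intros)
    thus "G holomorphic_on ball 0 R - {0}" by (rule holomorphic_transform) (auto simp: G_def)
    have "(G \<longlongrightarrow> 0) (at 0)"
    proof (rule Lim_null_comparison)
      show "\<forall>\<^sub>F w in at 0. norm (G w) \<le> norm w"
        unfolding eventually_at
      proof (intro exI[of _ R] conjI ballI impI)
        fix w :: complex assume "w \<noteq> 0 \<and> dist w 0 < R"
        thus "norm (G w) \<le> norm w" using bound[of w] by (simp add: G_def)
      qed (use R in simp)
      show "((\<lambda>w :: complex. norm w) \<longlongrightarrow> 0) (at 0)" by (rule tendsto_norm_zero) (rule tendsto_ident_at)
    qed
    thus "(G \<longlongrightarrow> G w) (at w within ball 0 R)" if "w \<in> {0}" for w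
      using that tendsto_within_subset[OF \<open>(G \<longlongrightarrow> 0) (at 0)\<close> subset_UNIV] by (simp add: G_def)
  qed auto
  hence "G analytic_on {0}" using R by (auto simp: analytic_at intro!: exI[of _ "ball 0 R"])
  hence "(\<lambda>w. G w / w ^ k) meromorphic_on {0}"
    by (intro meromorphic_intros analytic_on_imp_meromorphic_on analytic_intros) auto
  also have "?this \<longleftrightarrow> g meromorphic_on {0}"
  proof (rule meromorphic_on_cong)
    fix z :: complex assume "z \<in> {0}"
    thus "\<forall>\<^sub>F w in at z. G w / w ^ k = g w"
      by (auto simp: G_def eventually_at_filter)
  qed simp
  finally show ?thesis using main by blast
qed

no_notation fps_nth (infixl "$" 75)

text \<open>For Im \<tau> \<ge> 1 and determinant 1 one has |j| \<ge> 1, so the imaginary part does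
  not grow. On the strip |j| is at most linear in Im \<tau>, hence 1 / Im \<tau>' = |j|^2 / Im
  \<tau> is at most linear too.\<close>

lemma moebius_growth:
  fixes a b c d :: int and N :: nat
  assumes det: "a * d - b * c = 1" and \<tau>: "Im \<tau> \<ge> 1" "\<bar>Re \<tau>\<bar> \<le> of_nat N"
  defines "j \<equiv> of_int c * \<tau> + of_int d"
  defines "\<tau>' \<equiv> (of_int a * \<tau> + of_int b) / j"
  shows "Im \<tau>' \<le> Im \<tau>" "1 / Im \<tau>' \<le> (\<bar>of_int c\<bar> * (of_nat N + 1) + \<bar>of_int d\<bar>)\<^sup>2 * Im \<tau>"
proof -
  define y where "y = Im \<tau>"
  have y: "y \<ge> 1" using \<tau> by (simp add: y_def)
  have pos: "Im \<tau> > 0" using \<tau> by simp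
  have im: "Im \<tau>' = y / (norm j)\<^sup>2" and j: "j \<noteq> 0"
    using Im_moebius_pos[OF pos det] by (simp_all add: j_def \<tau>'_def y_def)
  have j1: "norm j \<ge> 1"
  proof (cases "c = 0")
    case True
    hence "d \<noteq> 0" using det by auto
    hence "\<bar>d\<bar> \<ge> 1" by linarith
    hence "\<bar>real_of_int d\<bar> \<ge> 1" by linarith
    thus ?thesis using True by (simp add: j_def)
  next
    case False
    hence "\<bar>c\<bar> \<ge> 1" by linarith
    hence "\<bar>real_of_int c\<bar> \<ge> 1" by linarith
    hence "1 * 1 \<le> \<bar>real_of_int c\<bar> * y" using y by (intro mult_mono) auto
    also have "\<dots> = \<bar>Im j\<bar>" using y by (simp add: j_def y_def abs_mult)
    also have "\<dots> \<le> norm j" by (rule abs_Im_le_cmod)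
    finally show ?thesis by simp
  qed
  have "1 \<le> (norm j)\<^sup>2" using j1 by simp
  hence "y / (norm j)\<^sup>2 \<le> y / 1" using y by (intro divide_left_mono) auto
  thus "Im \<tau>' \<le> Im \<tau>" by (simp add: im y_def)
  have "norm j \<le> \<bar>of_int c\<bar> * norm \<tau> + \<bar>of_int d\<bar>"
    unfolding j_def by (rule order.trans[OF norm_triangle_ineq]) (simp add: norm_mult)
  also have "norm \<tau> \<le> \<bar>Re \<tau>\<bar> + \<bar>Im \<tau>\<bar>" by (rule cmod_le)
  also have "\<dots> \<le> of_nat N * y + y"
  proof -
    have "of_nat N * 1 \<le> of_nat N * y" using y by (intro mult_left_mono) auto
    thus ?thesis using \<tau> by (simp add: y_def)
  qed
  also have "\<bar>of_int c\<bar> * (of_nat N * y + y) + \<bar>of_int d\<bar> \<le> \<bar>of_int c\<bar> * (of_nat N * y + y) + \<bar>of_int d\<bar> * y"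
    using y mult_left_mono[of 1 y "\<bar>of_int d\<bar>"] by simp
  also have "\<dots> = (\<bar>of_int c\<bar> * (of_nat N + 1) + \<bar>of_int d\<bar>) * y" by (simp add: algebra_simps)
  finally have "norm j \<le> (\<bar>of_int c\<bar> * (of_nat N + 1) + \<bar>of_int d\<bar>) * y"
    by (simp add: mult_left_mono)
  hence "(norm j)\<^sup>2 \<le> ((\<bar>of_int c\<bar> * (of_nat N + 1) + \<bar>of_int d\<bar>) * y)\<^sup>2" by (intro power_mono) auto
  hence "(norm j)\<^sup>2 / y \<le> ((\<bar>of_int c\<bar> * (of_nat N + 1) + \<bar>of_int d\<bar>) * y)\<^sup>2 / y" using y by (intro divide_right_mono) auto
  thus "1 / Im \<tau>' \<le> (\<bar>of_int c\<bar> * (of_nat N + 1) + \<bar>of_int d\<bar>)\<^sup>2 * Im \<tau>"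
    using y by (simp add: im y_def [symmetric] power_mult_distrib power2_eq_square)
qed

lemma SL2Z_entries:
  assumes "\<gamma> \<in> SL2Z"
  shows "\<gamma> $ 1 $ 1 * \<gamma> $ 2 $ 2 - \<gamma> $ 1 $ 2 * \<gamma> $ 2 $ 1 = 1"
  using assms by (simp add: SL2Z_def det_2)

lemma act_eq:
  "act \<gamma> \<tau> = (of_int (\<gamma> $ 1 $ 1) * \<tau> + of_int (\<gamma> $ 1 $ 2)) / (of_int (\<gamma> $ 2 $ 1) * \<tau> + of_int (\<gamma> $ 2 $ 2))"
  by (simp add: act_def moebius_def)

text \<open>The hypotheses on \<open>C\<close> and \<open>k\<close> are the two conditions on the
  indices: \<open>C\<close> is the order that completes the product to a quotient of Klein forms,
  and \<open>k\<close> is the integer that makes its multiplier trivial. All cusps are treated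
  alike, with the common period 28224.\<close>

lemma modular_function_eta_quot:
  assumes r: "0 < n" "n < 28" "0 < a" "a < 28" "0 < b" "b < 28" "0 < c" "c < 28" "0 < d" "d < 28"
    and C: "of_int C = eta_weight n - eta_weight a - eta_weight b - eta_weight c - eta_weight d - 637 / 2"
    and k: "3 * (int n ^ 2 - int a ^ 2 - int b ^ 2 - int c ^ 2 - int d ^ 2) - 882 = 4 * k"
    and f: "\<And>\<tau>. Im \<tau> > 0 \<Longrightarrow> f \<tau> = modular_eta_quot C n a b c d \<tau>"
  shows "modular_function_on (Gamma1 28224) f"
proof -
  define H where "H = modular_eta_quot C n a b c d"
  define N :: nat where "N = 28224"
  have H_hol: "H holomorphic_on {\<tau>. Im \<tau> > 0}" unfolding H_def by (rule holomorphic_modular_eta_quot[OF r])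
  have inv: "H ((of_int A * \<tau> + of_int B) / (of_int C' * \<tau> + of_int D)) = H \<tau>"
    if "Im \<tau> > 0" "in_Gamma1 A B C' D" for A B C' D \<tau>
    unfolding H_def modular_eta_quot_def by (rule eta_quot_Gamma1[OF that r C k])
  have "f holomorphic_on {\<tau>. Im \<tau> > 0}" using H_hol by (rule holomorphic_transform) (simp add: f H_def)
  hence "f analytic_on {\<tau>. Im \<tau> > 0}" by (simp add: analytic_on_open open_halfspace_Im_gt)
  hence 1: "f nicely_meromorphic_on {\<tau>. Im \<tau> > 0}" by (rule analytic_on_imp_nicely_meromorphic_on)
  have 2: "f (act \<gamma> \<tau>) = f \<tau>" if \<gamma>: "\<gamma> \<in> Gamma1 28224" and \<tau>: "Im \<tau> > 0" for \<gamma> \<tau>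
  proof -
    have det: "\<gamma> $ 1 $ 1 * \<gamma> $ 2 $ 2 - \<gamma> $ 1 $ 2 * \<gamma> $ 2 $ 1 = 1"
      using \<gamma> by (intro SL2Z_entries) (simp add: Gamma1_def)
    have "in_Gamma1 (\<gamma> $ 1 $ 1) (\<gamma> $ 1 $ 2) (\<gamma> $ 2 $ 1) (\<gamma> $ 2 $ 2)"
      using \<gamma> det by (simp add: in_Gamma1_def Gamma1_def cong_iff_dvd_diff)
    moreover have "Im (act \<gamma> \<tau>) > 0" unfolding act_eq by (rule Im_moebius_pos(3)[OF \<tau> det])
    ultimately show ?thesis using inv[OF \<tau>] f[OF \<tau>] f[of "act \<gamma> \<tau>"] by (simp add: H_def act_eq)
  qed
  have 3: "\<exists>g. g meromorphic_on {0} \<and> (\<forall>\<tau>. Im \<tau> > 0 \<longrightarrow> f (act \<gamma> \<tau>) = g (exp (2 * of_real pi * \<i> * \<tau> / of_nat N)))"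
    if \<gamma>: "\<gamma> \<in> SL2Z" for \<gamma>
  proof -
    define A B C' D where "A = \<gamma> $ 1 $ 1" "B = \<gamma> $ 1 $ 2" "C' = \<gamma> $ 2 $ 1" "D = \<gamma> $ 2 $ 2"
    note defs = this
    have det: "A * D - B * C' = 1" unfolding defs by (rule SL2Z_entries[OF \<gamma>])
    have detc: "of_int A * of_int D - of_int B * of_int C' = (1 :: complex)"
      using arg_cong[OF det, of "of_int :: int \<Rightarrow> complex"] by simp
    define m where "m \<tau> = (of_int A * \<tau> + of_int B) / (of_int C' * \<tau> + of_int D)" for \<tau> :: complex
    have m_pos: "Im (m \<tau>) > 0" if "Im \<tau> > 0" for \<tau> unfolding m_def by (rule Im_moebius_pos(3)[OF that det])
    have j_nz: "of_int C' * \<tau> + of_int D \<noteq> 0" if "Im \<tau> > 0" for \<tau> by (rule Im_moebius_pos(1)[OF that det])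
    have "\<exists>g. g meromorphic_on {0} \<and> (\<forall>\<tau>. Im \<tau> > 0 \<longrightarrow> H (m \<tau>) = g (exp (2 * of_real pi * \<i> * \<tau> / of_nat N)))"
    proof (rule periodic_meromorphic_at_cusp)
      show "N > 0" by (simp add: N_def)
      have "m holomorphic_on {\<tau>. Im \<tau> > 0}" unfolding m_def using j_nz by (intro holomorphic_intros) auto
      hence "(H \<circ> m) holomorphic_on {\<tau>. Im \<tau> > 0}"
        by (rule holomorphic_on_compose_gen[OF _ H_hol]) (use m_pos in auto)
      thus "(\<lambda>\<tau>. H (m \<tau>)) holomorphic_on {\<tau>. Im \<tau> > 0}" by (simp add: o_def)
      show "H (m (\<tau> + of_nat N)) = H (m \<tau>)" if \<tau>: "Im \<tau> > 0" for \<tau>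
      proof -
        define j where "j = of_int C' * \<tau> + of_int D"
        define K :: int where "K = int N"
        have j: "j \<noteq> 0" using j_nz[OF \<tau>] by (simp add: j_def)
        have mj: "m \<tau> * j = of_int A * \<tau> + of_int B" using j by (simp add: m_def j_def)
        \<comment> \<open>These are the entries of \<gamma> T^K \<gamma>^-1, where T is the
          translation by 1 and K = 28224. Each entry differs from that of the identity by a multiple
          of K, so invariance of \<open>H\<close> gives the period K of H(m \<tau>).\<close>
        have ggg: "in_Gamma1 (1 - A * C' * K) (A * A * K) (- (C' * C' * K)) (1 + A * C' * K)"
          by (simp add: in_Gamma1_def K_def N_def algebra_simps)
        have num: "(of_int (1 - A * C' * K) * m \<tau> + of_int (A * A * K)) * j = of_int A * (\<tau> + of_nat N) + of_int B"
        proof -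
          have "(of_int (1 - A * C' * K) * m \<tau> + of_int (A * A * K)) * j =
             of_int (1 - A * C' * K) * (m \<tau> * j) + of_int (A * A * K) * j" by (simp add: algebra_simps)
          also have "\<dots> = of_int A * \<tau> + of_int B + of_int A * of_int K * (of_int A * of_int D - of_int B * of_int C')"
            unfolding mj by (simp add: j_def algebra_simps)
          finally show ?thesis unfolding detc by (simp add: K_def algebra_simps)
        qed
        have den: "(of_int (- (C' * C' * K)) * m \<tau> + of_int (1 + A * C' * K)) * j = of_int C' * (\<tau> + of_nat N) + of_int D"
        proof -
          have "(of_int (- (C' * C' * K)) * m \<tau> + of_int (1 + A * C' * K)) * j =
             of_int (- (C' * C' * K)) * (m \<tau> * j) + of_int (1 + A * C' * K) * j" by (simp add: algebra_simps)
          also have "\<dots> = j + of_int C' * of_int K * (of_int A * of_int D - of_int B * of_int C')"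
            unfolding mj by (simp add: j_def algebra_simps)
          finally show ?thesis unfolding detc by (simp add: K_def j_def algebra_simps)
        qed
        have "m (\<tau> + of_nat N) = ((of_int (1 - A * C' * K) * m \<tau> + of_int (A * A * K)) * j) /
            ((of_int (- (C' * C' * K)) * m \<tau> + of_int (1 + A * C' * K)) * j)"
          by (simp only: num den m_def [of "\<tau> + of_nat N"])
        also have "\<dots> = (of_int (1 - A * C' * K) * m \<tau> + of_int (A * A * K)) /
            (of_int (- (C' * C' * K)) * m \<tau> + of_int (1 + A * C' * K))"
          using j by simp
        finally show ?thesis using inv[OF m_pos[OF \<tau>] ggg] by simp
      qed
      define L :: real where "L = (\<bar>of_int C'\<bar> * (of_nat N + 1) + \<bar>of_int D\<bar>)\<^sup>2"
      show "norm (H (m \<tau>)) \<le> exp ((2 * pi * \<bar>of_int C\<bar> + 36 * (1 + L)) * Im \<tau>)"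
        if \<tau>: "Im \<tau> \<ge> 1" "\<bar>Re \<tau>\<bar> \<le> of_nat N" for \<tau>
      proof -
        have im: "Im (m \<tau>) \<le> Im \<tau>" "1 / Im (m \<tau>) \<le> L * Im \<tau>"
          unfolding m_def L_def by (rule moebius_growth[OF det \<tau>])+
        have "norm (H (m \<tau>)) \<le> exp (2 * pi * \<bar>of_int C\<bar> * Im (m \<tau>) + 36 * (1 + 1 / Im (m \<tau>)))"
          unfolding H_def by (rule norm_modular_eta_quot_le[OF _ r]) (use m_pos \<tau> in auto)
        also have "2 * pi * \<bar>of_int C\<bar> * Im (m \<tau>) + 36 * (1 + 1 / Im (m \<tau>)) \<le>
           2 * pi * \<bar>of_int C\<bar> * Im \<tau> + 36 * (Im \<tau> + L * Im \<tau>)"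
          using im \<tau> by (intro add_mono mult_left_mono) auto
        also have "\<dots> = (2 * pi * \<bar>of_int C\<bar> + 36 * (1 + L)) * Im \<tau>" by (simp add: algebra_simps)
        finally show ?thesis by simp
      qed
    qed
    then obtain g where g: "g meromorphic_on {0}" "\<And>\<tau>. Im \<tau> > 0 \<Longrightarrow> H (m \<tau>) = g (exp (2 * of_real pi * \<i> * \<tau> / of_nat N))"
      by blast
    have "f (act \<gamma> \<tau>) = g (exp (2 * of_real pi * \<i> * \<tau> / of_nat N))" if "Im \<tau> > 0" for \<tau>
    proof -
      have "act \<gamma> \<tau> = m \<tau>" by (simp add: act_eq m_def defs)
      thus ?thesis using f[OF m_pos[OF that]] g(2)[OF that] by (simp add: H_def)
    qed
    thus ?thesis using g(1) by blast
  qed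
  show ?thesis unfolding modular_function_on_def
  proof (intro conjI ballI)
    show "f nicely_meromorphic_on upper_half_plane" by (rule 1)
    fix \<gamma> \<tau> assume "\<gamma> \<in> Gamma1 28224" "\<tau> \<in> upper_half_plane"
    thus "f (act \<gamma> \<tau>) = f \<tau>" by (intro 2) auto
  next
    fix \<gamma> assume "\<gamma> \<in> SL2Z"
    then obtain g where g: "g meromorphic_on {0}" "\<forall>\<tau>. Im \<tau> > 0 \<longrightarrow> f (act \<gamma> \<tau>) = g (exp (2 * of_real pi * \<i> * \<tau> / of_nat N))"
      using 3 by blast
    show "\<exists>h::nat. h > 0 \<and> (\<exists>g Y. g meromorphic_on {0} \<and> Y \<ge> 0 \<and>
        (\<forall>\<tau>. Im \<tau> > Y \<longrightarrow> f (act \<gamma> \<tau>) = g (exp (2 * of_real pi * \<i> * \<tau> / of_nat h))))"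
      using g by (intro exI[of _ N] conjI exI[of _ g] exI[of _ 0]) (auto simp: N_def)
  qed
qed

section \<open>From Nahm sums to infinite products\<close>

lemma qpow_eq_ee: "qpow \<tau> x = ee (of_rat x * \<tau>)"
  by (simp add: qpow_def ee_def mult.assoc)

text \<open>With q = ee(42 \<tau>) the variable of the Nahm sum at 168 \<tau> is q^4, so
  \<open>e i j\<close> is four times the exponent of the Nahm sum without C. The exponent is an
  integer-valued function in order to admit the term -2i.\<close>

lemma nahm_sum_eq:
  fixes \<tau> :: complex and \<beta>1 \<beta>2 C :: rat and e :: "nat \<Rightarrow> nat \<Rightarrow> int"
  assumes \<tau>: "Im \<tau> > 0" and q: "q = ee (42 * \<tau>)"
    and S: "((\<lambda>(i, j). q powi e i j / (qpoch (q ^ 4) (q ^ 4) i * qpoch (q ^ 4) (q ^ 4) j)) has_sum S) UNIV"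
    and e: "\<And>i j. of_int (e i j) = 3 * of_nat i ^ 2 + 4 * of_nat j ^ 2 + 4 * of_nat i * of_nat j + 4 * \<beta>1 * of_nat i + 4 * \<beta>2 * of_nat j"
  shows "nahm_sum (vector [vector [3/2, 1], vector [1, 2]]) (vector [\<beta>1, \<beta>2]) C (168 * \<tau>) = ee (168 * of_rat C * \<tau>) * S"
proof -
  define A :: "rat ^ 2 ^ 2" where "A = vector [vector [3/2, 1], vector [1, 2]]"
  define B :: "rat ^ 2" where "B = vector [\<beta>1, \<beta>2]"
  have q1: "qpow (168 * \<tau>) 1 = q ^ 4"
    using ee_of_nat_mult[of 4 "42 * \<tau>"] by (simp add: qpow_eq_ee q)
  have ee_powi: "ee (of_int k * x) = ee x powi k" for k :: int and x
    by (simp add: ee_def exp_power_int mult_ac)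
  have ex: "qpow (168 * \<tau>) (1/2 * dot v (A *v v) + dot v B + C) = ee (168 * of_rat C * \<tau>) * q powi e i j"
    if v: "v = vector [of_nat i, of_nat j]" for v i j
  proof -
    have "1/2 * dot v (A *v v) + dot v B = of_int (e i j) / 4"
      unfolding e v dot_def A_def B_def
      by (simp add: sum_2 matrix_vector_mult_def vector_2 field_simps power2_eq_square)
    hence "of_rat (1/2 * dot v (A *v v) + dot v B + C) = of_int (e i j) / 4 + (of_rat C :: complex)"
      by (simp only: of_rat_add of_rat_divide of_rat_of_int_eq of_rat_numeral_eq)
    hence "of_rat (1/2 * dot v (A *v v) + dot v B + C) * (168 * \<tau>) = 168 * of_rat C * \<tau> + of_int (e i j) * (42 * \<tau>)"
      by (simp only:) (simp add: algebra_simps)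
    thus ?thesis by (simp only: qpow_eq_ee ee_add ee_powi q)
  qed
  have "nahm_sum A B C (168 * \<tau>) = (\<Sum>\<^sub>\<infinity>x\<in>UNIV. ee (168 * of_rat C * \<tau>) *
     (case x of (i, j) \<Rightarrow> q powi e i j / (qpoch (q ^ 4) (q ^ 4) i * qpoch (q ^ 4) (q ^ 4) j)))"
    unfolding nahm_sum_def Let_def q1
    by (intro infsum_cong) (auto simp only: ex [OF refl] times_divide_eq_right split: prod.splits)
  also have "\<dots> = ee (168 * of_rat C * \<tau>) * S"
    by (intro infsumI has_sum_cmult_right S)
  finally show ?thesis by (simp only: A_def B_def)
qed

lemmas nahm_sum_eq_nat = nahm_sum_eq [where e = "\<lambda>i j. int (f i j)" for f, unfolded power_int_of_nat of_int_of_nat_eq]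

text \<open>The constants are forced: for the three index tuples the orders given by
  \<open>eta_weight\<close> are 1, -5 and 25, which are the values 168 C. In the third case the
  statement in English has 5/21, argument 84 \<tau> and level 14112. At 84 \<tau> the function with
  5/21 is the one with 25/168 times ee(15 \<tau> / 2), a factor that no congruence subgroup leaves
  invariant. The third function is therefore stated with 25/168, argument 168 \<tau> and level
  28224.\<close>

theorem theorem3p8:
  shows "(\<forall>q::complex. norm q < 1 \<longrightarrow>
      ((\<lambda>(i::nat, j::nat). q powi (3 * int i ^ 2 + 4 * int j ^ 2 + 4 * int i * int j - 2 * int i) /
          (qpoch (q ^ 4) (q ^ 4) i * qpoch (q ^ 4) (q ^ 4) j)) has_sum
        (J 14 q * J 28 q ^ 2 * J2 2 28 q / (J2 1 28 q * J2 4 28 q * J2 8 28 q * J2 13 28 q))) UNIV \<and>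
      ((\<lambda>(i::nat, j::nat). q ^ (i ^ 2 + 4 * i * j + 4 * j ^ 2 + 4 * j) /
          (qpoch (q ^ 4) (q ^ 4) i * qpoch (q ^ 8) (q ^ 8) j)) has_sum
        (J 14 q * J 28 q ^ 2 * J2 2 28 q / (J2 1 28 q * J2 4 28 q * J2 8 28 q * J2 13 28 q))) UNIV \<and>
      ((\<lambda>(i::nat, j::nat). q ^ (3 * i ^ 2 + 4 * j ^ 2 + 4 * i * j) /
          (qpoch (q ^ 4) (q ^ 4) i * qpoch (q ^ 4) (q ^ 4) j)) has_sum
        (J 14 q * J 28 q ^ 2 * J2 6 28 q / (J2 3 28 q * J2 4 28 q * J2 11 28 q * J2 12 28 q))) UNIV \<and>
      ((\<lambda>(i::nat, j::nat). q ^ (i ^ 2 + 4 * i * j + 4 * j ^ 2 + 2 * i) /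
          (qpoch (q ^ 4) (q ^ 4) i * qpoch (q ^ 8) (q ^ 8) j)) has_sum
        (J 14 q * J 28 q ^ 2 * J2 6 28 q / (J2 3 28 q * J2 4 28 q * J2 11 28 q * J2 12 28 q))) UNIV \<and>
      ((\<lambda>(i::nat, j::nat). q ^ (3 * i ^ 2 + 4 * j ^ 2 + 4 * i * j + 2 * i + 4 * j) /
          (qpoch (q ^ 4) (q ^ 4) i * qpoch (q ^ 4) (q ^ 4) j)) has_sum
        (J 14 q * J 28 q ^ 2 * J2 10 28 q / (J2 5 28 q * J2 8 28 q * J2 9 28 q * J2 12 28 q))) UNIV \<and>
      ((\<lambda>(i::nat, j::nat). q ^ (i ^ 2 + 4 * i * j + 4 * j ^ 2 + 4 * i + 4 * j) /
          (qpoch (q ^ 4) (q ^ 4) i * qpoch (q ^ 8) (q ^ 8) j)) has_sum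
        (J 14 q * J 28 q ^ 2 * J2 10 28 q / (J2 5 28 q * J2 8 28 q * J2 9 28 q * J2 12 28 q))) UNIV) \<and>
    (let A = (vector [vector [3/2, 1], vector [1, 2]] :: rat ^ 2 ^ 2) in
      modular_function_on (Gamma1 28224) (\<lambda>\<tau>. nahm_sum A (vector [-1/2, 0]) (1/168) (168 * \<tau>)) \<and>
      modular_function_on (Gamma1 28224) (\<lambda>\<tau>. nahm_sum A (vector [0, 0]) (-5/168) (168 * \<tau>)) \<and>
      modular_function_on (Gamma1 28224) (\<lambda>\<tau>. nahm_sum A (vector [1/2, 1]) (25/168) (168 * \<tau>)))"
proof -
  have q: "norm (ee (42 * \<tau>)) < 1" if "Im \<tau> > 0" for \<tau>
    using that by (intro norm_ee_less_1) simp
  note id = mod28_identities[OF q, unfolded mod28_identities_def]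
  have 1: "nahm_sum (vector [vector [3/2, 1], vector [1, 2]]) (vector [-1/2, 0]) (1/168) (168 * \<tau>) =
      modular_eta_quot 1 2 1 4 8 13 \<tau>" if \<tau>: "Im \<tau> > 0" for \<tau>
    unfolding modular_eta_quot_def eta_quot_def
    by (subst nahm_sum_eq[OF \<tau> refl conjunct1[OF id[OF \<tau>]]]) (simp_all add: of_rat_divide)
  have 2: "nahm_sum (vector [vector [3/2, 1], vector [1, 2]]) (vector [0, 0]) (-5/168) (168 * \<tau>) =
      modular_eta_quot (-5) 6 3 4 11 12 \<tau>" if \<tau>: "Im \<tau> > 0" for \<tau>
    unfolding modular_eta_quot_def eta_quot_def
    by (subst nahm_sum_eq_nat[OF \<tau> refl id[OF \<tau>, THEN conjunct2, THEN conjunct2, THEN conjunct1]])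
       (simp_all add: of_rat_divide of_rat_minus)
  have 3: "nahm_sum (vector [vector [3/2, 1], vector [1, 2]]) (vector [1/2, 1]) (25/168) (168 * \<tau>) =
      modular_eta_quot 25 10 5 8 9 12 \<tau>" if \<tau>: "Im \<tau> > 0" for \<tau>
    unfolding modular_eta_quot_def eta_quot_def
    by (subst nahm_sum_eq_nat[OF \<tau> refl id[OF \<tau>, THEN conjunct2, THEN conjunct2, THEN conjunct2, THEN conjunct2, THEN conjunct1]])
       (simp_all add: of_rat_divide)
  have "modular_function_on (Gamma1 28224) (\<lambda>\<tau>. nahm_sum (vector [vector [3/2, 1], vector [1, 2]]) (vector [-1/2, 0]) (1/168) (168 * \<tau>))"
    \<comment> \<open>In each case k is (3 (n^2 - a^2 - b^2 - c^2 - d^2) - 882) / 4; here it is (3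
      (4 - 1 - 16 - 64 - 169) - 882) / 4.\<close>
    by (rule modular_function_eta_quot[where k = "-405", OF _ _ _ _ _ _ _ _ _ _ _ _ 1]) (simp_all add: eta_weight_def)
  moreover have "modular_function_on (Gamma1 28224) (\<lambda>\<tau>. nahm_sum (vector [vector [3/2, 1], vector [1, 2]]) (vector [0, 0]) (-5/168) (168 * \<tau>))"
    by (rule modular_function_eta_quot[where k = "-411", OF _ _ _ _ _ _ _ _ _ _ _ _ 2]) (simp_all add: eta_weight_def)
  moreover have "modular_function_on (Gamma1 28224) (\<lambda>\<tau>. nahm_sum (vector [vector [3/2, 1], vector [1, 2]]) (vector [1/2, 1]) (25/168) (168 * \<tau>))"
    by (rule modular_function_eta_quot[where k = "-381", OF _ _ _ _ _ _ _ _ _ _ _ _ 3]) (simp_all add: eta_weight_def)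
  ultimately show ?thesis
    unfolding Let_def using mod28_identities[unfolded mod28_identities_def] by blast
qed

end
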